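(* Let $V$ be a three-dimensional Euclidean vector space over $\mathbb{R}$ and let $C:\mathcal{H}\to\mathcal{H}$ be the operator of common lines. Then $C$ admits a discrete spectrum consisting of $\lambda_1,\lambda_2,\dots,\lambda_n,\dots$ together with $\lambda_\infty=0$, where for every $n\ge 1$ $$\lambda_n=\frac{(-1)^{n-1}}{n(n+1)}.$$ Moreover, for every $n\geq 1$ the eigenspace $\mathcal{H}(\lambda_n)$ of $C$ for the eigenvalue $\lambda_n$ satisfies $\dim\mathcal{H}(\lambda_n)=2n+1$.
   Context: Let $B$ be the inner product of $V$ and $S(V)$ its unit sphere. Let $\mathfrak{H}\to S(V)$ be the real vector bundle with fiber $\mathfrak{H}_{|x}=x^{\perp}$ at $x$, and let $\mathcal{H}=\Gamma(S(V),\mathfrak{H})$ be its space of smooth global sections, with inner product $(s_1,s_2)=\int_{S(V)}B(s_1(x),s_2(x))\,dx$, where $dx$ is the normalized Haar (rotation invariant, total mass one) measure on the sphere. One does not distinguish between $\mathcal{H}$ and its Hilbert space completion. For $x,y\in S(V)$ with $x\ne\pm y$, let $C_{x,y}:x^\perp\cap y^\perp\hookrightarrow x^\perp$ and $C_{y,x}:x^\perp\cap y^\perp\hookrightarrow y^\perp$ be the inclusions of the line $x^\perp\cap y^\perp$, and let $C(x,y)=C_{x,y}\circ C_{y,x}^{t}:y^\perp\to x^\perp$ (transpose with respect to the Euclidean structures). The operator of common lines is the symmetric integral operator $$C(s)(x)=\int_{y\in S(V)}C(x,y)\big(s(y)\big)\,dy,\qquad s\in\mathcal{H}.$$ *)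

theory Defs
  imports "HOL-Probability.Probability"
begin

section \<open>The invariant probability measure on the unit sphere\<close>

text \<open>The uniform distribution on the unit ball, pushed radially onto the sphere; the lemmas
  below show that it has total mass one and is invariant under all orthogonal transformations,
  which determines it uniquely.\<close>

definition sphere_haar :: "'a::euclidean_space measure" where
  "sphere_haar =
     restrict_space (distr (uniform_measure lborel (ball 0 1)) borel sgn) (sphere 0 1)"

lemma measurable_sgn_euclidean [measurable]:
  "(sgn :: 'a::euclidean_space \<Rightarrow> 'a) \<in> borel_measurable borel"
  unfolding sgn_div_norm[abs_def] by measurable

lemma space_sphere_haar [simp]: "space (sphere_haar :: 'a::euclidean_space measure) = sphere 0 1"
  by (simp add: sphere_haar_def space_restrict_space)

lemma sets_sphere_haar [simp, measurable_cong]: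
  "sets (sphere_haar :: 'a::euclidean_space measure) = sets (restrict_space borel (sphere 0 1))"
  unfolding sphere_haar_def by (rule sets_restrict_space_cong) simp

lemma emeasure_unit_ball_bounds:
  "emeasure lborel (ball (0::'a::euclidean_space) 1) \<noteq> 0"
  "emeasure lborel (ball (0::'a::euclidean_space) 1) \<noteq> \<infinity>"
proof -
  have "emeasure lborel (ball (0::'a) 1) < \<infinity>" by (rule emeasure_lborel_ball_finite)
  then show "emeasure lborel (ball (0::'a) 1) \<noteq> \<infinity>" by simp
  have "measure lborel (ball (0::'a) 1) > 0" by (rule content_ball_pos) simp
  then show "emeasure lborel (ball (0::'a) 1) \<noteq> 0" by (auto simp: measure_def)
qed

lemma emeasure_sphere_haar:
  assumes "A \<in> sets borel" "A \<subseteq> sphere (0::'a::euclidean_space) 1"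
  shows "emeasure sphere_haar A =
    emeasure lborel {x \<in> ball 0 1. sgn x \<in> A} / emeasure lborel (ball (0::'a) 1)"
proof -
  have "emeasure sphere_haar A = emeasure (distr (uniform_measure lborel (ball 0 1)) borel sgn) A"
    unfolding sphere_haar_def using assms by (intro emeasure_restrict_space) auto
  also have "\<dots> = emeasure (uniform_measure lborel (ball 0 1)) (sgn -` A)"
    using assms by (subst emeasure_distr) auto
  also have "\<dots> = emeasure lborel (ball 0 1 \<inter> sgn -` A) / emeasure lborel (ball (0::'a) 1)"
    using assms measurable_sets_borel[OF measurable_sgn_euclidean, of A]
    by (subst emeasure_uniform_measure) auto
  also have "ball 0 1 \<inter> sgn -` A = {x \<in> ball 0 1. sgn x \<in> A}" by auto
  finally show ?thesis .
qed

lemma prob_space_sphere_haar: "prob_space (sphere_haar :: 'a::euclidean_space measure)"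
proof
  have "{x \<in> ball 0 1. sgn x \<in> sphere (0::'a) 1} = ball 0 1 - {0}"
    by (auto simp: norm_sgn)
  then have "emeasure lborel {x \<in> ball 0 1. sgn x \<in> sphere (0::'a) 1} = emeasure lborel (ball (0::'a) 1)"
    by (simp add: emeasure_Diff_null_set[OF finite_imp_null_set_lborel])
  then show "emeasure sphere_haar (space (sphere_haar :: 'a measure)) = 1"
    using emeasure_unit_ball_bounds[where 'a='a]
    by (subst emeasure_sphere_haar) (auto simp: ennreal_divide_self less_top)
qed

lemma lborel_distr_orthogonal:
  fixes T :: "'a::euclidean_space \<Rightarrow> 'a"
  assumes T: "orthogonal_transformation T"
  shows "distr lborel borel T = lborel"
proof -
  define \<mu> where "\<mu> = distr lborel borel T"
  have lin: "linear T" and nrm: "\<And>x. norm (T x) = norm x"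
    using T by (auto simp: orthogonal_transformation)
  have T_meas [measurable]: "T \<in> borel_measurable borel"
    using lin by (intro borel_measurable_continuous_onI linear_continuous_on)
      (simp add: linear_conv_bounded_linear)
  have sets_\<mu> [simp, measurable_cong]: "sets \<mu> = sets borel" and [simp]: "space \<mu> = UNIV"
    by (auto simp: \<mu>_def)
  have ball: "emeasure \<mu> (ball y 1) = emeasure lborel (ball (0::'a) 1)" for y
  proof -
    obtain z where z: "y = T z" using orthogonal_transformation_surj[OF T] by (metis surjD)
    have "T -` ball y 1 = ball z 1"
      unfolding z by (auto simp: dist_norm linear_diff[OF lin, symmetric] nrm)
    then have "emeasure \<mu> (ball y 1) = emeasure lborel (ball z 1)"
      by (simp add: \<mu>_def emeasure_distr)
    also have "\<dots> = emeasure lborel (ball (0::'a) 1)"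
      by (simp add: emeasure_ball)
    finally show ?thesis .
  qed
  have trans: "(\<integral>\<^sup>+x. f (x + y) \<partial>\<mu>) = (\<integral>\<^sup>+x. f x \<partial>\<mu>)"
    if [measurable]: "f \<in> borel_measurable borel" for f :: "'a \<Rightarrow> ennreal" and y
  proof -
    obtain z where z: "y = T z" using orthogonal_transformation_surj[OF T] by (metis surjD)
    have "(\<integral>\<^sup>+x. f (x + y) \<partial>\<mu>) = (\<integral>\<^sup>+x. f (T (z + x)) \<partial>lborel)"
      by (simp add: \<mu>_def nn_integral_distr z linear_add[OF lin] add.commute)
    also have "\<dots> = (\<integral>\<^sup>+x. f (T x) \<partial>distr lborel borel ((+) z))"
      by (subst nn_integral_distr) auto
    also have "\<dots> = (\<integral>\<^sup>+x. f x \<partial>\<mu>)"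
      by (simp add: \<mu>_def nn_integral_distr lborel_distr_plus)
    finally show ?thesis .
  qed
  interpret \<mu>: sigma_finite_measure \<mu>
  proof
    show "\<exists>A. countable A \<and> A \<subseteq> sets \<mu> \<and> \<Union>A = space \<mu> \<and> (\<forall>a\<in>A. emeasure \<mu> a \<noteq> \<infinity>)"
    proof (intro exI[of _ "range (\<lambda>n. ball 0 (real n))"] conjI ballI)
      fix a assume "a \<in> range (\<lambda>n. ball (0::'a) (real n))"
      then obtain n where n: "a = ball 0 (real n)" by auto
      have "T -` a = ball 0 (real n)" unfolding n by (auto simp: nrm)
      then have "emeasure \<mu> a = emeasure lborel (ball (0::'a) (real n))"
        by (simp add: \<mu>_def emeasure_distr n)
      then show "emeasure \<mu> a \<noteq> \<infinity>"
        using emeasure_lborel_ball_finite[of "0::'a" "real n"] by simp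
    next
      have "\<exists>n. norm x < real n" for x :: 'a by (rule reals_Archimedean2)
      then show "\<Union> (range (\<lambda>n. ball (0::'a) (real n))) = space \<mu>" by auto
    qed auto
  qed
  interpret pair_sigma_finite \<mu> "lborel :: 'a measure" ..
  define B :: "'a set" where "B = ball 0 1"
  have [measurable]: "B \<in> sets borel" by (simp add: B_def)
  have "emeasure \<mu> A = emeasure lborel A" if [measurable]: "A \<in> sets borel" for A
  proof -
    have "emeasure \<mu> A * emeasure lborel B
        = (\<integral>\<^sup>+y. (\<integral>\<^sup>+x. indicator A x * indicator B y \<partial>\<mu>) \<partial>lborel)"
      by (simp add: nn_integral_multc nn_integral_cmult)
    also have "\<dots> = (\<integral>\<^sup>+y. (\<integral>\<^sup>+x. indicator A (x + y) * indicator B y \<partial>\<mu>) \<partial>lborel)"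
    proof (rule nn_integral_cong)
      fix y :: 'a
      show "(\<integral>\<^sup>+x. (indicator A x :: ennreal) * indicator B y \<partial>\<mu>)
          = (\<integral>\<^sup>+x. indicator A (x + y) * indicator B y \<partial>\<mu>)"
        by (rule trans[of "\<lambda>x. indicator A x * indicator B y" y, symmetric]) simp
    qed
    also have "\<dots> = (\<integral>\<^sup>+x. (\<integral>\<^sup>+y. indicator A (x + y) * indicator B y \<partial>lborel) \<partial>\<mu>)"
      by (rule Fubini') measurable
    also have "\<dots> = (\<integral>\<^sup>+x. (\<integral>\<^sup>+y. indicator A y * indicator B (y - x) \<partial>lborel) \<partial>\<mu>)"
    proof (rule nn_integral_cong)
      fix x
      have "(\<integral>\<^sup>+y. indicator A y * indicator B (y - x) \<partial>lborel)
          = (\<integral>\<^sup>+y. indicator A y * indicator B (y - x) \<partial>distr lborel borel ((+) x))"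
        by (simp add: lborel_distr_plus)
      also have "\<dots> = (\<integral>\<^sup>+y. indicator A (x + y) * indicator B y \<partial>lborel)"
        by (subst nn_integral_distr) auto
      finally show "(\<integral>\<^sup>+y. indicator A (x + y) * indicator B y \<partial>lborel)
          = (\<integral>\<^sup>+y. indicator A y * indicator B (y - x) \<partial>lborel)" by simp
    qed
    also have "\<dots> = (\<integral>\<^sup>+y. (\<integral>\<^sup>+x. indicator A y * indicator B (y - x) \<partial>\<mu>) \<partial>lborel)"
      by (rule Fubini'[symmetric]) measurable
    also have "\<dots> = (\<integral>\<^sup>+y. indicator A y * emeasure lborel B \<partial>lborel)"
    proof (rule nn_integral_cong)
      fix y :: 'a
      have "(\<integral>\<^sup>+x. indicator A y * indicator B (y - x) \<partial>\<mu>)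
          = (\<integral>\<^sup>+x. indicator A y * indicator (ball y 1) x \<partial>\<mu>)"
        by (intro nn_integral_cong) (auto simp: B_def indicator_def dist_norm norm_minus_commute)
      also have "\<dots> = indicator A y * emeasure \<mu> (ball y 1)"
        by (subst nn_integral_cmult) (auto simp: borel_measurable_indicator_iff)
      finally show "(\<integral>\<^sup>+x. indicator A y * indicator B (y - x) \<partial>\<mu>) = indicator A y * emeasure lborel B"
        by (simp only: ball B_def)
    qed
    also have "\<dots> = emeasure lborel A * emeasure lborel B"
      by (simp add: nn_integral_multc)
    finally show ?thesis
      using emeasure_unit_ball_bounds[where 'a='a]
      by (metis B_def ennreal_mult_cancel_left infinity_ennreal_def mult.commute)
  qed
  then show ?thesis unfolding \<mu>_def[symmetric] by (intro measure_eqI) auto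
qed

lemma sphere_haar_distr_orthogonal:
  fixes T :: "'a::euclidean_space \<Rightarrow> 'a"
  assumes T: "orthogonal_transformation T"
  shows "distr sphere_haar sphere_haar T = sphere_haar"
proof (rule measure_eqI)
  have lin: "linear T" and nrm: "\<And>x. norm (T x) = norm x"
    using T by (auto simp: orthogonal_transformation)
  have T_meas [measurable]: "T \<in> borel_measurable borel"
    using lin by (intro borel_measurable_continuous_onI linear_continuous_on)
      (simp add: linear_conv_bounded_linear)
  have "T \<in> restrict_space borel (sphere 0 1) \<rightarrow>\<^sub>M restrict_space borel (sphere 0 1)"
    by (intro measurable_restrict_space3 T_meas) (auto simp: nrm)
  then have T_meas': "T \<in> sphere_haar \<rightarrow>\<^sub>M sphere_haar"
    by (simp cong: measurable_cong_sets)
  fix A assume "A \<in> sets (distr sphere_haar sphere_haar T)"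
  then have A': "A \<in> sets sphere_haar" by simp
  then have A [measurable]: "A \<in> sets borel" and sub: "A \<subseteq> sphere 0 1"
    by (auto simp: sets_restrict_space)
  have TA: "T -` A \<in> sets borel" using measurable_sets_borel[OF T_meas A] .
  have sub': "T -` A \<subseteq> sphere 0 1" using sub by (auto simp: nrm dest!: subsetD)
  have sgnT: "sgn (T x) = T (sgn x)" for x
    by (simp add: sgn_div_norm nrm linear_scale[OF lin])
  have "emeasure (distr sphere_haar sphere_haar T) A = emeasure sphere_haar (T -` A)"
    using sub' by (subst emeasure_distr[OF T_meas' A']) (simp add: Int_absorb2)
  also have "\<dots> = emeasure lborel {x \<in> ball 0 1. T (sgn x) \<in> A} / emeasure lborel (ball (0::'a) 1)"
    by (subst emeasure_sphere_haar[OF TA sub']) simp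
  also have "{x \<in> ball 0 1. T (sgn x) \<in> A} = T -` {x \<in> ball 0 1. sgn x \<in> A}"
    by (auto simp: nrm sgnT)
  also have "emeasure lborel \<dots> = emeasure (distr lborel borel T) {x \<in> ball 0 1. sgn x \<in> A}"
    by (subst emeasure_distr) auto
  also have "\<dots> = emeasure lborel {x \<in> ball 0 1. sgn x \<in> A}"
    by (simp add: lborel_distr_orthogonal[OF T])
  finally show "emeasure (distr sphere_haar sphere_haar T) A = emeasure sphere_haar A"
    by (simp add: emeasure_sphere_haar[OF A sub])
qed simp

section \<open>The Hilbert space of sections\<close>

text \<open>A section of the bundle with fiber \<open>x\<^sup>\<bottom>\<close> at \<open>x\<close> is a tangential vector field on the sphere,
  represented by a function on the ambient space of which only the values on the unit sphere
  matter.\<close>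

definition tangent_plane :: "'a::euclidean_space \<Rightarrow> 'a set" where
  "tangent_plane x = {v. v \<bullet> x = 0}"

definition section_of_bundle :: "('a::euclidean_space \<Rightarrow> 'a) \<Rightarrow> bool" where
  "section_of_bundle s \<longleftrightarrow> (\<forall>x\<in>sphere 0 1. s x \<in> tangent_plane x)"

lemma section_of_bundleI: "(\<And>x. norm x = 1 \<Longrightarrow> s x \<bullet> x = 0) \<Longrightarrow> section_of_bundle s"
  by (simp add: section_of_bundle_def tangent_plane_def)

lemma section_of_bundleD: "section_of_bundle s \<Longrightarrow> norm x = 1 \<Longrightarrow> s x \<bullet> x = 0"
  by (simp add: section_of_bundle_def tangent_plane_def)

definition l2_section :: "('a::euclidean_space \<Rightarrow> 'a) \<Rightarrow> bool" where
  "l2_section s \<longleftrightarrow> section_of_bundle s \<and> s \<in> borel_measurable sphere_haar \<and>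
     integrable sphere_haar (\<lambda>x. (norm (s x))\<^sup>2)"

definition l2_section_eq :: "('a::euclidean_space \<Rightarrow> 'a) \<Rightarrow> ('a \<Rightarrow> 'a) \<Rightarrow> bool" where
  "l2_section_eq s t \<longleftrightarrow> l2_section s \<and> l2_section t \<and> (AE x in sphere_haar. s x = t x)"

lemma l2_sectionD:
  assumes "l2_section s"
  shows "section_of_bundle s" "s \<in> borel_measurable sphere_haar"
    "integrable sphere_haar (\<lambda>x. (norm (s x))\<^sup>2)"
  using assms by (auto simp: l2_section_def)

lemma l2_section_zero: "l2_section (\<lambda>x. 0)"
  by (simp add: l2_section_def section_of_bundle_def tangent_plane_def)

lemma norm_mult_le_squares: "norm (a::'a::real_normed_vector) * norm (b::'a) \<le> (norm a)\<^sup>2 + (norm b)\<^sup>2"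
proof -
  have "0 \<le> (norm a - norm b)\<^sup>2" by simp
  then have "2 * (norm a * norm b) \<le> (norm a)\<^sup>2 + (norm b)\<^sup>2" by (simp add: power2_diff)
  moreover have "0 \<le> norm a * norm b" by simp
  ultimately show ?thesis by linarith
qed

lemma l2_section_integrable_inner:
  assumes "l2_section s" "l2_section t"
  shows "integrable sphere_haar (\<lambda>x. s x \<bullet> t x)"
proof (rule Bochner_Integration.integrable_bound)
  note [measurable] = l2_sectionD(2)[OF assms(1)] l2_sectionD(2)[OF assms(2)]
  show "integrable sphere_haar (\<lambda>x. (norm (s x))\<^sup>2 + (norm (t x))\<^sup>2)"
    using assms by (intro Bochner_Integration.integrable_add) (auto dest: l2_sectionD)
  show "(\<lambda>x. s x \<bullet> t x) \<in> borel_measurable sphere_haar" by measurable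
  have "\<bar>s x \<bullet> t x\<bar> \<le> (norm (s x))\<^sup>2 + (norm (t x))\<^sup>2" for x
    using Cauchy_Schwarz_ineq2[of "s x" "t x"] norm_mult_le_squares[of "s x" "t x"] by linarith
  then show "AE x in sphere_haar. norm (s x \<bullet> t x) \<le> norm ((norm (s x))\<^sup>2 + (norm (t x))\<^sup>2)"
    by simp
qed

lemma l2_section_integrable_norm:
  assumes "l2_section s"
  shows "integrable sphere_haar (\<lambda>x. norm (s x))"
proof (rule Bochner_Integration.integrable_bound)
  interpret prob_space "sphere_haar :: 'a measure" by (rule prob_space_sphere_haar)
  note [measurable] = l2_sectionD(2)[OF assms]
  show "integrable sphere_haar (\<lambda>x. 1 + (norm (s x))\<^sup>2)"
    using assms by (intro Bochner_Integration.integrable_add) (auto dest: l2_sectionD)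
  show "(\<lambda>x. norm (s x)) \<in> borel_measurable sphere_haar" by measurable
  have "norm (s x) \<le> 1 + (norm (s x))\<^sup>2" for x
    using norm_mult_le_squares[of "s x" "s x"] zero_le_power2[of "norm (s x) - 1"]
    by (simp add: power2_diff) (smt (verit) norm_ge_zero zero_le_power2)
  then show "AE x in sphere_haar. norm (norm (s x)) \<le> norm (1 + (norm (s x))\<^sup>2)"
    by simp
qed

lemma l2_section_add:
  assumes "l2_section s" "l2_section t"
  shows "l2_section (\<lambda>x. s x + t x)"
  unfolding l2_section_def
proof (intro conjI)
  note [measurable] = l2_sectionD(2)[OF assms(1)] l2_sectionD(2)[OF assms(2)]
  show "section_of_bundle (\<lambda>x. s x + t x)"
    using assms by (auto simp: l2_section_def section_of_bundle_def tangent_plane_def inner_add_left)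
  show "(\<lambda>x. s x + t x) \<in> borel_measurable sphere_haar" by measurable
  have "(norm (s x + t x))\<^sup>2 = (norm (s x))\<^sup>2 + (norm (t x))\<^sup>2 + 2 * (s x \<bullet> t x)" for x
    by (simp add: power2_norm_eq_inner inner_add_left inner_add_right inner_commute)
  then show "integrable sphere_haar (\<lambda>x. (norm (s x + t x))\<^sup>2)"
    using assms by (auto intro!: Bochner_Integration.integrable_add l2_section_integrable_inner dest: l2_sectionD)
qed

lemma l2_section_scaleR:
  assumes "l2_section s"
  shows "l2_section (\<lambda>x. c *\<^sub>R s x)"
  using assms by (auto simp: l2_section_def section_of_bundle_def tangent_plane_def power_mult_distrib)

quotient_type (overloaded) 'a section_space = "'a::euclidean_space \<Rightarrow> 'a" / partial: l2_section_eq
proof (rule part_equivpI)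
  show "\<exists>s::'a \<Rightarrow> 'a. l2_section_eq s s"
    using l2_section_zero by (auto simp: l2_section_eq_def)
  show "symp (l2_section_eq :: ('a \<Rightarrow> 'a) \<Rightarrow> _)"
    by (auto simp: symp_def l2_section_eq_def)
  show "transp (l2_section_eq :: ('a \<Rightarrow> 'a) \<Rightarrow> _)"
    by (auto simp: transp_def l2_section_eq_def)
qed

instantiation section_space :: (euclidean_space) real_vector
begin

lift_definition zero_section_space :: "'a section_space" is "\<lambda>x. 0"
  by (simp add: l2_section_eq_def l2_section_zero)

lift_definition plus_section_space :: "'a section_space \<Rightarrow> 'a section_space \<Rightarrow> 'a section_space"
  is "\<lambda>s t x. s x + t x"
  by (auto simp: l2_section_eq_def l2_section_add)

lift_definition scaleR_section_space :: "real \<Rightarrow> 'a section_space \<Rightarrow> 'a section_space"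
  is "\<lambda>c s x. c *\<^sub>R s x"
  by (auto simp: l2_section_eq_def l2_section_scaleR)

lift_definition uminus_section_space :: "'a section_space \<Rightarrow> 'a section_space"
  is "\<lambda>s x. - s x"
  using l2_section_scaleR[of _ "-1"] by (auto simp: l2_section_eq_def)

lift_definition minus_section_space :: "'a section_space \<Rightarrow> 'a section_space \<Rightarrow> 'a section_space"
  is "\<lambda>s t x. s x - t x"
  using l2_section_add[OF _ l2_section_scaleR[of _ "-1"]] by (auto simp: l2_section_eq_def)

instance
proof
  fix x y z :: "'a section_space" and a b :: real
  show "x + y + z = x + (y + z)"
    by transfer (auto simp: l2_section_eq_def intro!: l2_section_add simp: add.assoc)
  show "x + y = y + x"
    by transfer (auto simp: l2_section_eq_def intro!: l2_section_add simp: add.commute)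
  show "0 + x = x"
    by transfer (auto simp: l2_section_eq_def)
  show "- x + x = 0"
    by transfer (auto simp: l2_section_eq_def l2_section_zero)
  show "x - y = x + - y"
    by transfer (auto simp: l2_section_eq_def
        intro!: l2_section_add[OF _ l2_section_scaleR[of _ "-1"], simplified])
  show "a *\<^sub>R (x + y) = a *\<^sub>R x + a *\<^sub>R y"
    by transfer (auto simp: l2_section_eq_def scaleR_add_right intro!: l2_section_add l2_section_scaleR)
  show "(a + b) *\<^sub>R x = a *\<^sub>R x + b *\<^sub>R x"
    by transfer (auto simp: l2_section_eq_def scaleR_add_left intro!: l2_section_add l2_section_scaleR)
  show "a *\<^sub>R b *\<^sub>R x = (a * b) *\<^sub>R x"
    by transfer (auto simp: l2_section_eq_def intro!: l2_section_scaleR)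
  show "1 *\<^sub>R x = x"
    by transfer (auto simp: l2_section_eq_def)
qed

end

instantiation section_space :: (euclidean_space) real_inner
begin

lift_definition inner_section_space :: "'a section_space \<Rightarrow> 'a section_space \<Rightarrow> real"
  is "\<lambda>s t. \<integral>x. s x \<bullet> t x \<partial>sphere_haar"
  by (rule integral_cong_AE) (auto simp: l2_section_eq_def l2_section_def)

definition norm_section_space :: "'a section_space \<Rightarrow> real"
  where "norm_section_space s = sqrt (s \<bullet> s)"
definition dist_section_space :: "'a section_space \<Rightarrow> 'a section_space \<Rightarrow> real"
  where "dist_section_space s t = norm (s - t)"
definition sgn_section_space :: "'a section_space \<Rightarrow> 'a section_space"
  where "sgn_section_space s = s /\<^sub>R norm s"
definition uniformity_section_space :: "('a section_space \<times> 'a section_space) filter"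
  where "uniformity_section_space = (INF e\<in>{0<..}. principal {(x, y). dist x y < e})"
definition open_section_space :: "'a section_space set \<Rightarrow> bool"
  where "open_section_space U \<longleftrightarrow> (\<forall>x\<in>U. eventually (\<lambda>(x', y). x' = x \<longrightarrow> y \<in> U) uniformity)"

instance
proof
  fix x y z :: "'a section_space" and a :: real and U :: "'a section_space set"
  show "dist x y = norm (x - y)" by (rule dist_section_space_def)
  show "sgn x = x /\<^sub>R norm x" by (rule sgn_section_space_def)
  show "uniformity = (INF e\<in>{0<..}. principal {(x, y :: 'a section_space). dist x y < e})"
    by (rule uniformity_section_space_def)
  show "open U \<longleftrightarrow> (\<forall>x\<in>U. \<forall>\<^sub>F (x', y) in uniformity. x' = x \<longrightarrow> y \<in> U)"
    by (rule open_section_space_def)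
  show "norm x = sqrt (x \<bullet> x)" by (rule norm_section_space_def)
  show "x \<bullet> y = y \<bullet> x"
    by transfer (simp add: inner_commute)
  show "(x + y) \<bullet> z = x \<bullet> z + y \<bullet> z"
    by transfer (auto simp: l2_section_eq_def inner_add_left l2_section_integrable_inner
        intro!: Bochner_Integration.integral_add)
  show "a *\<^sub>R x \<bullet> y = a * (x \<bullet> y)"
    by transfer simp
  show "0 \<le> x \<bullet> x"
    by transfer simp
  show "x \<bullet> x = 0 \<longleftrightarrow> x = 0"
  proof transfer
    fix s :: "'a \<Rightarrow> 'a" assume "l2_section_eq s s"
    then have s: "l2_section s" by (simp add: l2_section_eq_def)
    have "(\<integral>x. s x \<bullet> s x \<partial>sphere_haar) = 0 \<longleftrightarrow> (AE x in sphere_haar. s x \<bullet> s x = 0)"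
      by (intro integral_nonneg_eq_0_iff_AE l2_section_integrable_inner s) auto
    then show "(\<integral>x. s x \<bullet> s x \<partial>sphere_haar) = 0 \<longleftrightarrow> l2_section_eq s (\<lambda>x. 0)"
      using s by (simp add: l2_section_eq_def l2_section_zero)
  qed
qed

end

lemma norm_abs_section_space:
  assumes "l2_section s"
  shows "(norm (abs_section_space s))\<^sup>2 = (\<integral>x. (norm (s x))\<^sup>2 \<partial>sphere_haar)"
proof -
  have *: "l2_section_eq s s" using assms by (simp add: l2_section_eq_def)
  have "(norm (abs_section_space s))\<^sup>2 = abs_section_space s \<bullet> abs_section_space s"
    by (simp add: power2_norm_eq_inner)
  then show ?thesis
    by (simp add: inner_section_space.abs_eq[OF * *] power2_norm_eq_inner)
qed

lemma minus_abs_section_space: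
  assumes "l2_section s" "l2_section t"
  shows "abs_section_space s - abs_section_space t = abs_section_space (\<lambda>x. s x - t x)"
  using assms by (intro minus_section_space.abs_eq) (auto simp: l2_section_eq_def)

lemma section_space_cases:
  obtains s where "l2_section s" "S = abs_section_space s"
  by (metis Quotient_section_space Quotient_abs_rep Quotient_rep_reflp l2_section_eq_def)

lemma l2_section_minus: "l2_section s \<Longrightarrow> l2_section t \<Longrightarrow> l2_section (\<lambda>x. s x - t x)"
  using l2_section_add[OF _ l2_section_scaleR[of _ "-1"], of s t] by simp

lemma l2_section_integral_norm_le:
  assumes "l2_section s"
  shows "(\<integral>x. norm (s x) \<partial>sphere_haar) \<le> norm (abs_section_space s)"
proof -
  interpret prob_space "sphere_haar :: 'a measure" by (rule prob_space_sphere_haar)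
  have "(\<integral>x. norm (s x) \<partial>sphere_haar)\<^sup>2 \<le> (\<integral>x. (norm (s x))\<^sup>2 \<partial>sphere_haar)"
    using variance_eq[of "\<lambda>x. norm (s x)"] variance_positive[of "\<lambda>x. norm (s x)"]
      l2_section_integrable_norm[OF assms] l2_sectionD(3)[OF assms] by simp
  then show ?thesis
    unfolding norm_abs_section_space[OF assms, symmetric] by (rule power2_le_imp_le) simp
qed

instance section_space :: (euclidean_space) complete_space
proof
  fix X :: "nat \<Rightarrow> 'a section_space"
  assume X: "Cauchy X"
  interpret prob_space "sphere_haar :: 'a measure" by (rule prob_space_sphere_haar)
  obtain r :: "nat \<Rightarrow> nat" where r: "strict_mono r"
    and r_le: "\<And>n. dist (X (r (Suc n))) (X (r n)) \<le> (1/2) ^ n"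
  proof -
    have "\<forall>n. \<exists>N. \<forall>i\<ge>N. \<forall>j\<ge>N. dist (X i) (X j) < (1/2) ^ n"
      using X by (auto simp: Cauchy_def)
    then obtain N where N: "\<And>n i j. i \<ge> N n \<Longrightarrow> j \<ge> N n \<Longrightarrow> dist (X i) (X j) < (1/2) ^ n"
      by metis
    define r where "r = rec_nat (N 0) (\<lambda>n k. max (Suc k) (N (Suc n)))"
    have r_Suc: "r (Suc n) = max (Suc (r n)) (N (Suc n))" and r_0: "r 0 = N 0" for n
      by (auto simp: r_def)
    have "strict_mono r" by (rule strict_monoI_Suc) (simp add: r_Suc less_max_iff_disj)
    moreover have ge: "r n \<ge> N n" for n by (cases n) (auto simp: r_0 r_Suc)
    moreover have "dist (X (r (Suc n))) (X (r n)) \<le> (1/2) ^ n" for n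
      using N[of n "r (Suc n)" "r n"] ge[of n] strict_monoD[OF \<open>strict_mono r\<close>, of n "Suc n"]
      by simp
    ultimately show ?thesis using that by blast
  qed
  have "\<exists>f. \<forall>n. l2_section (f n) \<and> X (r n) = abs_section_space (f n)"
    by (intro choice allI) (metis section_space_cases)
  then obtain f where f: "\<And>n. l2_section (f n)" and Xf: "\<And>n. X (r n) = abs_section_space (f n)"
    by auto
  note f_meas [measurable] = l2_sectionD(2)[OF f]
  have dist_f: "(dist (X (r m)) (X (r n)))\<^sup>2 = (\<integral>x. (norm (f m x - f n x))\<^sup>2 \<partial>sphere_haar)" for m n
    unfolding dist_norm Xf minus_abs_section_space[OF f f]
    by (rule norm_abs_section_space[OF l2_section_minus[OF f f]])
  define d where "d n x = norm (f (Suc n) x - f n x)" for n x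
  have d_int: "integrable sphere_haar (d n)" for n
    unfolding d_def by (intro l2_section_integrable_norm l2_section_minus f)
  have d_le: "(\<integral>x. d n x \<partial>sphere_haar) \<le> (1/2) ^ n" for n
  proof -
    have "(\<integral>x. d n x \<partial>sphere_haar) \<le> dist (X (r (Suc n))) (X (r n))"
      unfolding d_def dist_norm Xf minus_abs_section_space[OF f f]
      by (rule l2_section_integral_norm_le[OF l2_section_minus[OF f f]])
    with r_le[of n] show ?thesis by linarith
  qed
  have "(\<integral>\<^sup>+x. (\<Sum>n. ennreal (d n x)) \<partial>sphere_haar) = (\<Sum>n. \<integral>\<^sup>+x. ennreal (d n x) \<partial>sphere_haar)"
    unfolding d_def by (rule nn_integral_suminf) measurable
  also have "\<dots> \<le> (\<Sum>n. ennreal ((1/2) ^ n))"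
  proof (intro suminf_le)
    fix n
    have "(\<integral>\<^sup>+x. ennreal (d n x) \<partial>sphere_haar) = ennreal (\<integral>x. d n x \<partial>sphere_haar)"
      by (rule nn_integral_eq_integral[OF d_int]) (simp add: d_def)
    also have "\<dots> \<le> ennreal ((1/2) ^ n)" by (rule ennreal_leI[OF d_le])
    finally show "(\<integral>\<^sup>+x. ennreal (d n x) \<partial>sphere_haar) \<le> ennreal ((1/2) ^ n)" .
  qed auto
  also have "\<dots> = ennreal (\<Sum>n. (1/2) ^ n)"
    by (rule suminf_ennreal2) (auto intro: summable_geometric)
  finally have "(\<integral>\<^sup>+x. (\<Sum>n. ennreal (d n x)) \<partial>sphere_haar) \<noteq> \<infinity>"
    by (auto simp: top_unique)
  moreover have "(\<lambda>x. \<Sum>n. ennreal (d n x)) \<in> borel_measurable sphere_haar"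
    unfolding d_def by measurable
  ultimately have ae_sum: "AE x in sphere_haar. (\<Sum>n. ennreal (d n x)) \<noteq> \<infinity>"
    by (intro nn_integral_PInf_AE)
  have ae_Cauchy: "AE x in sphere_haar. Cauchy (\<lambda>n. f n x)"
    using ae_sum
  proof eventually_elim
    fix x assume "(\<Sum>n. ennreal (d n x)) \<noteq> \<infinity>"
    then have "summable (\<lambda>n. d n x)"
      by (intro summable_suminf_not_top) (auto simp: d_def)
    then have "summable (\<lambda>n. f (Suc n) x - f n x)"
      unfolding d_def by (rule summable_norm_cancel)
    then have "convergent (\<lambda>n. \<Sum>i<n. f (Suc i) x - f i x)"
      by (simp add: summable_iff_convergent)
    then have "convergent (\<lambda>n. f n x - f 0 x)" by (simp only: sum_lessThan_telescope[of "\<lambda>n. f n x"])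
    from convergent_add[OF this convergent_const[of "f 0 x"]]
    show "Cauchy (\<lambda>n. f n x)" by (simp add: convergent_eq_Cauchy Cauchy_convergent_iff)
  qed
  define g where "g x = (if Cauchy (\<lambda>n. f n x) then lim (\<lambda>n. f n x) else 0)" for x
  have g_meas [measurable]: "g \<in> borel_measurable sphere_haar"
    unfolding g_def by measurable
  have g_lim: "(\<lambda>n. f n x) \<longlonglongrightarrow> g x" if "Cauchy (\<lambda>n. f n x)" for x
    using that by (simp add: g_def Cauchy_convergent_iff convergent_LIMSEQ_iff)
  have g_tan: "section_of_bundle g"
  proof (rule section_of_bundleI)
    fix x :: 'a assume x: "norm x = 1"
    show "g x \<bullet> x = 0"
    proof (cases "Cauchy (\<lambda>n. f n x)")
      case True
      have "(\<lambda>n. f n x \<bullet> x) \<longlonglongrightarrow> g x \<bullet> x" by (intro tendsto_intros g_lim True)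
      moreover have "f n x \<bullet> x = 0" for n
        using l2_sectionD(1)[OF f] x by (auto simp: section_of_bundle_def tangent_plane_def)
      ultimately show ?thesis by (simp add: LIMSEQ_const_iff)
    qed (simp add: g_def)
  qed
  have fatou: "(\<integral>\<^sup>+x. ennreal ((norm (g x - f n x))\<^sup>2) \<partial>sphere_haar) \<le> ennreal (e\<^sup>2)"
    if le: "\<And>m. m \<ge> n \<Longrightarrow> dist (X (r m)) (X (r n)) \<le> e" for n e
  proof -
    have "(\<integral>\<^sup>+x. ennreal ((norm (g x - f n x))\<^sup>2) \<partial>sphere_haar)
        = (\<integral>\<^sup>+x. liminf (\<lambda>m. ennreal ((norm (f m x - f n x))\<^sup>2)) \<partial>sphere_haar)"
    proof (rule nn_integral_cong_AE, use ae_Cauchy in eventually_elim)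
      fix x assume "Cauchy (\<lambda>n. f n x)"
      then have "(\<lambda>m. ennreal ((norm (f m x - f n x))\<^sup>2)) \<longlonglongrightarrow> ennreal ((norm (g x - f n x))\<^sup>2)"
        by (intro tendsto_intros tendsto_ennrealI g_lim)
      then show "ennreal ((norm (g x - f n x))\<^sup>2) = liminf (\<lambda>m. ennreal ((norm (f m x - f n x))\<^sup>2))"
        by (intro lim_imp_Liminf[symmetric]) auto
    qed
    also have "\<dots> \<le> liminf (\<lambda>m. \<integral>\<^sup>+x. ennreal ((norm (f m x - f n x))\<^sup>2) \<partial>sphere_haar)"
      by (rule nn_integral_liminf) measurable
    also have "\<dots> \<le> liminf (\<lambda>m::nat. ennreal (e\<^sup>2))"
    proof (rule Liminf_mono, rule eventually_sequentiallyI)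
      fix m assume "m \<ge> n"
      have "(\<integral>\<^sup>+x. ennreal ((norm (f m x - f n x))\<^sup>2) \<partial>sphere_haar)
          = ennreal ((dist (X (r m)) (X (r n)))\<^sup>2)"
        unfolding dist_f by (intro nn_integral_eq_integral l2_sectionD(3) l2_section_minus f) auto
      also have "\<dots> \<le> ennreal (e\<^sup>2)"
        by (intro ennreal_leI power_mono le \<open>m \<ge> n\<close>) auto
      finally show "(\<integral>\<^sup>+x. ennreal ((norm (f m x - f n x))\<^sup>2) \<partial>sphere_haar) \<le> ennreal (e\<^sup>2)" .
    qed
    finally show ?thesis by (simp add: Liminf_const)
  qed
  have Cr: "Cauchy (X \<circ> r)" by (rule Cauchy_subseq_Cauchy[OF X r])
  have g_sec: "l2_section g"
  proof -
    obtain N where N: "\<And>m. m \<ge> N \<Longrightarrow> dist (X (r m)) (X (r N)) < 1"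
      using Cr unfolding Cauchy_def o_def by (metis order_refl zero_less_one)
    then have "(\<integral>\<^sup>+x. ennreal ((norm (g x - f N x))\<^sup>2) \<partial>sphere_haar) \<le> ennreal (1\<^sup>2)"
      by (intro fatou) (simp add: less_imp_le)
    then have "(\<integral>\<^sup>+x. ennreal (norm ((norm (g x - f N x))\<^sup>2)) \<partial>sphere_haar) < \<infinity>"
      by (auto simp: less_top[symmetric] top_unique)
    then have "integrable sphere_haar (\<lambda>x. (norm (g x - f N x))\<^sup>2)"
      by (intro integrableI_bounded) measurable
    then have "l2_section (\<lambda>x. g x - f N x)"
      using g_tan l2_sectionD(1)[OF f[of N]]
      by (auto simp: l2_section_def section_of_bundle_def tangent_plane_def inner_diff_left)
    from l2_section_add[OF this f[of N]] show ?thesis by simp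
  qed
  have "(X \<circ> r) \<longlonglongrightarrow> abs_section_space g"
  proof (rule metric_LIMSEQ_I)
    fix e :: real assume e: "e > 0"
    then obtain N where N: "\<And>m n. m \<ge> N \<Longrightarrow> n \<ge> N \<Longrightarrow> dist (X (r m)) (X (r n)) < e / 2"
      using Cr unfolding Cauchy_def o_def by (metis half_gt_zero)
    have "dist ((X \<circ> r) n) (abs_section_space g) < e" if n: "n \<ge> N" for n
    proof -
      have "dist ((X \<circ> r) n) (abs_section_space g) = norm (abs_section_space g - abs_section_space (f n))"
        by (simp add: Xf dist_norm norm_minus_commute)
      then have "(dist ((X \<circ> r) n) (abs_section_space g))\<^sup>2 = (\<integral>x. (norm (g x - f n x))\<^sup>2 \<partial>sphere_haar)"
        by (simp add: minus_abs_section_space[OF g_sec f] norm_abs_section_space[OF l2_section_minus[OF g_sec f]])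
      then have "ennreal ((dist ((X \<circ> r) n) (abs_section_space g))\<^sup>2)
          = (\<integral>\<^sup>+x. ennreal ((norm (g x - f n x))\<^sup>2) \<partial>sphere_haar)"
        by (simp add: nn_integral_eq_integral[OF l2_sectionD(3)[OF l2_section_minus[OF g_sec f]]])
      also have "\<dots> \<le> ennreal ((e/2)\<^sup>2)"
        using N n by (intro fatou) (simp add: less_imp_le)
      finally have "(dist ((X \<circ> r) n) (abs_section_space g))\<^sup>2 \<le> (e/2)\<^sup>2"
        by (simp add: ennreal_le_iff)
      then have "dist ((X \<circ> r) n) (abs_section_space g) \<le> e/2"
        by (rule power2_le_imp_le) (use e in simp)
      with e show ?thesis by linarith
    qed
    then show "\<exists>no. \<forall>n\<ge>no. dist ((X \<circ> r) n) (abs_section_space g) < e" by blast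
  qed
  from Cauchy_converges_subseq[OF X r this] show "convergent X" by (auto simp: convergent_def)
qed

text \<open>\<open>smooth_on U f\<close>: on the open set \<open>U\<close>, the map \<open>f\<close> and all its iterated directional
  derivatives are (totally) differentiable.  A section is smooth if it extends to a smooth map
  on a neighbourhood of the sphere.\<close>

coinductive smooth_on :: "'a::real_normed_vector set \<Rightarrow> ('a \<Rightarrow> 'b::real_normed_vector) \<Rightarrow> bool"
  for U where
  "f differentiable_on U \<Longrightarrow> (\<And>v. smooth_on U (\<lambda>x. frechet_derivative f (at x) v)) \<Longrightarrow> smooth_on U f"

definition smooth_section :: "('a::euclidean_space \<Rightarrow> 'a) \<Rightarrow> bool" where
  "smooth_section s \<longleftrightarrow> section_of_bundle s \<and>
     (\<exists>U F. open U \<and> sphere 0 1 \<subseteq> U \<and> smooth_on U F \<and> (\<forall>x\<in>sphere 0 1. s x = F x))"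

lemma smooth_section_imp_l2_section:
  assumes "smooth_section s"
  shows "l2_section s"
proof -
  interpret prob_space "sphere_haar :: 'a measure" by (rule prob_space_sphere_haar)
  obtain U F where U: "open U" "sphere 0 1 \<subseteq> U" "smooth_on U F" "\<forall>x\<in>sphere 0 1. s x = F x"
    using assms by (auto simp: smooth_section_def)
  have "F differentiable_on U" using U(3) by (cases rule: smooth_on.cases) auto
  then have "continuous_on (sphere 0 1) F"
    using U(2) continuous_on_subset differentiable_imp_continuous_on by blast
  then have cont: "continuous_on (sphere 0 1) s"
    using U(4) by (subst continuous_on_cong[OF refl, of _ s F]) auto
  then have meas [measurable]: "s \<in> borel_measurable sphere_haar"
    using borel_measurable_continuous_on_restrict by (simp cong: measurable_cong_sets)
  have "bounded (s ` sphere 0 1)"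
    by (intro compact_imp_bounded compact_continuous_image cont) simp
  then obtain B where B: "\<And>x. x \<in> sphere 0 1 \<Longrightarrow> norm (s x) \<le> B"
    unfolding bounded_iff by blast
  have "integrable sphere_haar (\<lambda>x. (norm (s x))\<^sup>2)"
    by (rule integrable_const_bound[of _ "B\<^sup>2"])
      (auto intro!: AE_I2 power_mono B)
  with assms show ?thesis by (simp add: l2_section_def smooth_section_def)
qed

lemma real_polynomial_function_has_derivative:
  assumes "real_polynomial_function (p :: 'a::real_normed_vector \<Rightarrow> real)"
  shows "\<exists>p'. (\<forall>x. (p has_derivative p' x) (at x)) \<and> (\<forall>v. real_polynomial_function (\<lambda>x. p' x v))"
  using assms
proof induction
  case (linear f)
  then show ?case
    by (intro exI[of _ "\<lambda>x. f"]) (auto intro: bounded_linear.has_derivative[where g="\<lambda>x. x"]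
        bounded_linear_imp_has_derivative)
next
  case (const c)
  then show ?case by (intro exI[of _ "\<lambda>x v. 0"]) auto
next
  case (add f g)
  then obtain f' g' where "\<And>x. (f has_derivative f' x) (at x)" "\<And>v. real_polynomial_function (\<lambda>x. f' x v)"
    "\<And>x. (g has_derivative g' x) (at x)" "\<And>v. real_polynomial_function (\<lambda>x. g' x v)" by blast
  then show ?case
    by (intro exI[of _ "\<lambda>x v. f' x v + g' x v"])
      (auto intro!: has_derivative_add)
next
  case (mult f g)
  then obtain f' g' where "\<And>x. (f has_derivative f' x) (at x)" "\<And>v. real_polynomial_function (\<lambda>x. f' x v)"
    "\<And>x. (g has_derivative g' x) (at x)" "\<And>v. real_polynomial_function (\<lambda>x. g' x v)" by blast
  with mult.hyps show ?case
    by (intro exI[of _ "\<lambda>x v. f x * g' x v + f' x v * g x"])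
      (auto intro!: has_derivative_mult real_polynomial_function.intros(3,4))
qed

lemma polynomial_function_has_derivative:
  fixes p :: "'a::real_normed_vector \<Rightarrow> 'b::euclidean_space"
  assumes "polynomial_function p"
  shows "\<exists>p'. (\<forall>x. (p has_derivative p' x) (at x)) \<and> (\<forall>v. polynomial_function (\<lambda>x. p' x v))"
proof -
  have "\<forall>b\<in>Basis. real_polynomial_function (\<lambda>x. p x \<bullet> b)"
    using assms by (simp add: polynomial_function_iff_Basis_inner)
  then have "\<forall>b\<in>Basis. \<exists>p'. (\<forall>x. ((\<lambda>x. p x \<bullet> b) has_derivative p' x) (at x)) \<and> (\<forall>v. real_polynomial_function (\<lambda>x. p' x v))"
    using real_polynomial_function_has_derivative by blast
  then obtain q where q: "\<And>b x. b \<in> Basis \<Longrightarrow> ((\<lambda>x. p x \<bullet> b) has_derivative q b x) (at x)"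
    "\<And>b v. b \<in> Basis \<Longrightarrow> real_polynomial_function (\<lambda>x. q b x v)"
    by metis
  have "((\<lambda>x. \<Sum>b\<in>Basis. (p x \<bullet> b) *\<^sub>R b) has_derivative (\<lambda>v. \<Sum>b\<in>Basis. q b x v *\<^sub>R b)) (at x)" for x
    by (intro has_derivative_sum has_derivative_scaleR_left q)
  then have "(p has_derivative (\<lambda>v. \<Sum>b\<in>Basis. q b x v *\<^sub>R b)) (at x)" for x
    by (simp add: euclidean_representation)
  moreover have "polynomial_function (\<lambda>x. \<Sum>b\<in>Basis. q b x v *\<^sub>R b)" for v
    using q(2) by (auto intro!: polynomial_function_sum polynomial_function_mult simp: real_polynomial_function_eq)
  ultimately show ?thesis by (intro exI[of _ "\<lambda>x v. \<Sum>b\<in>Basis. q b x v *\<^sub>R b"]) auto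
qed

lemma polynomial_function_smooth_on:
  fixes p :: "'a::real_normed_vector \<Rightarrow> 'b::euclidean_space"
  assumes "polynomial_function p"
  shows "smooth_on U p"
  using assms
proof (coinduction arbitrary: p)
  case smooth_on
  then obtain p' where p': "\<And>x. (p has_derivative p' x) (at x)" "\<And>v. polynomial_function (\<lambda>x. p' x v)"
    using polynomial_function_has_derivative by blast
  have "frechet_derivative p (at x) = p' x" for x
    using frechet_derivative_at[OF p'(1)] by simp
  with p' show ?case
    by (auto simp: differentiable_on_def differentiable_def intro: has_derivative_at_withinI)
qed

lemma measurable_ident_sphere_haar [measurable]:
  "(\<lambda>x. x) \<in> borel_measurable (sphere_haar :: 'a::euclidean_space measure)"
  by (simp add: measurable_restrict_space1 cong: measurable_cong_sets)

lemma sphere_haar_indicator_approx: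
  fixes A :: "'a::euclidean_space set"
  assumes A: "A \<in> sets sphere_haar" and e: "e > 0"
  obtains g :: "'a \<Rightarrow> real" where "continuous_on UNIV g" "\<And>x. 0 \<le> g x" "\<And>x. g x \<le> 1"
    "(\<integral>x. \<bar>indicator A x - g x\<bar> \<partial>sphere_haar) \<le> e"
proof -
  interpret prob_space "sphere_haar :: 'a measure" by (rule prob_space_sphere_haar)
  have A_b [measurable]: "A \<in> sets borel"
    using A by (auto simp: sets_restrict_space)
  define M where "M = distr sphere_haar borel (\<lambda>x::'a. x)"
  interpret M: prob_space M unfolding M_def by (rule prob_space_distr) measurable
  have M_sets [simp, measurable_cong]: "sets M = sets borel" by (simp add: M_def)
  have fin: "emeasure M (space M) \<noteq> \<infinity>" by (simp add: M.emeasure_space_1)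
  have "\<exists>K. K \<subseteq> A \<and> compact K \<and> measure M A - e/2 \<le> measure M K"
  proof (cases "measure M A = 0")
    case True
    then show ?thesis using e by (intro exI[of _ "{}"]) auto
  next
    case False
    then have "ennreal (measure M A - e/2) < emeasure M A"
      using e by (simp add: M.emeasure_eq_measure ennreal_less_iff measure_nonneg zero_less_measure_iff ennreal_lessI)
    then obtain K where "K \<subseteq> A" "compact K" "ennreal (measure M A - e/2) < emeasure M K"
      unfolding inner_regular[OF M_sets fin A_b] less_SUP_iff by auto
    then show ?thesis
      by (intro exI[of _ K]) (auto simp: M.emeasure_eq_measure ennreal_less_iff dest: less_imp_le)
  qed
  then obtain K where K: "K \<subseteq> A" "compact K" "measure M A - e/2 \<le> measure M K" by blast
  have "emeasure M A < ennreal (measure M A + e/2)"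
    using e by (simp add: M.emeasure_eq_measure ennreal_less_iff)
  then obtain U where U: "A \<subseteq> U" "open U" "emeasure M U < ennreal (measure M A + e/2)"
    unfolding outer_regular[OF M_sets fin A_b] INF_less_iff by auto
  then have U': "measure M U \<le> measure M A + e/2"
    by (simp add: M.emeasure_eq_measure ennreal_less_iff)
  have [measurable]: "K \<in> sets borel" "U \<in> sets borel"
    using K(2) U(2) by (auto intro: borel_compact)
  obtain g :: "'a \<Rightarrow> real" where g: "continuous_on UNIV g" "\<And>x. g x \<in> closed_segment 1 0"
    "\<And>x. x \<in> K \<Longrightarrow> g x = 1" "\<And>x. x \<in> - U \<Longrightarrow> g x = 0"
    by (rule Urysohn[of K "- U" 1 0]) (use K U in \<open>auto intro: compact_imp_closed\<close>)
  have g01: "0 \<le> g x" "g x \<le> 1" for x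
    using g(2)[of x] by (auto simp: closed_segment_eq_real_ivl split: if_splits)
  have g_meas [measurable]: "g \<in> borel_measurable borel"
    by (rule borel_measurable_continuous_onI[OF g(1)])
  have meas: "(\<lambda>x. \<bar>indicator A x - g x\<bar>) \<in> borel_measurable borel" by measurable
  then have meas_M: "(\<lambda>x. \<bar>indicator A x - g x\<bar>) \<in> borel_measurable M"
    by (simp cong: measurable_cong_sets)
  have "(\<integral>x. \<bar>indicator A x - g x\<bar> \<partial>sphere_haar) = (\<integral>x. \<bar>indicator A x - g x\<bar> \<partial>M)"
    unfolding M_def by (rule integral_distr[symmetric, OF measurable_ident_sphere_haar meas])
  also have "\<dots> \<le> (\<integral>x. indicator (U - K) x \<partial>M)"
  proof (rule integral_mono)
    have "\<bar>indicator A x - g x\<bar> \<le> 1" for x using g01[of x] by (auto simp: indicator_def)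
    then show "integrable M (\<lambda>x. \<bar>indicator A x - g x\<bar>)"
      by (intro M.integrable_const_bound[of _ 1] meas_M) auto
    show "integrable M (indicator (U - K) :: 'a \<Rightarrow> real)"
      by (simp add: M.emeasure_finite less_top[symmetric])
    show "\<bar>indicator A x - g x\<bar> \<le> indicator (U - K) x" for x
      using g01[of x] g(3,4)[of x] K(1) U(1) by (auto simp: indicator_def)
  qed
  also have "\<dots> = measure M (U - K)" by simp
  also have "\<dots> = measure M U - measure M K"
    using K(1) U(1) by (intro M.finite_measure_Diff) auto
  also have "\<dots> \<le> e" using K(3) U' by simp
  finally show thesis using that g(1) g01 by blast
qed

definition tangential_part :: "('a::euclidean_space \<Rightarrow> 'a) \<Rightarrow> 'a \<Rightarrow> 'a" where
  "tangential_part h x = h x - (h x \<bullet> x) *\<^sub>R x"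

lemma norm_tangential_part_le:
  assumes "norm x = 1"
  shows "norm (tangential_part h x) \<le> norm (h x)"
proof -
  have "x \<bullet> x = 1" using assms by (simp add: dot_square_norm)
  then have "(norm (tangential_part h x))\<^sup>2 = (norm (h x))\<^sup>2 - (h x \<bullet> x)\<^sup>2"
    unfolding tangential_part_def power2_norm_eq_inner
    by (simp add: inner_diff_left inner_diff_right inner_commute power2_eq_square algebra_simps)
  also have "\<dots> \<le> (norm (h x))\<^sup>2" by simp
  finally show ?thesis by (rule power2_le_imp_le) simp
qed

lemma l2_section_tangential_part:
  assumes [measurable]: "h \<in> borel_measurable sphere_haar"
    and int: "integrable sphere_haar (\<lambda>x. (norm (h x))\<^sup>2)"
  shows "l2_section (tangential_part h)"
  unfolding l2_section_def
proof (intro conjI)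
  show "section_of_bundle (tangential_part h)"
    by (rule section_of_bundleI)
      (simp add: tangential_part_def inner_diff_left dot_square_norm)
  show meas: "tangential_part h \<in> borel_measurable sphere_haar"
    unfolding tangential_part_def[abs_def] by measurable
  show "integrable sphere_haar (\<lambda>x. (norm (tangential_part h x))\<^sup>2)"
  proof (rule Bochner_Integration.integrable_bound[OF int])
    show "(\<lambda>x. (norm (tangential_part h x))\<^sup>2) \<in> borel_measurable sphere_haar"
      using meas by measurable
    show "AE x in sphere_haar. norm ((norm (tangential_part h x))\<^sup>2) \<le> norm ((norm (h x))\<^sup>2)"
      by (intro AE_I2) (simp add: norm_tangential_part_le power_mono)
  qed
qed

lemma tangential_part_zero [simp]: "tangential_part (\<lambda>x. 0) = (\<lambda>x. 0)"
  by (simp add: fun_eq_iff tangential_part_def)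

lemma tangential_part_add:
  "tangential_part (\<lambda>x. f x + g x) x = tangential_part f x + tangential_part g x"
  by (simp add: tangential_part_def inner_add_left scaleR_add_left)

lemma tangential_part_diff:
  "tangential_part (\<lambda>x. f x - g x) x = tangential_part f x - tangential_part g x"
  by (simp add: tangential_part_def inner_diff_left scaleR_diff_left)

lemma tangential_part_scaleR:
  "tangential_part (\<lambda>x. c *\<^sub>R f x) x = c *\<^sub>R tangential_part f x"
  by (simp add: tangential_part_def scaleR_diff_right)

lemma tangential_part_section:
  assumes "section_of_bundle s" "norm x = 1"
  shows "tangential_part s x = s x"
  using section_of_bundleD[OF assms] by (simp add: tangential_part_def)

lemma polynomial_function_l2:
  fixes p :: "'a::euclidean_space \<Rightarrow> 'a"
  assumes "polynomial_function p"
  shows "p \<in> borel_measurable sphere_haar" "integrable sphere_haar (\<lambda>x. (norm (p x))\<^sup>2)"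
proof -
  interpret prob_space "sphere_haar :: 'a measure" by (rule prob_space_sphere_haar)
  have cont: "continuous_on S p" for S
    by (rule continuous_on_polymonial_function[OF assms])
  then have "p \<in> borel_measurable borel" by (rule borel_measurable_continuous_onI)
  from measurable_compose[OF measurable_ident_sphere_haar this]
  show [measurable]: "p \<in> borel_measurable sphere_haar" .
  have "bounded (p ` sphere 0 1)"
    by (intro compact_imp_bounded compact_continuous_image cont) simp
  then obtain B where B: "\<And>x. x \<in> sphere 0 1 \<Longrightarrow> norm (p x) \<le> B"
    unfolding bounded_iff by blast
  show "integrable sphere_haar (\<lambda>x. (norm (p x))\<^sup>2)"
    by (rule integrable_const_bound[of _ "B\<^sup>2"]) (auto intro!: AE_I2 power_mono B)
qed

lemma smooth_section_polynomial:
  fixes p :: "'a::euclidean_space \<Rightarrow> 'a"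
  assumes "polynomial_function p"
  shows "smooth_section (tangential_part p)"
proof -
  have "real_polynomial_function (\<lambda>x. p x \<bullet> x)"
  proof -
    have "real_polynomial_function (\<lambda>x. \<Sum>b\<in>Basis. (p x \<bullet> b) * (x \<bullet> b))"
      using assms by (intro real_polynomial_function_sum real_polynomial_function.intros(4))
        (auto simp: polynomial_function_iff_Basis_inner
          intro!: real_polynomial_function.intros(1) bounded_linear_inner_left)
    then show ?thesis by (simp add: euclidean_inner[symmetric])
  qed
  then have "polynomial_function (\<lambda>x. p x - (p x \<bullet> x) *\<^sub>R x)"
    using assms by (intro polynomial_function_diff polynomial_function_mult)
      (auto simp: real_polynomial_function_eq)
  then have "smooth_on UNIV (tangential_part p)"
    unfolding tangential_part_def[abs_def] by (rule polynomial_function_smooth_on)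
  moreover have "section_of_bundle (tangential_part p)"
    using l2_section_tangential_part[OF polynomial_function_l2[OF assms]] by (rule l2_sectionD)
  ultimately show ?thesis
    unfolding smooth_section_def by (intro conjI exI[of _ UNIV] exI[of _ "tangential_part p"]) auto
qed

lemma abs_section_space_eqI:
  assumes "l2_section s" "l2_section t" "\<And>x. norm x = 1 \<Longrightarrow> s x = t x"
  shows "abs_section_space s = abs_section_space t"
  using assms
  by (intro Quotient_rel_abs[OF Quotient_section_space]) (auto simp: l2_section_eq_def intro!: AE_I2)

lemma plus_abs_section_space:
  assumes "l2_section s" "l2_section t"
  shows "abs_section_space s + abs_section_space t = abs_section_space (\<lambda>x. s x + t x)"
  using assms by (intro plus_section_space.abs_eq) (auto simp: l2_section_eq_def)

lemma scaleR_abs_section_space: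
  assumes "l2_section s"
  shows "c *\<^sub>R abs_section_space s = abs_section_space (\<lambda>x. c *\<^sub>R s x)"
  using assms by (intro scaleR_section_space.abs_eq) (auto simp: l2_section_eq_def)

lemma subspace_closure:
  fixes S :: "'b::real_normed_vector set"
  assumes S: "subspace S"
  shows "subspace (closure S)"
proof (rule subspaceI)
  show "0 \<in> closure S" using subspace_0[OF S] closure_subset by blast
next
  fix x y assume "x \<in> closure S" "y \<in> closure S"
  then obtain f g where "\<And>n. f n \<in> S" "f \<longlonglongrightarrow> x" "\<And>n. g n \<in> S" "g \<longlonglongrightarrow> y"
    by (auto simp: closure_sequential)
  then show "x + y \<in> closure S"
    unfolding closure_sequential
    by (intro exI[of _ "\<lambda>n. f n + g n"]) (auto intro: subspace_add[OF S] tendsto_add)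
next
  fix c x assume "x \<in> closure S"
  then obtain f where "\<And>n. f n \<in> S" "f \<longlonglongrightarrow> x"
    by (auto simp: closure_sequential)
  then show "c *\<^sub>R x \<in> closure S"
    unfolding closure_sequential
    by (intro exI[of _ "\<lambda>n. c *\<^sub>R f n"]) (auto intro: subspace_scale[OF S] tendsto_scaleR)
qed

text \<open>The smooth sections are dense, so that \<open>section_space\<close> is indeed their Hilbert space
  completion.\<close>

theorem smooth_sections_dense:
  "closure (abs_section_space ` {s :: 'a::euclidean_space \<Rightarrow> 'a. smooth_section s}) = UNIV"
proof -
  interpret prob_space "sphere_haar :: 'a measure" by (rule prob_space_sphere_haar)
  let ?abs = "\<lambda>h. abs_section_space (tangential_part h)"
  define P :: "'a section_space set" where "P = ?abs ` {p. polynomial_function p}"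
  have l2p: "l2_section (tangential_part p)" if "polynomial_function p" for p :: "'a \<Rightarrow> 'a"
    by (intro l2_section_tangential_part polynomial_function_l2 that)
  have add: "?abs f + ?abs g = ?abs (\<lambda>x. f x + g x)"
    if "l2_section (tangential_part f)" "l2_section (tangential_part g)" for f g :: "'a \<Rightarrow> 'a"
    using plus_abs_section_space[OF that] by (simp add: tangential_part_add[symmetric])
  have "subspace P"
  proof (rule subspaceI)
    have "(0 :: 'a section_space) = ?abs (\<lambda>x. 0)"
      by (simp add: zero_section_space_def)
    then show "0 \<in> P" unfolding P_def by (intro image_eqI[of _ _ "\<lambda>x. 0"]) auto
  next
    fix S T assume "S \<in> P" "T \<in> P"
    then show "S + T \<in> P" by (auto simp: P_def add l2p intro!: imageI)
  next
    fix c S assume "S \<in> P"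
    then obtain p where p: "polynomial_function p" "S = ?abs p" by (auto simp: P_def)
    then have "c *\<^sub>R S = ?abs (\<lambda>x. c *\<^sub>R p x)"
      by (simp add: scaleR_abs_section_space l2p tangential_part_scaleR[symmetric])
    then show "c *\<^sub>R S \<in> P" using p by (auto simp: P_def)
  qed
  define D where "D = closure P"
  have D: "subspace D" unfolding D_def by (rule subspace_closure[OF \<open>subspace P\<close>])
  have ind: "?abs (\<lambda>x. indicator A x *\<^sub>R v) \<in> D" "l2_section (tangential_part (\<lambda>x. indicator A x *\<^sub>R v))"
    if A [measurable]: "A \<in> sets sphere_haar" for A and v :: 'a
  proof -
    have [measurable]: "(\<lambda>x. indicator A x *\<^sub>R v) \<in> borel_measurable sphere_haar" by measurable
    have "integrable sphere_haar (\<lambda>x. (norm (indicator A x *\<^sub>R v))\<^sup>2)"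
      by (rule integrable_const_bound[of _ "(norm v)\<^sup>2"]) (auto intro!: AE_I2 simp: indicator_def)
    then show l2A: "l2_section (tangential_part (\<lambda>x. indicator A x *\<^sub>R v))"
      by (intro l2_section_tangential_part) measurable
    show "?abs (\<lambda>x. indicator A x *\<^sub>R v) \<in> D"
      unfolding D_def closure_approachable
    proof (intro allI impI)
      fix e :: real assume e: "e > 0"
      define c where "c = e\<^sup>2 / (8 * ((norm v)\<^sup>2 + 1))"
      have c: "c > 0" using e by (simp add: c_def add_nonneg_pos)
      obtain g :: "'a \<Rightarrow> real" where g: "continuous_on UNIV g" "\<And>x. 0 \<le> g x" "\<And>x. g x \<le> 1"
        "(\<integral>x. \<bar>indicator A x - g x\<bar> \<partial>sphere_haar) \<le> c"
        using sphere_haar_indicator_approx[OF A c] by blast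
      have g_meas [measurable]: "g \<in> borel_measurable sphere_haar"
        using measurable_compose[OF measurable_ident_sphere_haar borel_measurable_continuous_onI[OF g(1)]] .
      have g_bound: "\<bar>indicator A x - g x\<bar> \<le> 1" for x
        using g(2,3)[of x] by (auto simp: indicator_def)
      have g_int: "integrable sphere_haar (\<lambda>x. \<bar>indicator A x - g x\<bar>)"
        by (rule integrable_const_bound[of _ 1]) (auto intro!: AE_I2 g_bound)
      obtain p where p: "polynomial_function p" "\<And>x. x \<in> sphere 0 1 \<Longrightarrow> norm (g x *\<^sub>R v - p x) < e / 2"
        using Stone_Weierstrass_polynomial_function[of "sphere 0 1" "\<lambda>x. g x *\<^sub>R v" "e/2"] e
          continuous_on_subset[OF g(1)] by (force intro!: continuous_intros)
      let ?h = "\<lambda>x. indicator A x *\<^sub>R v - p x"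
      have "(dist (?abs (\<lambda>x. indicator A x *\<^sub>R v)) (?abs p))\<^sup>2
          = (\<integral>x. (norm (tangential_part ?h x))\<^sup>2 \<partial>sphere_haar)"
        unfolding dist_norm minus_abs_section_space[OF l2A l2p[OF p(1)]] tangential_part_diff
        by (rule norm_abs_section_space[OF l2_section_minus[OF l2A l2p[OF p(1)]]])
      also have "\<dots> \<le> (\<integral>x. 2 * (norm v)\<^sup>2 * \<bar>indicator A x - g x\<bar> + 2 * (e/2)\<^sup>2 \<partial>sphere_haar)"
      proof (rule integral_mono)
        show "integrable sphere_haar (\<lambda>x. (norm (tangential_part ?h x))\<^sup>2)"
          unfolding tangential_part_diff by (intro l2_sectionD(3) l2_section_minus l2A l2p p(1))
        show "integrable sphere_haar (\<lambda>x. 2 * (norm v)\<^sup>2 * \<bar>indicator A x - g x\<bar> + 2 * (e/2)\<^sup>2)"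
          using g_int by simp
        fix x :: 'a assume "x \<in> space sphere_haar"
        then have x: "norm x = 1" by simp
        let ?a = "(indicator A x - g x) *\<^sub>R v" and ?b = "g x *\<^sub>R v - p x"
        have "\<bar>indicator A x - g x\<bar>\<^sup>2 \<le> \<bar>indicator A x - g x\<bar>"
          unfolding power2_eq_square by (intro mult_left_le g_bound) auto
        then have a: "(norm ?a)\<^sup>2 \<le> (norm v)\<^sup>2 * \<bar>indicator A x - g x\<bar>"
          by (simp add: power_mult_distrib mult.commute mult_left_mono)
        have b: "(norm ?b)\<^sup>2 \<le> (e/2)\<^sup>2"
          using p(2)[of x] x by (intro power_mono) auto
        have "(norm (tangential_part ?h x))\<^sup>2 \<le> (norm (?a + ?b))\<^sup>2"
          using norm_tangential_part_le[OF x, of ?h] by (simp add: algebra_simps power_mono)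
        also have "\<dots> \<le> (norm ?a + norm ?b)\<^sup>2" by (intro power_mono norm_triangle_ineq) auto
        also have "\<dots> \<le> 2 * (norm ?a)\<^sup>2 + 2 * (norm ?b)\<^sup>2"
          using zero_le_power2[of "norm ?a - norm ?b"] unfolding power2_sum power2_diff by linarith
        finally show "(norm (tangential_part ?h x))\<^sup>2 \<le> 2 * (norm v)\<^sup>2 * \<bar>indicator A x - g x\<bar> + 2 * (e/2)\<^sup>2"
          using a b by linarith
      qed
      also have "\<dots> = 2 * (norm v)\<^sup>2 * (\<integral>x. \<bar>indicator A x - g x\<bar> \<partial>sphere_haar) + 2 * (e/2)\<^sup>2"
        using g_int by (simp add: prob_space[unfolded space_sphere_haar])
      also have "\<dots> \<le> 2 * (norm v)\<^sup>2 * c + 2 * (e/2)\<^sup>2"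
        using g(4) by (simp add: mult_left_mono)
      also have "\<dots> \<le> 2 * ((norm v)\<^sup>2 + 1) * c + 2 * (e/2)\<^sup>2" using c by simp
      also have "2 * ((norm v)\<^sup>2 + 1) * c = e\<^sup>2 / 4"
      proof -
        have "2 * k * (e\<^sup>2 / (8 * k)) = e\<^sup>2 / 4" if "k > 0" for k using that by simp
        then show ?thesis unfolding c_def by (simp only: add_nonneg_pos zero_le_power2 zero_less_one)
      qed
      also have "e\<^sup>2 / 4 + 2 * (e/2)\<^sup>2 < e\<^sup>2" using e by (simp add: power_divide)
      finally have "dist (?abs (\<lambda>x. indicator A x *\<^sub>R v)) (?abs p) < e"
        using e by (intro power2_less_imp_less[of _ e]) auto
      then show "\<exists>y\<in>P. dist y (?abs (\<lambda>x. indicator A x *\<^sub>R v)) < e"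
        using p(1) by (auto simp: P_def dist_commute)
    qed
  qed
  have sum: "?abs (\<lambda>x. \<Sum>y\<in>Y. indicator (A y) x *\<^sub>R y) \<in> D \<and>
      l2_section (tangential_part (\<lambda>x. \<Sum>y\<in>Y. indicator (A y) x *\<^sub>R y))"
    if "finite Y" "\<And>y. A y \<in> sets sphere_haar" for Y :: "'a set" and A
    using that(1)
  proof induction
    case empty
    have "(0 :: 'a section_space) = ?abs (\<lambda>x. 0)" by (simp add: zero_section_space_def)
    then show ?case
      using subspace_0[OF D] l2_section_zero[where 'a='a] by simp
  next
    case (insert y Y)
    let ?f = "\<lambda>x. indicator (A y) x *\<^sub>R y" and ?g = "\<lambda>x. \<Sum>y\<in>Y. indicator (A y) x *\<^sub>R y"
    have l2: "l2_section (tangential_part ?f)" "l2_section (tangential_part ?g)"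
      using ind(2)[OF that(2)] insert.IH by auto
    have "?abs ?f + ?abs ?g \<in> D"
      using ind(1)[OF that(2)] insert.IH by (intro subspace_add[OF D]) auto
    moreover have "l2_section (tangential_part (\<lambda>x. ?f x + ?g x))"
      using l2_section_add[OF l2] by (simp add: tangential_part_add[symmetric])
    ultimately show ?case
      unfolding sum.insert[OF insert.hyps(1,2)] add[OF l2] by (rule conjI)
  qed
  have "S \<in> D" for S :: "'a section_space"
  proof -
    obtain f where f: "l2_section f" and S: "S = abs_section_space f" by (rule section_space_cases)
    note f_meas [measurable] = l2_sectionD(2)[OF f]
    obtain h where h: "\<And>i. simple_function sphere_haar (h i)"
      "\<And>x. x \<in> space sphere_haar \<Longrightarrow> (\<lambda>i. h i x) \<longlonglongrightarrow> f x"
      "\<And>i x. x \<in> space sphere_haar \<Longrightarrow> norm (h i x) \<le> 2 * norm (f x)"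
      using borel_measurable_implies_sequence_metric[OF f_meas, of 0]
      unfolding dist_norm diff_0_right by blast
    have h_meas [measurable]: "h i \<in> borel_measurable sphere_haar" for i
      using h(1) by (rule borel_measurable_simple_function)
    have h_D: "?abs (h i) \<in> D" and h_l2: "l2_section (tangential_part (h i))" for i
    proof -
      let ?Y = "h i ` sphere 0 1" and ?A = "\<lambda>y. h i -` {y} \<inter> sphere 0 1"
      have fin: "finite ?Y" using h(1)[of i] by (simp add: simple_function_def)
      have A: "?A y \<in> sets sphere_haar" for y
        using measurable_sets[OF h_meas[of i], of "{y}"] by (simp only: space_sphere_haar) auto
      have eq: "h i x = (\<Sum>y\<in>?Y. indicator (?A y) x *\<^sub>R y)" if "norm x = 1" for x
      proof -
        have "(\<Sum>y\<in>?Y. indicator (?A y) x *\<^sub>R y) = (\<Sum>y\<in>?Y. if y = h i x then y else 0)"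
          using that by (intro sum.cong) (auto simp: indicator_def)
        then show ?thesis using fin that by (auto simp: sum.delta)
      qed
      have "integrable sphere_haar (\<lambda>x. (norm (h i x))\<^sup>2)"
      proof (rule Bochner_Integration.integrable_bound)
        show "integrable sphere_haar (\<lambda>x. 4 * (norm (f x))\<^sup>2)"
          using l2_sectionD(3)[OF f] by simp
        show "AE x in sphere_haar. norm ((norm (h i x))\<^sup>2) \<le> norm (4 * (norm (f x))\<^sup>2)"
          using power_mono[OF h(3), of _ i 2] by (intro AE_I2) (simp add: power_mult_distrib)
      qed measurable
      then show l2: "l2_section (tangential_part (h i))"
        by (intro l2_section_tangential_part) measurable
      have eq': "tangential_part (\<lambda>x. \<Sum>y\<in>?Y. indicator (?A y) x *\<^sub>R y) x = tangential_part (h i) x"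
        if "norm x = 1" for x
        unfolding tangential_part_def eq[OF that, symmetric] by (rule refl)
      have "?abs (\<lambda>x. \<Sum>y\<in>?Y. indicator (?A y) x *\<^sub>R y) = ?abs (h i)"
        by (rule abs_section_space_eqI[OF conjunct2[OF sum[of ?Y ?A, OF fin A]] l2 eq'])
      then show "?abs (h i) \<in> D" using conjunct1[OF sum[of ?Y ?A, OF fin A]] by (simp only:)
    qed
    have l2_diff: "l2_section (\<lambda>x. tangential_part (h i) x - f x)" for i
      by (rule l2_section_minus[OF h_l2 f])
    note d_meas [measurable] = l2_sectionD(2)[OF l2_diff]
    have "(\<lambda>i. \<integral>x. (norm (tangential_part (h i) x - f x))\<^sup>2 \<partial>sphere_haar) \<longlonglongrightarrow> (\<integral>x. 0 \<partial>(sphere_haar :: 'a measure))"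
    proof (rule integral_dominated_convergence[where w="\<lambda>x. 9 * (norm (f x))\<^sup>2"])
      show "integrable sphere_haar (\<lambda>x. 9 * (norm (f x))\<^sup>2)" using l2_sectionD(3)[OF f] by simp
      show "AE x in sphere_haar. (\<lambda>i. (norm (tangential_part (h i) x - f x))\<^sup>2) \<longlonglongrightarrow> 0"
      proof (rule AE_I2)
        fix x :: 'a assume x: "x \<in> space sphere_haar"
        have "(\<lambda>i. (norm (tangential_part (h i) x - f x))\<^sup>2) \<longlonglongrightarrow> (norm (tangential_part f x - f x))\<^sup>2"
          unfolding tangential_part_def by (intro tendsto_intros h(2) x)
        then show "(\<lambda>i. (norm (tangential_part (h i) x - f x))\<^sup>2) \<longlonglongrightarrow> 0"
          using tangential_part_section[OF l2_sectionD(1)[OF f], of x] x by simp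
      qed
      fix i
      show "AE x in sphere_haar. norm ((norm (tangential_part (h i) x - f x))\<^sup>2) \<le> 9 * (norm (f x))\<^sup>2"
      proof (rule AE_I2)
        fix x :: 'a assume x: "x \<in> space sphere_haar"
        have "norm (tangential_part (h i) x - f x) \<le> norm (tangential_part (h i) x) + norm (f x)"
          by (rule norm_triangle_ineq4)
        also have "\<dots> \<le> 3 * norm (f x)"
          using norm_tangential_part_le[of x "h i"] h(3)[OF x, of i] x by simp
        finally have "(norm (tangential_part (h i) x - f x))\<^sup>2 \<le> (3 * norm (f x))\<^sup>2"
          by (rule power_mono) simp
        then show "norm ((norm (tangential_part (h i) x - f x))\<^sup>2) \<le> 9 * (norm (f x))\<^sup>2"
          by (simp add: power_mult_distrib)
      qed
    qed measurable
    then have "(\<lambda>i. (dist (?abs (h i)) S)\<^sup>2) \<longlonglongrightarrow> 0"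
      unfolding S dist_norm minus_abs_section_space[OF h_l2 f] norm_abs_section_space[OF l2_diff]
      by simp
    then have "(\<lambda>i. sqrt ((dist (?abs (h i)) S)\<^sup>2)) \<longlonglongrightarrow> sqrt 0" by (intro tendsto_intros)
    then have "(\<lambda>i. ?abs (h i)) \<longlonglongrightarrow> S" by (simp add: tendsto_dist_iff[of _ S])
    moreover have "closed D" by (simp add: D_def)
    ultimately show "S \<in> D"
      using closed_sequentially[of D "\<lambda>i. ?abs (h i)" S] h_D by (simp only: simp_thms)
  qed
  moreover have "P \<subseteq> abs_section_space ` {s. smooth_section s}"
    by (auto simp: P_def intro!: imageI smooth_section_polynomial)
  then have "D \<subseteq> closure (abs_section_space ` {s. smooth_section s})"
    unfolding D_def by (rule closure_mono)
  ultimately show ?thesis by (simp only: set_eq_iff subset_iff UNIV_I simp_thms)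
qed

section \<open>The operator of common lines\<close>

text \<open>The transpose of a linear map \<open>f\<close> from a subspace \<open>U\<close> into the ambient space, with
  respect to the induced Euclidean structures.\<close>

definition subspace_transpose ::
  "'a::euclidean_space set \<Rightarrow> ('a \<Rightarrow> 'b::euclidean_space) \<Rightarrow> 'b \<Rightarrow> 'a" where
  "subspace_transpose U f w = (THE u. u \<in> U \<and> (\<forall>u'\<in>U. u \<bullet> u' = w \<bullet> f u'))"

definition common_line :: "'a::euclidean_space \<Rightarrow> 'a \<Rightarrow> 'a set" where
  "common_line x y = tangent_plane x \<inter> tangent_plane y"

text \<open>\<open>C(x,y)\<close> as a map from \<open>tangent_plane y\<close> to \<open>tangent_plane x\<close>.  Both inclusions of the
  common line are the identity on vectors of the ambient space.  The values for
  \<open>y = x\<close> and \<open>y = - x\<close>, where the common line is not a line, do not matter: \<open>{x, -x}\<close>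
  has measure zero as soon as the dimension is at least two.\<close>

definition common_lines_kernel :: "'a::euclidean_space \<Rightarrow> 'a \<Rightarrow> 'a \<Rightarrow> 'a" where
  "common_lines_kernel x y = (\<lambda>w. w) \<circ> subspace_transpose (common_line x y) (\<lambda>w. w)"

lemma common_lines_kernel_eq:
  assumes x: "norm x = 1" and y: "norm y = 1" and v: "v \<in> tangent_plane y"
  shows "common_lines_kernel x y v \<in> common_line x y"
    and "common_lines_kernel x y v = v - ((v \<bullet> x) / (1 - (x \<bullet> y)\<^sup>2)) *\<^sub>R (x - (x \<bullet> y) *\<^sub>R y)"
    (is "_ = ?u")
proof -
  have xx: "x \<bullet> x = 1" and yy: "y \<bullet> y = 1" using x y by (simp_all add: dot_square_norm)
  have vy: "v \<bullet> y = 0" using v by (simp add: tangent_plane_def)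
  have uy: "?u \<bullet> y = 0" by (simp add: inner_diff_left vy yy)
  have ux: "?u \<bullet> x = 0"
  proof (cases "(x \<bullet> y)\<^sup>2 = 1")
    case True
    have "(norm (x - (x \<bullet> y) *\<^sub>R y))\<^sup>2 = 1 - (x \<bullet> y)\<^sup>2"
      unfolding power2_norm_eq_inner
      by (simp add: inner_diff_left inner_diff_right inner_commute power2_eq_square xx yy)
    with True have eq: "x = (x \<bullet> y) *\<^sub>R y" by simp
    have "v \<bullet> x = v \<bullet> ((x \<bullet> y) *\<^sub>R y)" by (rule arg_cong[OF eq])
    then show ?thesis by (simp add: vy)
  next
    case False
    then have "1 - (x \<bullet> y)\<^sup>2 \<noteq> 0" by simp
    moreover have "(x - (x \<bullet> y) *\<^sub>R y) \<bullet> x = 1 - (x \<bullet> y)\<^sup>2"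
      by (simp add: inner_diff_left inner_commute[of y x] power2_eq_square xx)
    ultimately show ?thesis by (simp add: inner_diff_left)
  qed
  have u: "?u \<in> common_line x y" using ux uy by (simp add: common_line_def tangent_plane_def)
  have orth: "?u \<bullet> w = v \<bullet> w" if "w \<in> common_line x y" for w
    using that by (simp add: common_line_def tangent_plane_def inner_diff_left inner_diff_right inner_commute)
  have "(THE u. u \<in> common_line x y \<and> (\<forall>w\<in>common_line x y. u \<bullet> w = v \<bullet> w)) = ?u"
  proof (rule the_equality)
    show "?u \<in> common_line x y \<and> (\<forall>w\<in>common_line x y. ?u \<bullet> w = v \<bullet> w)" using u orth by blast
    fix u' assume u': "u' \<in> common_line x y \<and> (\<forall>w\<in>common_line x y. u' \<bullet> w = v \<bullet> w)"
    have "u' - ?u \<in> common_line x y"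
      using u u' by (simp add: common_line_def tangent_plane_def inner_diff_left)
    then have "(u' - ?u) \<bullet> (u' - ?u) = 0"
      using u' orth by (subst inner_diff_left) auto
    then show "u' = ?u" by simp
  qed
  then show "common_lines_kernel x y v = ?u"
    by (simp add: common_lines_kernel_def subspace_transpose_def)
  then show "common_lines_kernel x y v \<in> common_line x y" using u by simp
qed

lemma common_lines_kernel_props:
  assumes x: "norm x = 1" and y: "norm y = 1" and v: "v \<in> tangent_plane y"
  shows "common_lines_kernel x y v \<bullet> x = 0" "norm (common_lines_kernel x y v) \<le> norm v"
proof -
  let ?u = "common_lines_kernel x y v"
  show ux: "?u \<bullet> x = 0"
    using common_lines_kernel_eq(1)[OF assms] by (simp add: common_line_def tangent_plane_def)
  have uy: "?u \<bullet> y = 0"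
    using common_lines_kernel_eq(1)[OF assms] by (simp add: common_line_def tangent_plane_def)
  have "w \<bullet> ?u = v \<bullet> ?u" if "w = ?u" for w
    unfolding that by (subst (1) common_lines_kernel_eq(2)[OF assms])
      (use ux uy in \<open>simp add: inner_diff_left inner_diff_right inner_commute\<close>)
  then have "norm ?u * norm ?u \<le> norm v * norm ?u"
    using norm_cauchy_schwarz[of v ?u] by (simp add: dot_square_norm power2_eq_square)
  then show "norm ?u \<le> norm v"
    by (cases "norm ?u = 0") (simp_all add: mult_le_cancel_right)
qed

definition common_lines_integral :: "('a::euclidean_space \<Rightarrow> 'a) \<Rightarrow> 'a \<Rightarrow> 'a" where
  "common_lines_integral s x = (\<integral>y. common_lines_kernel x y (s y) \<partial>sphere_haar)"

lemma common_lines_measurable: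
  assumes s: "l2_section s"
  shows "(\<lambda>(x, y). common_lines_kernel x y (s y))
    \<in> borel_measurable (sphere_haar \<Otimes>\<^sub>M (sphere_haar :: 'a::euclidean_space measure))"
proof -
  note [measurable] = l2_sectionD(2)[OF s]
  have "(\<lambda>(x, y). common_lines_kernel x y (s y))
      \<in> borel_measurable (sphere_haar \<Otimes>\<^sub>M (sphere_haar :: 'a measure)) \<longleftrightarrow>
    (\<lambda>(x, y). s y - ((s y \<bullet> x) / (1 - (x \<bullet> y)\<^sup>2)) *\<^sub>R (x - (x \<bullet> y) *\<^sub>R y))
      \<in> borel_measurable (sphere_haar \<Otimes>\<^sub>M (sphere_haar :: 'a measure))"
    using l2_sectionD(1)[OF s]
    by (intro measurable_cong) (auto simp: space_pair_measure section_of_bundle_def common_lines_kernel_eq(2))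
  also have \<dots> by measurable
  finally show ?thesis .
qed

lemma common_lines_integrable:
  assumes s: "l2_section s" and x: "norm x = 1"
  shows "integrable sphere_haar (\<lambda>y. common_lines_kernel x y (s y))"
proof (rule Bochner_Integration.integrable_bound[OF l2_section_integrable_norm[OF s]])
  show "(\<lambda>y. common_lines_kernel x y (s y)) \<in> borel_measurable sphere_haar"
    using measurable_compose_Pair1[OF _ common_lines_measurable[OF s], of x] x by simp
  show "AE y in sphere_haar. norm (common_lines_kernel x y (s y)) \<le> norm (norm (s y))"
    using l2_sectionD(1)[OF s] x
    by (intro AE_I2) (simp add: common_lines_kernel_props section_of_bundle_def)
qed

lemma norm_common_lines_integral_le:
  assumes s: "l2_section s" and x: "norm x = 1"
  shows "norm (common_lines_integral s x) \<le> norm (abs_section_space s)"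
proof -
  have "norm (common_lines_integral s x) \<le> (\<integral>y. norm (common_lines_kernel x y (s y)) \<partial>sphere_haar)"
    unfolding common_lines_integral_def by (rule integral_norm_bound)
  also have "\<dots> \<le> (\<integral>y. norm (s y) \<partial>sphere_haar)"
    using l2_sectionD(1)[OF s] x
    by (intro integral_mono integrable_norm common_lines_integrable l2_section_integrable_norm s)
      (simp_all add: common_lines_kernel_props section_of_bundle_def)
  also have "\<dots> \<le> norm (abs_section_space s)" by (rule l2_section_integral_norm_le[OF s])
  finally show ?thesis .
qed

lemma l2_section_common_lines_integral:
  assumes s: "l2_section s"
  shows "l2_section (common_lines_integral s)"
  unfolding l2_section_def
proof (intro conjI)
  interpret prob_space "sphere_haar :: 'a measure" by (rule prob_space_sphere_haar)
  show "section_of_bundle (common_lines_integral s)"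
  proof (rule section_of_bundleI)
    fix x :: 'a assume x: "norm x = 1"
    have "common_lines_integral s x \<bullet> x = (\<integral>y. common_lines_kernel x y (s y) \<bullet> x \<partial>sphere_haar)"
      unfolding common_lines_integral_def
      by (rule integral_inner_left[symmetric]) (rule common_lines_integrable[OF s x])
    also have "\<dots> = (\<integral>y. 0 \<partial>(sphere_haar :: 'a measure))"
      using l2_sectionD(1)[OF s] x
      by (intro Bochner_Integration.integral_cong)
        (simp_all add: common_lines_kernel_props section_of_bundle_def)
    finally show "common_lines_integral s x \<bullet> x = 0" by simp
  qed
  show [measurable]: "common_lines_integral s \<in> borel_measurable sphere_haar"
    unfolding common_lines_integral_def[abs_def]
    by (rule borel_measurable_lebesgue_integral[OF common_lines_measurable[OF s]])
  show "integrable sphere_haar (\<lambda>x. (norm (common_lines_integral s x))\<^sup>2)"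
    by (rule integrable_const_bound[of _ "(norm (abs_section_space s))\<^sup>2"])
      (auto intro!: AE_I2 power_mono norm_common_lines_integral_le s)
qed

lemma common_lines_integral_cong:
  assumes eq: "l2_section_eq s t" and x: "norm x = 1"
  shows "common_lines_integral s x = common_lines_integral t x"
  unfolding common_lines_integral_def
proof (rule integral_cong_AE)
  have st: "l2_section s" "l2_section t" and ae: "AE y in sphere_haar. s y = t y"
    using eq by (auto simp: l2_section_eq_def)
  show "(\<lambda>y. common_lines_kernel x y (s y)) \<in> borel_measurable sphere_haar"
    "(\<lambda>y. common_lines_kernel x y (t y)) \<in> borel_measurable sphere_haar"
    using common_lines_integrable[OF _ x] st by auto
  show "AE y in sphere_haar. common_lines_kernel x y (s y) = common_lines_kernel x y (t y)"
    using ae by eventually_elim simp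
qed

lift_definition common_lines_operator :: "'a::euclidean_space section_space \<Rightarrow> 'a section_space"
  is common_lines_integral
  by (auto simp: l2_section_eq_def intro!: AE_I2 l2_section_common_lines_integral)
    (auto simp: l2_section_eq_def intro!: common_lines_integral_cong)

lemma bounded_linear_common_lines_operator:
  "bounded_linear (common_lines_operator :: 'a::euclidean_space section_space \<Rightarrow> 'a section_space)"
proof (rule bounded_linear_intro[where K=1])
  interpret prob_space "sphere_haar :: 'a measure" by (rule prob_space_sphere_haar)
  have op: "common_lines_operator (abs_section_space s) = abs_section_space (common_lines_integral s)"
    if "l2_section s" for s :: "'a \<Rightarrow> 'a"
    using that by (intro common_lines_operator.abs_eq) (simp add: l2_section_eq_def)
  note tan = l2_sectionD(1)[unfolded section_of_bundle_def, rule_format]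
  fix S T :: "'a section_space" and c :: real
  obtain s where s: "l2_section s" "S = abs_section_space s" by (rule section_space_cases)
  obtain t where t: "l2_section t" "T = abs_section_space t" by (rule section_space_cases)
  note l2 = l2_section_common_lines_integral
  have "common_lines_integral (\<lambda>x. s x + t x) x = common_lines_integral s x + common_lines_integral t x"
    if x: "norm x = 1" for x
  proof -
    have "common_lines_integral (\<lambda>x. s x + t x) x
        = (\<integral>y. common_lines_kernel x y (s y) + common_lines_kernel x y (t y) \<partial>sphere_haar)"
      unfolding common_lines_integral_def
      using x tan[OF s(1)] tan[OF t(1)] tan[OF l2_section_add[OF s(1) t(1)]]
      by (intro Bochner_Integration.integral_cong)
        (simp_all add: common_lines_kernel_eq(2) inner_add_left add_divide_distrib scaleR_add_left)
    then show ?thesis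
      unfolding common_lines_integral_def
      by (simp add: common_lines_integrable x s t)
  qed
  then show "common_lines_operator (S + T) = common_lines_operator S + common_lines_operator T"
    unfolding s(2) t(2) plus_abs_section_space[OF s(1) t(1)] op[OF s(1)] op[OF t(1)]
      op[OF l2_section_add[OF s(1) t(1)]] plus_abs_section_space[OF l2[OF s(1)] l2[OF t(1)]]
    by (intro abs_section_space_eqI l2 l2_section_add s t)
  have "common_lines_integral (\<lambda>x. c *\<^sub>R s x) x = c *\<^sub>R common_lines_integral s x"
    if x: "norm x = 1" for x
  proof -
    have "common_lines_integral (\<lambda>x. c *\<^sub>R s x) x
        = (\<integral>y. c *\<^sub>R common_lines_kernel x y (s y) \<partial>sphere_haar)"
      unfolding common_lines_integral_def
      using x tan[OF s(1)] tan[OF l2_section_scaleR[OF s(1), of c]]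
      by (intro Bochner_Integration.integral_cong)
        (simp_all add: common_lines_kernel_eq(2) scaleR_diff_right)
    then show ?thesis unfolding common_lines_integral_def by simp
  qed
  then show "common_lines_operator (c *\<^sub>R S) = c *\<^sub>R common_lines_operator S"
    unfolding s(2) scaleR_abs_section_space[OF s(1)] op[OF s(1)]
      op[OF l2_section_scaleR[OF s(1)]] scaleR_abs_section_space[OF l2[OF s(1)]]
    by (intro abs_section_space_eqI l2 l2_section_scaleR s)
  have "(norm (common_lines_operator S))\<^sup>2 = (\<integral>x. (norm (common_lines_integral s x))\<^sup>2 \<partial>sphere_haar)"
    unfolding s(2) op[OF s(1)] by (rule norm_abs_section_space[OF l2[OF s(1)]])
  also have "\<dots> \<le> (\<integral>x. (norm S)\<^sup>2 \<partial>(sphere_haar :: 'a measure))"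
    unfolding s(2)
    by (intro integral_mono l2_sectionD(3) l2 s(1)) (auto intro!: power_mono norm_common_lines_integral_le s(1))
  also have "\<dots> = (norm S)\<^sup>2" by (simp add: prob_space[unfolded space_sphere_haar])
  finally show "norm (common_lines_operator S) \<le> norm S * 1" 
    by (auto intro: power2_le_imp_le)
qed

section \<open>Spectrum\<close>

definition eigenspace :: "('h::real_vector \<Rightarrow> 'h) \<Rightarrow> real \<Rightarrow> 'h set" where
  "eigenspace T \<mu> = {s. T s = \<mu> *\<^sub>R s}"

definition spectrum :: "('h::real_normed_vector \<Rightarrow> 'h) \<Rightarrow> real set" where
  "spectrum T = {\<mu>. \<not> (\<exists>R. bounded_linear R \<and>
     (\<forall>s. R (T s - \<mu> *\<^sub>R s) = s) \<and> (\<forall>s. T (R s) - \<mu> *\<^sub>R R s = s))}"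

text \<open>The spectrum is discrete (pure point) if it consists of eigenvalues whose eigenvectors
  span a dense subspace.\<close>

definition has_discrete_spectrum :: "('h::real_normed_vector \<Rightarrow> 'h) \<Rightarrow> bool" where
  "has_discrete_spectrum T \<longleftrightarrow> (\<forall>\<mu>\<in>spectrum T. eigenspace T \<mu> \<noteq> {0}) \<and>
     closure (span (\<Union>\<mu>\<in>spectrum T. eigenspace T \<mu>)) = UNIV"

end

theory Submission
  imports Defs
begin

text \<open>\<open>C(x, y)\<close> is the orthogonal projection onto the line spanned by \<open>x \<times> y\<close>. It does not change when
\<open>y\<close> is replaced by \<open>- y\<close>, so that \<open>C\<close> kills every field with \<open>s (- y) = - s y\<close>, and \<open>0\<close> is an eigenvalue.
The other eigenvectors are found among polynomial fields. For a vector \<open>a\<close> and \<open>m = n - 1\<close> let \<open>zonal m a\<close>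
be the field \<open>(a \<bullet> y)\<^sup>m a\<^sub>\<bottom>\<close> if \<open>m\<close> is even and \<open>(a \<bullet> y)\<^sup>m (y \<times> a)\<close> if \<open>m\<close> is odd: up to the factor
\<open>n\<close>, the spherical gradient of \<open>(a \<bullet> y)\<^sup>n\<close>, turned by a right angle if \<open>n\<close> is even. In both cases the
field is even. The computation on which everything rests (\<open>common_lines_integral_zonal\<close>) is

\<open>C (zonal m a) = (-1)\<^sup>m / ((m + 1) (m + 2)) \<Sum>\<^bsub>j \<le> m div 2\<^esub> \<bar>a\<bar>\<^bsup>2j\<^esup> zonal (m - 2j) a\<close>.

It shows that \<open>C\<close> is triangular with respect to the degree \<open>n\<close>, with the diagonal entries \<open>\<lambda>\<^sub>n\<close>. The
integral is evaluated in an orthonormal frame \<open>x, h, b\<close> with \<open>a\<close> in the plane of \<open>x\<close> and \<open>h\<close>. It then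
consists of moments of the coordinates of \<open>y\<close> with the singular weight \<open>1 / (1 - (x \<bullet> y)\<^sup>2)\<close>, and
invariance under the rotations about \<open>x\<close> replaces this weight by a constant (\<open>weighted_moment\<close>). The
plain moments that remain follow from invariance under all rotations.

Because the \<open>\<lambda>\<^sub>n\<close> are distinct, a triangular operator can be diagonalised degree by degree. Because \<open>C\<close>
is symmetric, its eigenspaces are orthogonal, and so the eigenspaces found in this way are the whole
eigenspaces as soon as the fields considered span a dense subspace (locale \<open>triangular_operator\<close>). Two
inputs remain.

The dimension. The field of a homogeneous polynomial \<open>f\<close> depends only on the restriction of \<open>f\<close> to the
sphere. There the square of the third coordinate is \<open>1\<close> minus the other two squares, so that modulo lower
degrees the \<open>2n + 1\<close> monomials of degree \<open>n\<close> with third exponent at most \<open>1\<close> suffice. They are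
independent modulo lower degrees: a field vanishes only if its polynomial is constant on the sphere, which
would make a combination of these monomials divisible by \<open>y \<bullet> y\<close>, a quadratic polynomial in the
third coordinate (\<open>monomials_independent_mod_lower\<close>).

The density. The tangential part of \<open>(a \<bullet> y)\<^sup>m v\<close> is odd, hence killed by \<open>C\<close>, if \<open>m\<close> is odd. If \<open>m\<close>
is even, an explicit Hodge decomposition writes it as a sum of a gradient, a turned gradient and the
tangential part of a field of degree \<open>m - 2\<close> (\<open>tangential_section_power_even\<close>). Such fields span the
tangential polynomial fields, which are dense by the theorem of Stone and Weierstrass.

Finally, a symmetric bounded operator whose eigenvectors span a dense subspace has a bounded resolvent at
every point that has a positive distance from the eigenvalues (\<open>resolvent_exists\<close>). As \<open>\<lambda>\<^sub>n\<close> tends to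
\<open>0\<close>, these are all points outside the set of the \<open>\<lambda>\<^sub>n\<close> and \<open>0\<close>.\<close>

section \<open>Comparing coefficients of polynomials\<close>

text \<open>The difference \<open>p (2 s) - 2\<^sup>n p s\<close> has lower degree and takes its values in \<open>S\<close>, which permits an
induction. For a subspace of a function space this is polarization; for \<open>S = {0}\<close> it is comparison of
coefficients.\<close>

lemma coefficients_in_subspace:
  fixes c :: "nat \<Rightarrow> 'v::real_vector"
  assumes S: "subspace S" and "\<And>s. (\<Sum>i\<le>n. s ^ i *\<^sub>R c i) \<in> S" and "i \<le> n"
  shows "c i \<in> S"
  using assms(2,3)
proof (induction n arbitrary: c i)
  case 0
  then show ?case using "0.prems"(1)[of 0] by simp
next
  case (Suc n)
  have low: "c j \<in> S" if "j \<le> n" for j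
  proof -
    have "(\<Sum>i\<le>n. s ^ i *\<^sub>R ((2 ^ i - 2 ^ Suc n) *\<^sub>R c i)) \<in> S" for s :: real
    proof -
      have "(\<Sum>i\<le>Suc n. (2 * s) ^ i *\<^sub>R c i) - 2 ^ Suc n *\<^sub>R (\<Sum>i\<le>Suc n. s ^ i *\<^sub>R c i) \<in> S"
        by (intro subspace_diff[OF S] subspace_scale[OF S] Suc.prems(1))
      also have "(\<Sum>i\<le>Suc n. (2 * s) ^ i *\<^sub>R c i) - 2 ^ Suc n *\<^sub>R (\<Sum>i\<le>Suc n. s ^ i *\<^sub>R c i)
          = (\<Sum>i\<le>n. s ^ i *\<^sub>R ((2 ^ i - 2 ^ Suc n) *\<^sub>R c i))"
        by (simp add: scaleR_sum_right sum_subtractf[symmetric] power_mult_distrib algebra_simps)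
      finally show ?thesis .
    qed
    from Suc.IH[OF this that] have "(2 ^ j - 2 ^ Suc n) *\<^sub>R c j \<in> S" .
    then have "inverse (2 ^ j - 2 ^ Suc n) *\<^sub>R ((2 ^ j - 2 ^ Suc n) *\<^sub>R c j) \<in> S"
      by (rule subspace_scale[OF S])
    moreover have "(2::real) ^ j < 2 ^ Suc n" using that by (intro power_strict_increasing) auto
    ultimately show ?thesis by simp
  qed
  have "(\<Sum>i\<le>Suc n. 1 ^ i *\<^sub>R c i) - (\<Sum>i\<le>n. c i) \<in> S"
    by (intro subspace_diff[OF S] Suc.prems(1) subspace_sum[OF S] low) auto
  then have "c (Suc n) \<in> S" by simp
  with low Suc.prems(2) show ?case by (cases "i = Suc n") auto
qed

lemma equal_coefficients:
  fixes c d :: "nat \<Rightarrow> 'v::real_vector"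
  assumes "\<And>s. (\<Sum>i\<le>n. s ^ i *\<^sub>R c i) = (\<Sum>i\<le>n. s ^ i *\<^sub>R d i)" and "i \<le> n"
  shows "c i = d i"
  using coefficients_in_subspace[where S="{0}" and n=n and c="\<lambda>i. c i - d i" and i=i] assms
  by (auto simp: scaleR_diff_right sum_subtractf)

text \<open>Multiplied by \<open>v\<close>, both sides become \<open>(u + v)\<^bsup>M + 1\<^esup> - u\<^bsup>M + 1\<^esup>\<close>.\<close>

lemma geometric_binomial_sum:
  fixes u v :: real
  shows "(\<Sum>i\<le>M. (Suc M choose Suc i) * u ^ (M - i) * v ^ i) = (\<Sum>j\<le>M. (u + v) ^ j * u ^ (M - j))"
proof (cases "v = 0")
  case True
  have "(\<Sum>i\<le>M. (Suc M choose Suc i) * u ^ (M - i) * v ^ i) = (\<Sum>i\<in>{0}. (Suc M choose Suc i) * u ^ (M - i) * v ^ i)"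
    using True by (intro sum.mono_neutral_right) auto
  also have "\<dots> = (\<Sum>j\<le>M. (u + v) ^ j * u ^ (M - j))"
    using True by (simp add: power_add[symmetric])
  finally show ?thesis .
next
  case False
  have "v * (\<Sum>i\<le>M. (Suc M choose Suc i) * u ^ (M - i) * v ^ i) = (v + u) ^ Suc M - u ^ Suc M"
    unfolding binomial_ring by (subst sum.atMost_Suc_shift) (simp add: sum_distrib_left algebra_simps)
  also have "\<dots> = v * (\<Sum>j\<le>M. (u + v) ^ j * u ^ (M - j))"
    by (subst power_diff_sumr2) (simp add: lessThan_Suc_atMost add.commute mult.commute)
  finally show ?thesis using False by simp
qed

section \<open>Rotation invariant integrals over the sphere\<close>

lemma integral_sphere_haar_orthogonal:
  fixes f :: "'a::euclidean_space \<Rightarrow> 'b::{banach, second_countable_topology}" and T :: "'a \<Rightarrow> 'a"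
  assumes T: "orthogonal_transformation T" and f: "f \<in> borel_measurable sphere_haar"
  shows "(\<integral>y. f (T y) \<partial>sphere_haar) = (\<integral>y. f y \<partial>sphere_haar)"
proof -
  have lin: "linear T" and nrm: "\<And>x. norm (T x) = norm x"
    using T by (auto simp: orthogonal_transformation)
  have [measurable]: "T \<in> borel_measurable borel"
    using lin by (intro borel_measurable_continuous_onI linear_continuous_on)
      (simp add: linear_conv_bounded_linear)
  have "T \<in> restrict_space borel (sphere 0 1) \<rightarrow>\<^sub>M restrict_space borel (sphere 0 1)"
    by (intro measurable_restrict_space3) (auto simp: nrm)
  then have "T \<in> sphere_haar \<rightarrow>\<^sub>M sphere_haar" by (simp cong: measurable_cong_sets)
  from integral_distr[OF this f] show ?thesis by (simp add: sphere_haar_distr_orthogonal[OF T])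
qed

lemma integrable_sphere_haar_bounded:
  fixes f :: "'a::euclidean_space \<Rightarrow> 'b::{banach, second_countable_topology}"
  assumes "f \<in> borel_measurable sphere_haar" "\<And>y. norm y = 1 \<Longrightarrow> norm (f y) \<le> B"
  shows "integrable sphere_haar f"
proof -
  interpret prob_space "sphere_haar :: 'a measure" by (rule prob_space_sphere_haar)
  show ?thesis using assms by (intro integrable_const_bound[of _ B] AE_I2) auto
qed

lemma measurable_sphere_haar_continuous:
  fixes f :: "'a::euclidean_space \<Rightarrow> 'b::topological_space"
  assumes "continuous_on UNIV f"
  shows "f \<in> borel_measurable sphere_haar"
  using measurable_compose[OF measurable_ident_sphere_haar borel_measurable_continuous_onI[OF assms]] .

lemma integrable_sphere_haar_continuous:
  fixes f :: "'a::euclidean_space \<Rightarrow> 'b::{banach, second_countable_topology}"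
  assumes "continuous_on UNIV f"
  shows "integrable sphere_haar f"
proof -
  have "bounded (f ` sphere 0 1)"
    by (intro compact_imp_bounded compact_continuous_image continuous_on_subset[OF assms]) auto
  then obtain B where B: "\<And>x. x \<in> sphere 0 1 \<Longrightarrow> norm (f x) \<le> B"
    unfolding bounded_iff by blast
  then show ?thesis
    by (intro integrable_sphere_haar_bounded[of _ B] measurable_sphere_haar_continuous assms) auto
qed

definition reflection :: "'a::real_inner \<Rightarrow> 'a \<Rightarrow> 'a" where
  "reflection u y = y - (2 * (u \<bullet> y) / (u \<bullet> u)) *\<^sub>R u"

lemma orthogonal_transformation_reflection: "orthogonal_transformation (reflection u)"
  unfolding orthogonal_transformation_def
proof (intro conjI allI)
  show "linear (reflection u)"
    by (rule linearI) (simp_all add: reflection_def inner_add_right algebra_simps add_divide_distrib)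
  fix v w
  show "reflection u v \<bullet> reflection u w = v \<bullet> w"
    by (cases "u = 0") (simp_all add: reflection_def inner_diff_left inner_diff_right inner_commute field_simps)
qed

lemma inner_reflection_orthogonal: "v \<bullet> u = 0 \<Longrightarrow> v \<bullet> reflection u y = v \<bullet> y"
  by (simp add: reflection_def inner_diff_right)

lemma inner_reflection_self: "u \<bullet> reflection u y = - (u \<bullet> y)"
  by (cases "u = 0") (simp_all add: reflection_def inner_diff_right)

text \<open>The reflection that exchanges two vectors of equal length. Invariance under such reflections is the only
form of rotation invariance that the evaluation of the moments uses.\<close>

lemma inner_reflection_diff:
  assumes "norm a = norm b"
  shows "a \<bullet> reflection (a - b) y = b \<bullet> y"
proof (cases "a = b")
  case False
  have "(a - b) \<bullet> (a - b) = 2 * (a \<bullet> (a - b))"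
    using assms by (simp add: inner_diff_left inner_diff_right inner_commute norm_eq_sqrt_inner)
  moreover have "(a - b) \<bullet> (a - b) \<noteq> 0" using False by simp
  ultimately have "2 * (a \<bullet> (a - b)) / ((a - b) \<bullet> (a - b)) = 1" by simp
  then have "((a - b) \<bullet> y) * (2 * (a \<bullet> (a - b)) / ((a - b) \<bullet> (a - b))) = (a - b) \<bullet> y"
    by (simp only: mult_1_right)
  then have "a \<bullet> reflection (a - b) y = a \<bullet> y - ((a - b) \<bullet> y)"
    by (simp add: reflection_def inner_diff_right[of a y] mult.commute mult.left_commute)
  then show ?thesis by (simp add: inner_diff_left)
qed (simp add: reflection_def)

lemma integral_sphere_haar_odd:
  fixes f :: "'a::euclidean_space \<Rightarrow> real" and T :: "'a \<Rightarrow> 'a"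
  assumes "orthogonal_transformation T" "f \<in> borel_measurable sphere_haar" "\<And>y. f (T y) = - f y"
  shows "(\<integral>y. f y \<partial>sphere_haar) = 0"
  using integral_sphere_haar_orthogonal[OF assms(1,2)] assms(3) by simp

text \<open>With \<open>q (x \<bullet> y)\<close> held fixed, the integral of \<open>q (x \<bullet> y) (w \<bullet> y)\<^bsup>2k\<^esup>\<close> over \<open>y\<close> depends, for \<open>w\<close>
in the plane of \<open>h\<close> and \<open>b\<close>, only on \<open>\<bar>w\<bar>\<close>, because the reflection exchanging two such \<open>w\<close> fixes \<open>x\<close>. For
\<open>w = h + s b\<close> it is therefore a multiple of \<open>(1 + s\<^sup>2)\<^sup>k\<close>, and the claim compares the coefficients of
\<open>s\<^bsup>2j\<^esup>\<close>. The choice \<open>x = 0\<close> gives moments without weight.\<close>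

lemma planar_moments:
  fixes x h b :: "'a::euclidean_space" and q :: "real \<Rightarrow> real"
  assumes x: "x \<bullet> h = 0" "x \<bullet> b = 0" and hb: "norm h = 1" "norm b = 1" "h \<bullet> b = 0"
    and int: "\<And>i j. i + j = 2 * k \<Longrightarrow>
      integrable sphere_haar (\<lambda>y. q (x \<bullet> y) * (h \<bullet> y) ^ i * (b \<bullet> y) ^ j)"
    and "j \<le> k"
  shows "(2 * k choose (2 * j)) * (\<integral>y. q (x \<bullet> y) * (h \<bullet> y) ^ (2 * k - 2 * j) * (b \<bullet> y) ^ (2 * j) \<partial>sphere_haar)
    = (k choose j) * (\<integral>y. q (x \<bullet> y) * (h \<bullet> y) ^ (2 * k) \<partial>sphere_haar)" (is "_ = _ * ?E")
proof -
  have bin: "(h \<bullet> y + s * (b \<bullet> y)) ^ (2 * k)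
      = (\<Sum>i\<le>2 * k. s ^ i * (2 * k choose i) * ((h \<bullet> y) ^ (2 * k - i) * (b \<bullet> y) ^ i))" for s y
    using binomial_ring[of "s * (b \<bullet> y)" "h \<bullet> y" "2 * k"]
    by (simp add: power_mult_distrib ac_simps)
  have "(\<Sum>i\<le>2 * k. s ^ i * ((2 * k choose i) *
        (\<integral>y. q (x \<bullet> y) * (h \<bullet> y) ^ (2 * k - i) * (b \<bullet> y) ^ i \<partial>sphere_haar)))
      = (\<Sum>i\<le>2 * k. s ^ i * (if even i then (k choose (i div 2)) * ?E else 0))" for s
  proof -
    have n: "norm (h + s *\<^sub>R b) = norm (sqrt (1 + s\<^sup>2) *\<^sub>R h)"
      using hb by (simp add: norm_eq_sqrt_inner inner_add_left inner_add_right inner_commute power2_eq_square)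
    have o: "x \<bullet> (h + s *\<^sub>R b - sqrt (1 + s\<^sup>2) *\<^sub>R h) = 0"
      using x by (simp add: inner_diff_right inner_add_right)
    have eq: "q (x \<bullet> y) * ((h + s *\<^sub>R b) \<bullet> y) ^ (2 * k) = (\<Sum>i\<le>2 * k. s ^ i * (2 * k choose i) *
        (q (x \<bullet> y) * (h \<bullet> y) ^ (2 * k - i) * (b \<bullet> y) ^ i))" for y
      by (simp add: inner_add_left bin sum_distrib_left mult.assoc mult.left_commute[of "q _"])
    have int': "integrable sphere_haar (\<lambda>y. s ^ i * (2 * k choose i) *
        (q (x \<bullet> y) * (h \<bullet> y) ^ (2 * k - i) * (b \<bullet> y) ^ i))" if "i \<in> {..2 * k}" for i
      using int[of "2 * k - i" i] that by simp
    have I: "integrable sphere_haar (\<lambda>y. q (x \<bullet> y) * ((h + s *\<^sub>R b) \<bullet> y) ^ (2 * k))"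
      unfolding eq by (rule Bochner_Integration.integrable_sum[OF int'])
    have "(\<Sum>i\<le>2 * k. s ^ i * ((2 * k choose i) *
        (\<integral>y. q (x \<bullet> y) * (h \<bullet> y) ^ (2 * k - i) * (b \<bullet> y) ^ i \<partial>sphere_haar)))
      = (\<integral>y. q (x \<bullet> y) * ((h + s *\<^sub>R b) \<bullet> y) ^ (2 * k) \<partial>sphere_haar)"
      unfolding eq by (subst Bochner_Integration.integral_sum[OF int']) (simp_all add: mult.assoc)
    also have "\<dots> = (\<integral>y. q (x \<bullet> y) * ((sqrt (1 + s\<^sup>2) *\<^sub>R h) \<bullet> y) ^ (2 * k) \<partial>sphere_haar)"
      using integral_sphere_haar_orthogonal[OF orthogonal_transformation_reflection borel_measurable_integrable[OF I],
          of "h + s *\<^sub>R b - sqrt (1 + s\<^sup>2) *\<^sub>R h"]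
      by (simp only: inner_reflection_diff[OF n] inner_reflection_orthogonal[OF o])
    also have "\<dots> = (1 + s\<^sup>2) ^ k * ?E"
      by (simp add: power_mult_distrib power_mult[of "sqrt _"] mult.left_commute[of "q _"])
    also have "(1 + s\<^sup>2) ^ k = (\<Sum>i\<le>k. s ^ (2 * i) * (k choose i))"
      using binomial_ring[of "s\<^sup>2" 1 k] unfolding power_mult by (simp add: mult.commute add.commute)
    also have "\<dots> * ?E = (\<Sum>i\<in>(*) 2 ` {..k}. s ^ i * (if even i then (k choose (i div 2)) * ?E else 0))"
      by (subst sum.reindex) (auto simp: inj_on_def sum_distrib_right mult.assoc)
    also have "\<dots> = (\<Sum>i\<le>2 * k. s ^ i * (if even i then (k choose (i div 2)) * ?E else 0))"
      by (rule sum.mono_neutral_left) (auto elim!: evenE)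
    finally show ?thesis .
  qed
  from equal_coefficients[where n = "2 * k" and c = "\<lambda>i. (2 * k choose i) *
        (\<integral>y. q (x \<bullet> y) * (h \<bullet> y) ^ (2 * k - i) * (b \<bullet> y) ^ i \<partial>sphere_haar)"
      and d = "\<lambda>i. if even i then (k choose (i div 2)) * ?E else 0" and i = "2 * j"] this assms(7)
  show ?thesis by simp
qed

section \<open>Symmetric operators with a dense span of eigenvectors\<close>

lemma linear_image_of_span:
  assumes "subspace V" "linear T" "\<And>x. x \<in> S \<Longrightarrow> T x \<in> V" "x \<in> span S"
  shows "T x \<in> V"
proof -
  have "subspace {x. T x \<in> V}"
    using assms(1,2) by (auto intro!: subspaceI simp: linear_0 linear_add linear_scale subspace_0 subspace_add subspace_scale)
  then have "span S \<subseteq> {x. T x \<in> V}" using assms(3) by (intro span_minimal) auto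
  then show ?thesis using assms(4) by blast
qed

lemma subspace_eigenspace:
  assumes "linear T" shows "subspace (eigenspace T \<mu>)"
  using assms by (auto intro!: subspaceI simp: eigenspace_def linear_0 linear_add linear_scale algebra_simps)

lemma eigenspace_orthogonal:
  fixes T :: "'h::real_inner \<Rightarrow> 'h"
  assumes "\<And>s t. T s \<bullet> t = s \<bullet> T t" "s \<in> eigenspace T \<mu>" "t \<in> eigenspace T \<nu>" "\<mu> \<noteq> \<nu>"
  shows "s \<bullet> t = 0"
proof -
  have "\<mu> * (s \<bullet> t) = \<nu> * (s \<bullet> t)"
    using assms(1)[of s t] assms(2,3) by (simp add: eigenspace_def)
  with assms(4) show ?thesis by simp
qed

lemma orthogonal_projection_exists:
  fixes B :: "'h::real_inner set"
  assumes "finite B"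
  obtains p where "p \<in> span B" "\<And>y. y \<in> span B \<Longrightarrow> (s - p) \<bullet> y = 0"
proof -
  obtain D where D: "finite D" "span D = span B" "pairwise orthogonal D"
    using basis_orthogonal[OF assms] by blast
  define p where "p = (\<Sum>d\<in>D. (s \<bullet> d / (d \<bullet> d)) *\<^sub>R d)"
  have "(s - p) \<bullet> d = 0" if d: "d \<in> D" for d
  proof -
    have "p \<bullet> d = (\<Sum>e\<in>D. if e = d then s \<bullet> d else 0)"
      unfolding p_def inner_sum_left
    proof (rule sum.cong[OF refl])
      fix e assume "e \<in> D"
      then show "(s \<bullet> e / (e \<bullet> e)) *\<^sub>R e \<bullet> d = (if e = d then s \<bullet> d else 0)"
        using d D(3) by (auto simp: pairwise_def orthogonal_def)
    qed
    then show ?thesis using D(1) d by (simp add: inner_diff_left)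
  qed
  then have "span D \<subseteq> {y. (s - p) \<bullet> y = 0}"
    by (intro span_minimal subspaceI) (auto simp: inner_add_right)
  moreover have "p \<in> span D" unfolding p_def by (intro span_sum span_scale span_base)
  ultimately show thesis using that D(2) by blast
qed

lemma orthogonal_to_dense_imp_zero:
  fixes X :: "'h::real_inner set"
  assumes dense: "closure (span X) = UNIV" and orth: "\<And>x. x \<in> X \<Longrightarrow> s \<bullet> x = 0"
  shows "s = 0"
proof -
  have "closed {y. s \<bullet> y = 0}"
    by (intro closed_Collect_eq continuous_intros)
  moreover have "span X \<subseteq> {y. s \<bullet> y = 0}"
    using orth by (intro span_minimal subspaceI) (auto simp: inner_add_right)
  ultimately have "closure (span X) \<subseteq> {y. s \<bullet> y = 0}" by (rule closure_minimal[rotated])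
  then have "s \<in> {y. s \<bullet> y = 0}" unfolding dense by (rule subsetD) simp
  then show ?thesis by simp
qed

lemma spectrum_if_eigenvalue:
  assumes "eigenspace T \<mu> \<noteq> {0}" "linear T"
  shows "\<mu> \<in> spectrum T"
proof -
  have "0 \<in> eigenspace T \<mu>" using assms(2) by (simp add: eigenspace_def linear_0)
  then obtain s where s: "s \<in> eigenspace T \<mu>" "s \<noteq> 0" using assms(1) by blast
  show ?thesis unfolding spectrum_def
  proof (clarify)
    fix R :: "'a \<Rightarrow> 'a" assume R: "bounded_linear R" "\<forall>s. R (T s - \<mu> *\<^sub>R s) = s"
    have "R 0 = s" using R(2)[rule_format, of s] s(1) by (simp add: eigenspace_def)
    then show False using s(2) linear_0[OF bounded_linear.linear[OF R(1)]] by simp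
  qed
qed

text \<open>Eigenvectors for different eigenvalues are orthogonal, so Pythagoras applies to \<open>s\<close> and to
\<open>T s - \<mu> s\<close>, whose components differ by the factors \<open>\<nu> - \<mu>\<close>.\<close>

lemma span_eigenspaces_lower_bound:
  fixes T :: "'h::real_inner \<Rightarrow> 'h"
  assumes T: "linear T" and sym: "\<And>s t. T s \<bullet> t = s \<bullet> T t"
    and gap: "\<And>\<nu>. \<nu> \<in> E \<Longrightarrow> \<delta> \<le> \<bar>\<nu> - \<mu>\<bar>" "0 \<le> \<delta>"
    and s: "s \<in> span (\<Union>\<nu>\<in>E. eigenspace T \<nu>)"
  shows "\<delta> * norm s \<le> norm (T s - \<mu> *\<^sub>R s)"
proof -
  have "\<exists>F e. finite F \<and> F \<subseteq> E \<and> (\<forall>\<nu>\<in>F. e \<nu> \<in> eigenspace T \<nu>) \<and> s = (\<Sum>\<nu>\<in>F. e \<nu>)"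
    using s
  proof (induction rule: span_induct_alt)
    case base
    show ?case by (intro exI[of _ "{}"]) auto
  next
    case (step c x y)
    then obtain F e \<nu> where F: "finite F" "F \<subseteq> E" "\<forall>\<nu>\<in>F. e \<nu> \<in> eigenspace T \<nu>" "y = (\<Sum>\<nu>\<in>F. e \<nu>)"
      and \<nu>: "\<nu> \<in> E" "x \<in> eigenspace T \<nu>" by blast
    define e' where "e' \<xi> = (if \<xi> \<in> F then e \<xi> else 0) + (if \<xi> = \<nu> then c *\<^sub>R x else 0)" for \<xi>
    have "c *\<^sub>R x \<in> eigenspace T \<nu>" using \<nu>(2) subspace_scale[OF subspace_eigenspace[OF T]] by blast
    then have "\<forall>\<xi>\<in>insert \<nu> F. e' \<xi> \<in> eigenspace T \<xi>"
      using F(3) by (auto simp: e'_def intro!: subspace_add[OF subspace_eigenspace[OF T]] subspace_0[OF subspace_eigenspace[OF T]])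
    moreover have "(\<Sum>\<xi>\<in>insert \<nu> F. e' \<xi>) = (\<Sum>\<xi>\<in>insert \<nu> F. if \<xi> \<in> F then e \<xi> else 0) + (\<Sum>\<xi>\<in>insert \<nu> F. if \<xi> = \<nu> then c *\<^sub>R x else 0)"
      unfolding e'_def by (rule sum.distrib)
    moreover have "(\<Sum>\<xi>\<in>insert \<nu> F. if \<xi> \<in> F then e \<xi> else 0) = (\<Sum>\<xi>\<in>F. e \<xi>)"
      using F(1) by (intro sum.mono_neutral_cong_right) auto
    moreover have "(\<Sum>\<xi>\<in>insert \<nu> F. if \<xi> = \<nu> then c *\<^sub>R x else 0) = c *\<^sub>R x"
      using F(1) by (subst sum.delta) auto
    ultimately show ?case using F \<nu>(1)
      by (intro exI[of _ "insert \<nu> F"] exI[of _ e']) (simp add: add.commute)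
  qed
  then obtain F e where F: "finite F" "F \<subseteq> E" and e: "\<And>\<nu>. \<nu> \<in> F \<Longrightarrow> e \<nu> \<in> eigenspace T \<nu>" and s: "s = (\<Sum>\<nu>\<in>F. e \<nu>)"
    by blast
  have orth: "e \<nu> \<bullet> e \<xi> = 0" if "\<nu> \<in> F" "\<xi> \<in> F" "\<nu> \<noteq> \<xi>" for \<nu> \<xi>
    using eigenspace_orthogonal[OF sym e[OF that(1)] e[OF that(2)] that(3)] .
  have pyth: "(norm (\<Sum>\<nu>\<in>F. c \<nu> *\<^sub>R e \<nu>))\<^sup>2 = (\<Sum>\<nu>\<in>F. (c \<nu>)\<^sup>2 * (norm (e \<nu>))\<^sup>2)" for c
  proof -
    have "(norm (\<Sum>\<nu>\<in>F. c \<nu> *\<^sub>R e \<nu>))\<^sup>2 = (\<Sum>\<nu>\<in>F. (norm (c \<nu> *\<^sub>R e \<nu>))\<^sup>2)"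
      by (rule norm_sum_Pythagorean[OF F(1)]) (auto simp: pairwise_def orthogonal_def orth)
    then show ?thesis by (simp add: power_mult_distrib)
  qed
  have "T s - \<mu> *\<^sub>R s = (\<Sum>\<nu>\<in>F. (\<nu> - \<mu>) *\<^sub>R e \<nu>)"
    unfolding s linear_sum[OF T] scaleR_sum_right sum_subtractf[symmetric]
    using e by (intro sum.cong refl) (simp add: eigenspace_def algebra_simps)
  then have "(norm (T s - \<mu> *\<^sub>R s))\<^sup>2 = (\<Sum>\<nu>\<in>F. (\<nu> - \<mu>)\<^sup>2 * (norm (e \<nu>))\<^sup>2)" by (simp add: pyth)
  also have "\<dots> \<ge> (\<Sum>\<nu>\<in>F. \<delta>\<^sup>2 * (norm (e \<nu>))\<^sup>2)"
  proof (intro sum_mono mult_right_mono)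
    fix \<nu> assume "\<nu> \<in> F"
    then have "\<delta> \<le> \<bar>\<nu> - \<mu>\<bar>" using F(2) gap(1) by blast
    then show "\<delta>\<^sup>2 \<le> (\<nu> - \<mu>)\<^sup>2" using gap(2) by (metis power2_abs power_mono)
  qed simp
  also have "(\<Sum>\<nu>\<in>F. \<delta>\<^sup>2 * (norm (e \<nu>))\<^sup>2) = (\<delta> * norm s)\<^sup>2"
    using pyth[of "\<lambda>_. 1"] by (simp add: s power_mult_distrib sum_distrib_left)
  finally show ?thesis by (rule power2_le_imp_le) simp
qed

text \<open>By density, \<open>\<delta> \<bar>s\<bar> \<le> \<bar>T s - \<mu> s\<bar>\<close> holds for all \<open>s\<close>. So \<open>T - \<mu>\<close> is injective with closed range,
and the range contains all the eigenvectors, hence everything; the inverse is bounded by \<open>1 / \<delta>\<close>.\<close>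

lemma resolvent_exists:
  fixes T :: "'h::{real_inner, complete_space} \<Rightarrow> 'h"
  assumes T: "bounded_linear T" and sym: "\<And>s t. T s \<bullet> t = s \<bullet> T t"
    and dense: "closure (span (\<Union>\<nu>\<in>E. eigenspace T \<nu>)) = UNIV"
    and gap: "\<And>\<nu>. \<nu> \<in> E \<Longrightarrow> \<delta> \<le> \<bar>\<nu> - \<mu>\<bar>" "0 < \<delta>"
  shows "\<mu> \<notin> spectrum T"
proof -
  let ?X = "\<Union>\<nu>\<in>E. eigenspace T \<nu>"
  interpret T: bounded_linear T by (rule T)
  define A where "A s = T s - \<mu> *\<^sub>R s" for s
  have A: "bounded_linear A"
    unfolding A_def by (intro bounded_linear_sub T bounded_linear_scaleR_right)
  interpret A: bounded_linear A by (rule A)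
  have contA: "continuous_on UNIV A" by (rule linear_continuous_on[OF A])
  have lower: "\<delta> * norm s \<le> norm (A s)" for s
  proof -
    have "closed {s. \<delta> * norm s \<le> norm (A s)}"
      by (intro closed_Collect_le continuous_intros contA)
    moreover have "span ?X \<subseteq> {s. \<delta> * norm s \<le> norm (A s)}"
      using span_eigenspaces_lower_bound[OF T.linear sym gap(1) less_imp_le[OF gap(2)]]
      by (auto simp: A_def)
    ultimately have "closure (span ?X) \<subseteq> {s. \<delta> * norm s \<le> norm (A s)}" by (rule closure_minimal[rotated])
    then have "s \<in> {s. \<delta> * norm s \<le> norm (A s)}" unfolding dense by (rule subsetD) simp
    then show ?thesis by simp
  qed
  have inj: "s = t" if "A s = A t" for s t
    using lower[of "s - t"] that gap(2) by (simp add: A.diff mult_le_0_iff)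
  have "Topological_Spaces.complete (A ` UNIV)"
  proof (rule complete_isometric_image[of \<delta>])
    show "Topological_Spaces.complete (UNIV :: 'h set)" by (rule complete_UNIV)
  qed (use gap lower A in \<open>auto\<close>)
  then have "closed (range A)" by (rule complete_imp_closed)
  moreover have "span ?X \<subseteq> range A"
  proof (rule span_minimal)
    show "subspace (range A)" by (rule linear_subspace_image[OF A.linear subspace_UNIV])
    show "?X \<subseteq> range A"
    proof
      fix x assume "x \<in> ?X"
      then obtain \<nu> where \<nu>: "\<nu> \<in> E" "T x = \<nu> *\<^sub>R x" by (auto simp: eigenspace_def)
      have "\<nu> \<noteq> \<mu>" using gap \<nu>(1) by force
      then have "A (inverse (\<nu> - \<mu>) *\<^sub>R x) = x"
        by (simp add: A.scaleR) (simp add: A_def \<nu>(2) flip: scaleR_diff_left)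
      then show "x \<in> range A" by (metis rangeI)
    qed
  qed
  ultimately have "closure (span ?X) \<subseteq> range A" by (rule closure_minimal[rotated])
  then have "s \<in> range A" for s unfolding dense by (rule subsetD) simp
  then have surj: "\<exists>t. A t = s" for s by (metis imageE)
  define R where "R s = (THE t. A t = s)" for s
  have AR: "A (R s) = s" for s
    unfolding R_def by (rule theI') (use surj inj in blast)
  have RA: "R (A s) = s" for s by (rule inj) (rule AR)
  have "bounded_linear R"
  proof (rule bounded_linear_intro[where K="1 / \<delta>"])
    show "R (x + y) = R x + R y" for x y by (rule inj) (simp add: AR A.add)
    show "R (r *\<^sub>R x) = r *\<^sub>R R x" for r x by (rule inj) (simp add: AR A.scaleR)
    show "norm (R x) \<le> norm x * (1 / \<delta>)" for x
      using lower[of "R x"] gap(2) by (simp add: AR field_simps)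
  qed
  then show ?thesis using AR RA unfolding spectrum_def A_def by blast
qed

section \<open>Triangular operators\<close>

lemma independent_familyI:
  fixes e :: "'i \<Rightarrow> 'h::real_vector"
  assumes fin: "finite I" and zero: "\<And>c i. (\<Sum>i\<in>I. c i *\<^sub>R e i) = 0 \<Longrightarrow> i \<in> I \<Longrightarrow> c i = 0"
  shows "inj_on e I" "independent (e ` I)"
proof -
  show inj: "inj_on e I"
  proof (rule inj_onI, rule ccontr)
    fix i j assume ij: "i \<in> I" "j \<in> I" "e i = e j" "i \<noteq> j"
    define c :: "'i \<Rightarrow> real" where "c k = (if k = i then 1 else 0) - (if k = j then 1 else 0)" for k
    have "(\<Sum>k\<in>I. c k *\<^sub>R e k) = (\<Sum>k\<in>I. if k = i then e k else 0) - (\<Sum>k\<in>I. if k = j then e k else 0)"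
      unfolding sum_subtractf[symmetric] by (intro sum.cong) (auto simp: c_def)
    then have "(\<Sum>k\<in>I. c k *\<^sub>R e k) = 0" using ij fin by simp
    from zero[OF this ij(1)] show False using ij(4) by (simp add: c_def)
  qed
  show "independent (e ` I)"
    unfolding dependent_finite[OF finite_imageI[OF fin]] sum.reindex[OF inj] o_def
    using zero[of "\<lambda>i. u (e i)" for u] by auto
qed

text \<open>A symmetric operator that acts on the degree \<open>n\<close> vectors \<open>G n\<close> as the scalar \<open>lam n\<close>, up to vectors of
lower degree of the same parity, which span \<open>L n\<close>. Modulo \<open>L n\<close> the finite family \<open>b n\<close> is a basis
of the span of \<open>G n\<close>. Together with the kernel, the \<open>G n\<close> span a dense subspace.\<close>

locale triangular_operator =
  fixes T :: "'h::real_inner \<Rightarrow> 'h" and lam :: "nat \<Rightarrow> real" and G :: "nat \<Rightarrow> 'h set"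
    and I :: "nat \<Rightarrow> 'i set" and b :: "nat \<Rightarrow> 'i \<Rightarrow> 'h"
  assumes linear: "linear T" and symmetric: "T s \<bullet> t = s \<bullet> T t"
    and lam_inj: "inj_on lam {1..}" and lam_nonzero: "n \<ge> 1 \<Longrightarrow> lam n \<noteq> 0"
    and finite_index: "finite (I n)"
  fixes L assumes L_def: "L n = span (\<Union>k\<in>{k. 1 \<le> k \<and> k < n \<and> (even k \<longleftrightarrow> even n)}. G k)"
  assumes triangular: "n \<ge> 1 \<Longrightarrow> x \<in> G n \<Longrightarrow> T x - lam n *\<^sub>R x \<in> L n"
    and generators: "n \<ge> 1 \<Longrightarrow> b n ` I n \<subseteq> span (G n)" "n \<ge> 1 \<Longrightarrow> G n \<subseteq> span (b n ` I n \<union> L n)"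
    and independent_mod: "n \<ge> 1 \<Longrightarrow> (\<Sum>i\<in>I n. c i *\<^sub>R b n i) \<in> L n \<Longrightarrow> i \<in> I n \<Longrightarrow> c i = 0"
    and dense: "closure (span (eigenspace T 0 \<union> (\<Union>n\<in>{1..}. G n))) = UNIV"
begin

abbreviation below :: "nat \<Rightarrow> nat set" where
  "below n \<equiv> {k. 1 \<le> k \<and> k < n \<and> (even k \<longleftrightarrow> even n)}"

definition M :: "nat \<Rightarrow> 'h set" where "M n = span (G n \<union> L n)"

text \<open>The part of the eigenspace that is visible in degrees up to \<open>n\<close>. It is the whole eigenspace, but
this has to wait for the density argument in \<open>eigenspace_basis\<close>.\<close>

definition F :: "nat \<Rightarrow> 'h set" where "F n = eigenspace T (lam n) \<inter> M n"

lemma subspace_L: "subspace (L n)"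
  unfolding L_def by (rule subspace_span)

lemma M_subset_L: "k \<in> below n \<Longrightarrow> M k \<subseteq> L n"
  unfolding M_def
proof (rule span_minimal[OF _ subspace_L])
  assume k: "k \<in> below n"
  then have "L k \<subseteq> L n" unfolding L_def by (intro span_mono) auto
  moreover have "G k \<subseteq> L n" unfolding L_def using k by (auto intro: span_base)
  ultimately show "G k \<union> L k \<subseteq> L n" by blast
qed

lemma L_subset_M: "L n \<subseteq> M n" and G_subset_M: "G n \<subseteq> M n"
  unfolding M_def by (auto intro: span_base)

lemma lam_distinct: "k \<in> below n \<Longrightarrow> lam k \<noteq> lam n"
  using inj_onD[OF lam_inj, of k n] by auto

lemma T_L: "x \<in> L n \<Longrightarrow> T x \<in> L n"
proof -
  assume x: "x \<in> L n"
  show "T x \<in> L n"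
  proof (rule linear_image_of_span[OF subspace_L linear _ x[unfolded L_def]])
    fix g assume "g \<in> (\<Union>k\<in>below n. G k)"
    then obtain k where k: "k \<in> below n" "g \<in> G k" by blast
    have "T g - lam k *\<^sub>R g \<in> L n" "g \<in> L n"
      using triangular[OF _ k(2)] k(1) M_subset_L[OF k(1)] L_subset_M[of k] G_subset_M[of k] k(2) by auto
    then have "(T g - lam k *\<^sub>R g) + lam k *\<^sub>R g \<in> L n"
      by (intro subspace_add[OF subspace_L] subspace_scale[OF subspace_L])
    then show "T g \<in> L n" by simp
  qed
qed

text \<open>\<open>T - lam n\<close> is invertible on the eigenvectors of lower degree, since their eigenvalues differ from
\<open>lam n\<close>.\<close>

lemma solve_below:
  assumes z: "z \<in> span (\<Union>k\<in>below n. F k)"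
  shows "\<exists>w\<in>L n. T w - lam n *\<^sub>R w = z"
  using z
proof (induction rule: span_induct_alt)
  case base
  show ?case using subspace_0[OF subspace_L] by (intro bexI[of _ 0]) (auto simp: linear_0[OF linear])
next
  case (step c x y)
  then obtain w k where w: "w \<in> L n" "T w - lam n *\<^sub>R w = y" and k: "k \<in> below n" "x \<in> F k" by blast
  define d where "d = lam k - lam n"
  have d: "d \<noteq> 0" using lam_distinct[OF k(1)] by (simp add: d_def)
  have "x \<in> L n" using M_subset_L[OF k(1)] k(2) by (auto simp: F_def)
  define r where "r = c / d"
  have "w + r *\<^sub>R x \<in> L n"
    using \<open>x \<in> L n\<close> by (intro subspace_add[OF subspace_L] subspace_scale[OF subspace_L] w(1))
  moreover have "T (w + r *\<^sub>R x) - lam n *\<^sub>R (w + r *\<^sub>R x) = (T w - lam n *\<^sub>R w) + (r * d) *\<^sub>R x"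
    using k(2) by (simp add: linear_add[OF linear] linear_scale[OF linear] F_def eigenspace_def d_def algebra_simps)
  moreover have "r * d = c" using d by (simp add: r_def)
  ultimately show ?case using w(2) by (intro bexI[of _ "w + r *\<^sub>R x"]) (auto simp: add.commute)
qed

text \<open>The error \<open>T x - lam n x\<close> has lower degree, so it can be cancelled by a correction \<open>w\<close> of lower
degree.\<close>

lemma split_eigenvector:
  assumes n: "n \<ge> 1" and L: "L n \<subseteq> span (\<Union>k\<in>below n. F k)" and x: "x \<in> M n"
  obtains w where "w \<in> L n" "x - w \<in> F n"
proof -
  have "T x - lam n *\<^sub>R x \<in> L n"
  proof (rule linear_image_of_span[OF subspace_L _ _ x[unfolded M_def]])
    show "linear (\<lambda>x. T x - lam n *\<^sub>R x)"
      by (rule linearI) (simp_all add: linear_add[OF linear] linear_scale[OF linear] algebra_simps)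
    show "T g - lam n *\<^sub>R g \<in> L n" if "g \<in> G n \<union> L n" for g
      using that triangular[OF n, of g] T_L[of g n] subspace_diff[OF subspace_L] subspace_scale[OF subspace_L] by blast
  qed
  then obtain w where w: "w \<in> L n" "T w - lam n *\<^sub>R w = T x - lam n *\<^sub>R x"
    using solve_below[of _ n] L by blast
  have "T (x - w) = lam n *\<^sub>R (x - w)"
    using w(2) by (simp add: linear_diff[OF linear] scaleR_diff_right algebra_simps)
  moreover have "x - w \<in> M n"
    using x L_subset_M w(1) unfolding M_def by (intro span_diff) auto
  ultimately show thesis using that w(1) by (auto simp: F_def eigenspace_def)
qed

lemma L_subset_span_F: "L n \<subseteq> span (\<Union>k\<in>below n. F k)"
proof (induction n rule: less_induct)
  case (less n)
  have "(\<Union>k\<in>below n. G k) \<subseteq> span (\<Union>k\<in>below n. F k)"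
  proof
    fix g assume "g \<in> (\<Union>k\<in>below n. G k)"
    then obtain k where k: "k \<in> below n" "g \<in> G k" by blast
    have Lk: "L k \<subseteq> span (\<Union>j\<in>below k. F j)" using less.IH[of k] k(1) by simp
    obtain w where w: "w \<in> L k" "g - w \<in> F k"
      using split_eigenvector[OF _ Lk, of g] k G_subset_M by auto
    have "(\<Union>j\<in>below k. F j) \<subseteq> (\<Union>j\<in>below n. F j)" using k(1) by auto
    then have "w \<in> span (\<Union>j\<in>below n. F j)" using w(1) Lk span_mono by blast
    moreover have "g - w \<in> span (\<Union>j\<in>below n. F j)" using w(2) k(1) by (intro span_base) blast
    ultimately have "(g - w) + w \<in> span (\<Union>j\<in>below n. F j)" by (intro span_add)
    then show "g \<in> span (\<Union>j\<in>below n. F j)" by simp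
  qed
  then show ?case unfolding L_def[of n] by (rule span_minimal[OF _ subspace_span])
qed

lemma eigenspace_Int_L:
  assumes "n \<ge> 1" "s \<in> eigenspace T (lam n)" "s \<in> L n"
  shows "s = 0"
proof -
  have "span (\<Union>k\<in>below n. F k) \<subseteq> {y. s \<bullet> y = 0}"
  proof (rule span_minimal)
    show "(\<Union>k\<in>below n. F k) \<subseteq> {y. s \<bullet> y = 0}"
    proof
      fix y assume "y \<in> (\<Union>k\<in>below n. F k)"
      then obtain k where k: "k \<in> below n" "y \<in> eigenspace T (lam k)" by (auto simp: F_def)
      show "y \<in> {y. s \<bullet> y = 0}"
        using eigenspace_orthogonal[OF symmetric assms(2) k(2)] lam_distinct[OF k(1)] by simp
    qed
  qed (auto intro!: subspaceI simp: inner_add_right)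
  then have "s \<bullet> s = 0" using assms(3) L_subset_span_F by blast
  then show ?thesis by simp
qed

text \<open>Corrected by vectors of lower degree, the \<open>b n\<close> become eigenvectors, and they span \<open>F n\<close>. An
eigenvector for \<open>lam n\<close> orthogonal to them is orthogonal to the other eigenspaces as well, hence to a dense
subspace, and vanishes.\<close>

lemma eigenspace_basis:
  assumes n: "n \<ge> 1"
  obtains e where "inj_on e (I n)" "independent (e ` I n)" "span (e ` I n) = eigenspace T (lam n)"
proof -
  have bM: "b n i \<in> M n" if "i \<in> I n" for i
    using generators(1)[OF n] that span_mono[of "G n" "G n \<union> L n"] unfolding M_def by blast
  then have "\<forall>i\<in>I n. \<exists>w. w \<in> L n \<and> b n i - w \<in> F n"
    using split_eigenvector[OF n L_subset_span_F] by metis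
  then obtain w where w: "\<And>i. i \<in> I n \<Longrightarrow> w i \<in> L n" "\<And>i. i \<in> I n \<Longrightarrow> b n i - w i \<in> F n" by metis
  define e where "e i = b n i - w i" for i
  have eF: "e ` I n \<subseteq> F n" using w(2) by (auto simp: e_def)
  have zero: "c i = 0" if "(\<Sum>i\<in>I n. c i *\<^sub>R e i) = 0" "i \<in> I n" for c i
  proof -
    have "(\<Sum>i\<in>I n. c i *\<^sub>R b n i) = (\<Sum>i\<in>I n. c i *\<^sub>R w i)"
      using that(1) by (simp add: e_def scaleR_diff_right sum_subtractf)
    also have "\<dots> \<in> L n" by (intro subspace_sum[OF subspace_L] subspace_scale[OF subspace_L] w(1))
    finally show ?thesis using independent_mod[OF n _ that(2)] by blast
  qed
  have ind: "inj_on e (I n)" "independent (e ` I n)"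
    by (rule independent_familyI[OF finite_index]; rule zero; assumption)+
  have eE: "span (e ` I n) \<subseteq> eigenspace T (lam n)"
    using eF by (intro span_minimal subspace_eigenspace linear) (auto simp: F_def)
  have F_sub: "F n \<subseteq> span (e ` I n)"
  proof
    fix s assume s: "s \<in> F n"
    have "b n ` I n \<subseteq> span (e ` I n \<union> L n)"
    proof (rule image_subsetI)
      fix i assume i: "i \<in> I n"
      have "e i + w i \<in> span (e ` I n \<union> L n)" using i w(1) by (intro span_add span_base) auto
      then show "b n i \<in> span (e ` I n \<union> L n)" by (simp add: e_def)
    qed
    then have "span (b n ` I n \<union> L n) \<subseteq> span (e ` I n \<union> L n)"
      by (intro span_minimal subspace_span Un_least) (auto intro: span_base)
    then have "M n \<subseteq> span (e ` I n \<union> L n)"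
      unfolding M_def using generators(2)[OF n]
      by (intro span_minimal subspace_span Un_least) (auto intro: span_base)
    then have "s \<in> span (e ` I n \<union> L n)" using s by (auto simp: F_def)
    then obtain u v where uv: "s = u + v" "u \<in> span (e ` I n)" "v \<in> span (L n)"
      unfolding span_Un by blast
    have "v \<in> L n" using uv(3) span_eq_iff[THEN iffD2, OF subspace_L] by blast
    moreover have "s - u \<in> eigenspace T (lam n)"
      using s eE uv(2) by (intro subspace_diff subspace_eigenspace linear) (auto simp: F_def)
    ultimately have "v = 0" using eigenspace_Int_L[OF n, of v] uv(1) by simp
    then show "s \<in> span (e ` I n)" using uv by simp
  qed
  have "eigenspace T (lam n) \<subseteq> span (e ` I n)"
  proof
    fix s assume s: "s \<in> eigenspace T (lam n)"
    obtain p where p: "p \<in> span (e ` I n)" "\<And>y. y \<in> span (e ` I n) \<Longrightarrow> (s - p) \<bullet> y = 0"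
      using orthogonal_projection_exists[OF finite_imageI[OF finite_index]] by metis
    have r: "s - p \<in> eigenspace T (lam n)"
      using s eE p(1) by (intro subspace_diff subspace_eigenspace linear) auto
    have rF: "(s - p) \<bullet> y = 0" if "y \<in> F k" "k \<ge> 1" for y k
    proof (cases "k = n")
      case True
      then show ?thesis using that F_sub p(2) by blast
    next
      case False
      then have "lam n \<noteq> lam k" using inj_onD[OF lam_inj, of n k] that n by auto
      then show ?thesis using eigenspace_orthogonal[OF symmetric r, of y "lam k"] that by (auto simp: F_def)
    qed
    have rL: "(s - p) \<bullet> y = 0" if "y \<in> L k" for y k
    proof -
      have "span (\<Union>j\<in>below k. F j) \<subseteq> {y. (s - p) \<bullet> y = 0}"
        using rF by (intro span_minimal subspaceI) (auto simp: inner_add_right)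
      then show ?thesis using that L_subset_span_F by blast
    qed
    have "s - p = 0"
    proof (rule orthogonal_to_dense_imp_zero[OF dense])
      fix x assume "x \<in> eigenspace T 0 \<union> (\<Union>n\<in>{1..}. G n)"
      then show "(s - p) \<bullet> x = 0"
      proof
        assume "x \<in> eigenspace T 0"
        then show ?thesis using eigenspace_orthogonal[OF symmetric r] lam_nonzero[OF n] by blast
      next
        assume "x \<in> (\<Union>n\<in>{1..}. G n)"
        then obtain k where k: "k \<ge> 1" "x \<in> G k" by auto
        obtain w where w: "w \<in> L k" "x - w \<in> F k"
          using split_eigenvector[OF k(1) L_subset_span_F, of x] k(2) G_subset_M by blast
        have "(s - p) \<bullet> ((x - w) + w) = 0"
          unfolding inner_add_right using rF[OF w(2) k(1)] rL[OF w(1)] by simp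
        then show ?thesis by simp
      qed
    qed
    then show "s \<in> span (e ` I n)" using p(1) by simp
  qed
  with eE ind that show thesis by blast
qed

theorem dim_eigenspace: "n \<ge> 1 \<Longrightarrow> dim (eigenspace T (lam n)) = card (I n)"
proof -
  assume n: "n \<ge> 1"
  obtain e where e: "inj_on e (I n)" "independent (e ` I n)" "span (e ` I n) = eigenspace T (lam n)"
    using eigenspace_basis[OF n] by blast
  have "dim (eigenspace T (lam n)) = card (e ` I n)"
    using dim_eq_card[of "e ` I n" "eigenspace T (lam n)"] e(2,3) by (metis span_span)
  then show ?thesis using card_image[OF e(1)] by simp
qed

theorem eigenspaces_dense: "closure (span (\<Union>\<nu>\<in>lam ` {1..} \<union> {0}. eigenspace T \<nu>)) = UNIV"
proof -
  let ?E = "\<Union>\<nu>\<in>lam ` {1..} \<union> {0}. eigenspace T \<nu>"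
  have F: "F k \<subseteq> span ?E" if "k \<ge> 1" for k
    using that by (auto simp: F_def intro!: span_base)
  have "G k \<subseteq> span ?E" if k: "k \<ge> 1" for k
  proof
    fix x assume "x \<in> G k"
    then obtain w where w: "w \<in> L k" "x - w \<in> F k"
      using split_eigenvector[OF k L_subset_span_F, of x] G_subset_M by blast
    have "span (\<Union>j\<in>below k. F j) \<subseteq> span ?E" using F by (intro span_minimal subspace_span) auto
    then have "w \<in> span ?E" using w(1) L_subset_span_F by blast
    then have "(x - w) + w \<in> span ?E" using F[OF k] w(2) by (intro span_add) auto
    then show "x \<in> span ?E" by simp
  qed
  then have "span (eigenspace T 0 \<union> (\<Union>n\<in>{1..}. G n)) \<subseteq> span ?E"
    by (intro span_minimal subspace_span) (auto intro: span_base)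
  from closure_mono[OF this] show ?thesis unfolding dense by blast
qed

end

section \<open>The cross product and the moments of the two-dimensional sphere\<close>

lemma measure_sphere_haar_UNIV [simp]: "measure sphere_haar (sphere (0::'a::euclidean_space) 1) = 1"
  using prob_space.prob_space[OF prob_space_sphere_haar] by simp

lemma continuous_monomial:
  fixes a v :: "'a::euclidean_space"
  shows "continuous_on UNIV (\<lambda>y. (a \<bullet> y) ^ i * (v \<bullet> y) ^ j)"
  by (intro continuous_intros)

text \<open>An oriented three-dimensional Euclidean space, given by its cross product. The last identity contains all
the metric information: orthonormal frames and norms are computed from it.\<close>

locale cross_product =
  fixes cross :: "'a::euclidean_space \<Rightarrow> 'a \<Rightarrow> 'a"
  assumes dim3: "DIM('a) = 3"
    and bounded_bilinear_cross: "bounded_bilinear cross"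
    and cross_skew: "cross x y = - cross y x"
    and cross_perp: "cross x y \<bullet> x = 0"
    and cross_cross: "cross x (cross y z) = (x \<bullet> z) *\<^sub>R y - (x \<bullet> y) *\<^sub>R z"

text \<open>The cross product of \<open>real ^ 3\<close> is transported along a linear isometry.\<close>

lemma cross_product_exists:
  assumes "DIM('a::euclidean_space) = 3"
  obtains cross :: "'a::euclidean_space \<Rightarrow> 'a \<Rightarrow> 'a" where "cross_product cross"
proof -
  have "dim (UNIV :: 'a set) = dim (UNIV :: (real^3) set)" using assms by simp
  then obtain f :: "'a \<Rightarrow> real^3" and g where f: "linear f" "linear g"
    "\<And>x. norm (f x) = norm x" "\<And>x. norm (g x) = norm x" "\<And>x. g (f x) = x" "\<And>x. f (g x) = x"
    by (rule isometries_subspaces[OF subspace_UNIV subspace_UNIV]) auto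
  \<comment> \<open>Norms determine inner products, so the isometries preserve them.\<close>
  have inner: "x \<bullet> y = ((norm (x + y))\<^sup>2 - (norm (x - y))\<^sup>2) / 4" for x y :: "'c::real_inner"
    by (simp add: power2_norm_eq_inner inner_add_left inner_add_right inner_diff_left inner_diff_right inner_commute)
  have fi: "f x \<bullet> f y = x \<bullet> y" for x y
    unfolding inner by (simp add: linear_add[OF f(1), symmetric] linear_diff[OF f(1), symmetric] f(3))
  have gi: "g x \<bullet> y = x \<bullet> f y" for x y
    using fi[of "g x" y] by (simp add: f)
  define c where "c x y = g (cross3 (f x) (f y))" for x y
  have "cross_product c"
  proof (rule cross_product.intro)
    show "DIM('a) = 3" by (rule assms)
    have "bilinear c"
      unfolding bilinear_def c_def
      by (auto intro!: linearI simp: linear_add[OF f(1)] linear_add[OF f(2)] linear_scale[OF f(1)]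
          linear_scale[OF f(2)] cross_add_left cross_add_right cross_mult_left cross_mult_right)
    then show "bounded_bilinear c" by (simp add: bilinear_conv_bounded_bilinear)
    fix x y z
    show "c x y = - c y x"
      unfolding c_def by (subst cross_skew) (simp add: linear_neg[OF f(2)])
    show "c x y \<bullet> x = 0" by (simp add: c_def gi dot_cross_self inner_commute[of _ "f x"])
    show "c x (c y z) = (x \<bullet> z) *\<^sub>R y - (x \<bullet> y) *\<^sub>R z"
      by (simp add: c_def f Lagrange linear_diff[OF f(2)] linear_scale[OF f(2)] fi)
  qed
  then show thesis by (rule that)
qed

context cross_product begin

sublocale cross: bounded_bilinear cross by (rule bounded_bilinear_cross)

lemma cross_self [simp]: "cross x x = 0"
  using cross_skew[of x x] by (simp add: eq_neg_iff_add_eq_0 flip: scaleR_2)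

lemma cross_perp' [simp]: "cross x y \<bullet> x = 0" "x \<bullet> cross x y = 0" "cross x y \<bullet> y = 0" "y \<bullet> cross x y = 0"
  using cross_perp[of x y] cross_perp[of y x] cross_skew[of x y] by (simp_all add: inner_commute)

definition frame :: "'a \<Rightarrow> 'a \<Rightarrow> 'a \<Rightarrow> bool" where
  "frame x h b \<longleftrightarrow> norm x = 1 \<and> norm h = 1 \<and> x \<bullet> h = 0 \<and> b = cross x h"

lemma frameD:
  assumes "frame x h b"
  shows "norm x = 1" "norm h = 1" "norm b = 1" "x \<bullet> h = 0" "x \<bullet> b = 0" "h \<bullet> b = 0"
    "cross x h = b" "cross h b = x" "cross b x = h"
    "v = (x \<bullet> v) *\<^sub>R x + (h \<bullet> v) *\<^sub>R h + (b \<bullet> v) *\<^sub>R b"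
proof -
  show b: "norm x = 1" "norm h = 1" "x \<bullet> h = 0" "x \<bullet> b = 0" "h \<bullet> b = 0" "cross x h = b"
    using assms by (auto simp: frame_def)
  have xx: "x \<bullet> x = 1" "h \<bullet> h = 1" using b by (simp_all add: dot_square_norm)
  show hb: "cross h b = x" using cross_cross[of h x h] b xx by (simp add: inner_commute)
  have "cross x b = - h" using cross_cross[of x x h] b xx by simp
  then show bx: "cross b x = h" using cross_skew[of b x] by simp
  have "b \<bullet> b = 1"
  proof -
    have "cross b (cross h b) = (b \<bullet> b) *\<^sub>R h" using cross_cross[of b h b] b by (simp add: inner_commute)
    then have "(b \<bullet> b) *\<^sub>R h = h" using hb bx by simp
    then have "((b \<bullet> b) *\<^sub>R h) \<bullet> h = 1" using xx by simp
    then show ?thesis using xx by simp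
  qed
  then show "norm b = 1" by (simp add: norm_eq_sqrt_inner)
  have "v - (b \<bullet> v) *\<^sub>R b = cross b (cross v b)"
    using \<open>b \<bullet> b = 1\<close> by (simp add: cross_cross)
  also have "cross v b = (v \<bullet> h) *\<^sub>R x - (v \<bullet> x) *\<^sub>R h" using cross_cross[of v x h] b by simp
  also have "cross b \<dots> = (v \<bullet> h) *\<^sub>R h + (v \<bullet> x) *\<^sub>R x"
    using bx hb cross_skew[of b h] by (simp add: cross.diff_right cross.scaleR_right)
  finally show "v = (x \<bullet> v) *\<^sub>R x + (h \<bullet> v) *\<^sub>R h + (b \<bullet> v) *\<^sub>R b"
    by (simp add: algebra_simps inner_commute)
qed

lemma frame_exists:
  assumes "norm x = 1"
  obtains h b where "frame x h b" "b \<bullet> a = 0" "a = (x \<bullet> a) *\<^sub>R x + (h \<bullet> a) *\<^sub>R h"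
proof -
  have xx: "x \<bullet> x = 1" using assms by (simp add: dot_square_norm)
  have "\<exists>h. norm h = 1 \<and> x \<bullet> h = 0 \<and> (\<exists>c. a - (x \<bullet> a) *\<^sub>R x = c *\<^sub>R h)"
  proof (cases "a - (x \<bullet> a) *\<^sub>R x = 0")
    case True
    obtain y where "y \<noteq> 0" "orthogonal x y"
      using orthogonal_to_vector_exists[of x] dim3 by auto
    then show ?thesis using True
      by (intro exI[of _ "y /\<^sub>R norm y"]) (auto simp: orthogonal_def intro: exI[of _ 0])
  next
    case False
    then show ?thesis
      by (intro exI[of _ "(a - (x \<bullet> a) *\<^sub>R x) /\<^sub>R norm (a - (x \<bullet> a) *\<^sub>R x)"])
        (auto simp: inner_diff_right xx intro!: exI[of _ "norm (a - (x \<bullet> a) *\<^sub>R x)"])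
  qed
  then obtain h c where h: "norm h = 1" "x \<bullet> h = 0" "a - (x \<bullet> a) *\<^sub>R x = c *\<^sub>R h" by blast
  have "frame x h (cross x h)" using assms h by (simp add: frame_def)
  moreover have a: "a = (x \<bullet> a) *\<^sub>R x + c *\<^sub>R h" using h(3) by (simp add: algebra_simps)
  have "cross x h \<bullet> a = 0" by (subst a) (simp add: inner_add_right)
  moreover have "h \<bullet> a = c" by (subst a) (use h in \<open>simp add: inner_add_right inner_commute dot_square_norm\<close>)
  ultimately show thesis using that a by blast
qed

lemma frame_norm:
  assumes "frame x h b"
  shows "(norm v)\<^sup>2 = (x \<bullet> v)\<^sup>2 + (h \<bullet> v)\<^sup>2 + (b \<bullet> v)\<^sup>2"
proof -
  have "v \<bullet> v = v \<bullet> ((x \<bullet> v) *\<^sub>R x + (h \<bullet> v) *\<^sub>R h + (b \<bullet> v) *\<^sub>R b)"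
    using frameD(10)[OF assms, of v] by (rule arg_cong)
  then show ?thesis unfolding power2_norm_eq_inner
    by (simp add: inner_add_right power2_eq_square inner_commute)
qed

text \<open>Inserting \<open>1 = (a \<bullet> y)\<^sup>2 + (h \<bullet> y)\<^sup>2 + (b \<bullet> y)\<^sup>2\<close> into the moment of order \<open>2 k\<close> and comparing the
mixed moments with the moment of order \<open>2 k + 2\<close> by \<open>planar_moments\<close> gives the recursion
\<open>(2 k + 1) c\<^sub>k = (2 k + 3) c\<^bsub>k + 1\<^esub>\<close>.\<close>

lemma sphere_moment_even_unit:
  fixes a :: 'a
  assumes "norm a = 1"
  shows "(\<integral>y. (a \<bullet> y) ^ (2 * k) \<partial>sphere_haar) = 1 / (2 * real k + 1)"
proof (induction k)
  case 0
  show ?case by simp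
next
  case (Suc k)
  obtain h b where f: "frame a h b" using frame_exists[OF assms] by blast
  note fD = frameD[OF f]
  let ?c = "\<integral>y. (a \<bullet> y) ^ (2 * Suc k) \<partial>sphere_haar"
  have m: "(2 * real k + 1) * (\<integral>y. (a \<bullet> y) ^ (2 * k) * (v \<bullet> y)\<^sup>2 \<partial>sphere_haar) = ?c"
    if v: "norm v = 1" "a \<bullet> v = 0" for v
  proof -
    have "(2 * Suc k choose 2) * (\<integral>y. (a \<bullet> y) ^ (2 * k) * (v \<bullet> y)\<^sup>2 \<partial>sphere_haar) = real (Suc k) * ?c"
      using planar_moments[of 0 a v "Suc k" "\<lambda>_. 1" 1] assms v
        integrable_sphere_haar_continuous[OF continuous_monomial[of a _ v]] by simp
    moreover have "real (2 * Suc k choose 2) = real (Suc k) * (2 * real k + 1)"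
      by (simp add: choose_two algebra_simps)
    ultimately have "real (Suc k) * ((2 * real k + 1) * (\<integral>y. (a \<bullet> y) ^ (2 * k) * (v \<bullet> y)\<^sup>2 \<partial>sphere_haar)) = real (Suc k) * ?c"
      by (simp only: mult.assoc)
    then show ?thesis by (simp del: of_nat_Suc)
  qed
  have "(\<integral>y. (a \<bullet> y) ^ (2 * k) \<partial>sphere_haar) = (\<integral>y. (a \<bullet> y) ^ (2 * Suc k) + (a \<bullet> y) ^ (2 * k) * (h \<bullet> y)\<^sup>2
      + (a \<bullet> y) ^ (2 * k) * (b \<bullet> y)\<^sup>2 \<partial>sphere_haar)"
  proof (rule Bochner_Integration.integral_cong)
    fix y :: 'a assume "y \<in> space sphere_haar"
    then have "(a \<bullet> y)\<^sup>2 + (h \<bullet> y)\<^sup>2 + (b \<bullet> y)\<^sup>2 = 1" using frame_norm[OF f, of y] by simp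
    then have "(a \<bullet> y) ^ (2 * k) = (a \<bullet> y) ^ (2 * k) * ((a \<bullet> y)\<^sup>2 + (h \<bullet> y)\<^sup>2 + (b \<bullet> y)\<^sup>2)" by simp
    then show "(a \<bullet> y) ^ (2 * k) = (a \<bullet> y) ^ (2 * Suc k) + (a \<bullet> y) ^ (2 * k) * (h \<bullet> y)\<^sup>2
      + (a \<bullet> y) ^ (2 * k) * (b \<bullet> y)\<^sup>2" by (simp add: algebra_simps power2_eq_square)
  qed simp
  also have "\<dots> = ?c + (\<integral>y. (a \<bullet> y) ^ (2 * k) * (h \<bullet> y)\<^sup>2 \<partial>sphere_haar)
      + (\<integral>y. (a \<bullet> y) ^ (2 * k) * (b \<bullet> y)\<^sup>2 \<partial>sphere_haar)"
    using integrable_sphere_haar_continuous[OF continuous_monomial[of a "2 * k" h 2]]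
      integrable_sphere_haar_continuous[OF continuous_monomial[of a "2 * k" b 2]]
      integrable_sphere_haar_continuous[OF continuous_monomial[of a "2 * Suc k" b 0]] by simp
  finally have "1 = (2 * real k + 1) * \<dots>" unfolding Suc.IH by (simp add: field_simps)
  also have "\<dots> = (2 * real k + 3) * ?c"
    unfolding distrib_left m[OF fD(2,4)] m[OF fD(3,5)] by (simp add: algebra_simps)
  finally show ?case by (simp add: field_simps)
qed

lemma sphere_moment_mixed:
  assumes "frame x h b" "i \<le> k"
  shows "(2 * k choose (2 * i)) * (\<integral>y. (x \<bullet> y) ^ (2 * k - 2 * i) * (h \<bullet> y) ^ (2 * i) \<partial>sphere_haar)
    = (k choose i) / (2 * real k + 1)"
proof -
  note fD = frameD(1-6)[OF assms(1)]
  have int: "integrable sphere_haar (\<lambda>y. (\<lambda>_. 1) (0 \<bullet> y) * (x \<bullet> y) ^ i * (h \<bullet> y) ^ j)" for i j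
    using integrable_sphere_haar_continuous[OF continuous_monomial[of x i h j]] by simp
  show ?thesis
    using planar_moments[OF inner_zero_left inner_zero_left fD(1,2,4) int assms(2)]
      sphere_moment_even_unit[OF fD(1)] by simp
qed

end

section \<open>Common lines of zonal fields\<close>

context cross_product begin

text \<open>The measure of the two poles is at most every moment \<open>1 / (2 k + 1)\<close>, so it is zero.\<close>

lemma AE_not_polar:
  fixes x :: 'a
  assumes "norm x = 1"
  shows "AE y in sphere_haar. (x \<bullet> y)\<^sup>2 \<noteq> 1"
proof -
  interpret prob_space "sphere_haar :: 'a measure" by (rule prob_space_sphere_haar)
  let ?S = "{y \<in> space sphere_haar. (x \<bullet> y)\<^sup>2 = 1}"
  have S [measurable]: "?S \<in> sets sphere_haar" by measurable
  have le: "prob ?S \<le> inverse (real (Suc k))" for k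
  proof -
    have "prob ?S = (\<integral>y. indicator ?S y \<partial>sphere_haar)"
      using sets.sets_into_space[OF S] by (simp add: Int_absorb2)
    also have "\<dots> \<le> (\<integral>y. (x \<bullet> y) ^ (2 * k) \<partial>sphere_haar)"
    proof (rule integral_mono)
      show "integrable sphere_haar (indicat_real ?S)" by (rule integrable_sphere_haar_bounded[of _ 1]) auto
      show "integrable sphere_haar (\<lambda>y. (x \<bullet> y) ^ (2 * k))"
        by (intro integrable_sphere_haar_continuous continuous_intros)
    qed (auto simp: indicator_def power_mult)
    also have "\<dots> = 1 / (2 * real k + 1)" by (rule sphere_moment_even_unit[OF assms])
    also have "\<dots> \<le> inverse (real (Suc k))" by (simp add: field_simps)
    finally show ?thesis .
  qed
  have "prob ?S \<le> 0"
    using LIMSEQ_le_const[OF LIMSEQ_inverse_real_of_nat] le by blast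
  then have "prob ?S = 0" using measure_nonneg[of sphere_haar ?S] by linarith
  then have "emeasure sphere_haar ?S = 0" by (simp add: emeasure_eq_measure)
  then show ?thesis by (intro AE_I[OF _ _ S]) auto
qed

lemma integrable_weighted:
  assumes f: "frame x h b" and ij: "i + j \<ge> 2"
  shows "integrable sphere_haar (\<lambda>y. (x \<bullet> y) ^ p / (1 - (x \<bullet> y)\<^sup>2) * (h \<bullet> y) ^ i * (b \<bullet> y) ^ j)"
proof (rule integrable_sphere_haar_bounded[of _ 1])
  fix y :: 'a assume "norm y = 1"
  then have eq: "(x \<bullet> y)\<^sup>2 + (h \<bullet> y)\<^sup>2 + (b \<bullet> y)\<^sup>2 = 1" using frame_norm[OF f, of y] by simp
  define \<rho> where "\<rho> = 1 - (x \<bullet> y)\<^sup>2"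
  have \<rho>: "0 \<le> \<rho>" "\<rho> \<le> 1" "(h \<bullet> y)\<^sup>2 \<le> \<rho>" "(b \<bullet> y)\<^sup>2 \<le> \<rho>" 
    using eq zero_le_power2[of "h \<bullet> y"] zero_le_power2[of "b \<bullet> y"] zero_le_power2[of "x \<bullet> y"]
    unfolding \<rho>_def by linarith+
  have "\<bar>x \<bullet> y\<bar> \<le> 1" using \<rho>(1) by (simp add: \<rho>_def abs_square_le_1)
  then have 1: "\<bar>x \<bullet> y\<bar> ^ p \<le> 1" by (simp add: power_le_one)
  have "\<bar>h \<bullet> y\<bar> ^ i * \<bar>b \<bullet> y\<bar> ^ j \<le> sqrt \<rho> ^ i * sqrt \<rho> ^ j"
    using \<rho> by (intro mult_mono power_mono) (auto intro: real_le_rsqrt)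
  also have "\<dots> = sqrt \<rho> ^ (i + j)" by (simp add: power_add)
  also have "\<dots> \<le> sqrt \<rho> ^ 2" using \<rho> ij by (intro power_decreasing) auto
  finally have 2: "\<bar>h \<bullet> y\<bar> ^ i * \<bar>b \<bullet> y\<bar> ^ j \<le> \<rho>" using \<rho> by simp
  have "\<bar>x \<bullet> y\<bar> ^ p * (\<bar>h \<bullet> y\<bar> ^ i * \<bar>b \<bullet> y\<bar> ^ j) \<le> 1 * \<rho>"
    using 1 2 by (intro mult_mono) auto
  then have "\<bar>x \<bullet> y\<bar> ^ p * (\<bar>h \<bullet> y\<bar> ^ i * \<bar>b \<bullet> y\<bar> ^ j) / \<rho> \<le> 1"
    using \<rho> by (cases "\<rho> = 0") (auto simp: divide_le_eq)
  then show "norm ((x \<bullet> y) ^ p / (1 - (x \<bullet> y)\<^sup>2) * (h \<bullet> y) ^ i * (b \<bullet> y) ^ j) \<le> 1"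
    using \<rho>(1) by (simp add: abs_mult power_abs \<rho>_def[symmetric])
qed measurable

text \<open>The reason that the singular kernel can be integrated in closed form. By \<open>planar_moments\<close> for the weight
\<open>q t = t\<^sup>p / (1 - t\<^sup>2)\<close>, replacing \<open>(b \<bullet> y)\<^sup>2\<close> by \<open>(h \<bullet> y)\<^sup>2\<close> multiplies the left hand side by
\<open>2 i + 1\<close>. The sum of the two integrands has no denominator left, because
\<open>(h \<bullet> y)\<^sup>2 + (b \<bullet> y)\<^sup>2 = 1 - (x \<bullet> y)\<^sup>2\<close>.\<close>

lemma weighted_moment:
  assumes f: "frame x h b"
  shows "(\<integral>y. (x \<bullet> y) ^ p / (1 - (x \<bullet> y)\<^sup>2) * (h \<bullet> y) ^ (2 * i) * (b \<bullet> y)\<^sup>2 \<partial>sphere_haar)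
    = (\<integral>y. (x \<bullet> y) ^ p * (h \<bullet> y) ^ (2 * i) \<partial>sphere_haar) / (2 * real i + 2)" (is "?A = ?B / _")
proof -
  note fD = frameD(1-6)[OF f]
  let ?C = "\<integral>y. (x \<bullet> y) ^ p / (1 - (x \<bullet> y)\<^sup>2) * (h \<bullet> y) ^ (2 * Suc i) \<partial>sphere_haar"
  have "(2 * Suc i choose 2) * ?A = real (Suc i) * ?C"
    using planar_moments[of x h b "Suc i" "\<lambda>t. t ^ p / (1 - t\<^sup>2)" 1] fD integrable_weighted[OF f]
    by simp
  moreover have "real (2 * Suc i choose 2) = real (Suc i) * (2 * real i + 1)"
    by (simp add: choose_two algebra_simps)
  ultimately have "real (Suc i) * ((2 * real i + 1) * ?A) = real (Suc i) * ?C"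
    by (simp only: mult.assoc)
  then have C: "(2 * real i + 1) * ?A = ?C" by (simp del: of_nat_Suc)
  have "?C + ?A = (\<integral>y. (x \<bullet> y) ^ p / (1 - (x \<bullet> y)\<^sup>2) * (h \<bullet> y) ^ (2 * Suc i) +
      (x \<bullet> y) ^ p / (1 - (x \<bullet> y)\<^sup>2) * (h \<bullet> y) ^ (2 * i) * (b \<bullet> y)\<^sup>2 \<partial>sphere_haar)"
    using integrable_weighted[OF f, of "2 * Suc i" 0 p] integrable_weighted[OF f, of "2 * i" 2 p] by simp
  also have "\<dots> = ?B"
  proof (rule integral_cong_AE)
    show "AE y in sphere_haar. (x \<bullet> y) ^ p / (1 - (x \<bullet> y)\<^sup>2) * (h \<bullet> y) ^ (2 * Suc i) +
      (x \<bullet> y) ^ p / (1 - (x \<bullet> y)\<^sup>2) * (h \<bullet> y) ^ (2 * i) * (b \<bullet> y)\<^sup>2 = (x \<bullet> y) ^ p * (h \<bullet> y) ^ (2 * i)"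
      using AE_not_polar[OF fD(1)] AE_space
    proof eventually_elim
      fix y assume y: "(x \<bullet> y)\<^sup>2 \<noteq> 1" "y \<in> space sphere_haar"
      have e: "(h \<bullet> y)\<^sup>2 + (b \<bullet> y)\<^sup>2 = 1 - (x \<bullet> y)\<^sup>2" using frame_norm[OF f, of y] y by simp
      have "(x \<bullet> y) ^ p / (1 - (x \<bullet> y)\<^sup>2) * (h \<bullet> y) ^ (2 * Suc i) +
        (x \<bullet> y) ^ p / (1 - (x \<bullet> y)\<^sup>2) * (h \<bullet> y) ^ (2 * i) * (b \<bullet> y)\<^sup>2
        = (x \<bullet> y) ^ p * (h \<bullet> y) ^ (2 * i) * (((h \<bullet> y)\<^sup>2 + (b \<bullet> y)\<^sup>2) / (1 - (x \<bullet> y)\<^sup>2))"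
        by (simp add: add_divide_distrib algebra_simps power2_eq_square)
      then show "(x \<bullet> y) ^ p / (1 - (x \<bullet> y)\<^sup>2) * (h \<bullet> y) ^ (2 * Suc i) +
        (x \<bullet> y) ^ p / (1 - (x \<bullet> y)\<^sup>2) * (h \<bullet> y) ^ (2 * i) * (b \<bullet> y)\<^sup>2 = (x \<bullet> y) ^ p * (h \<bullet> y) ^ (2 * i)"
        unfolding e using y by simp
    qed
  qed measurable
  finally show ?thesis using C by (simp add: field_simps)
qed

text \<open>The even and the odd case are treated together: \<open>m mod 2\<close> is the power of \<open>x \<bullet> y\<close> that the kernel
contributes in addition. Up to the denominator, which does not depend on \<open>i\<close>, the result is the coefficient
in \<open>geometric_binomial_sum\<close>.\<close>

lemma weighted_coefficient:
  assumes f: "frame x h b" and i: "i \<le> m div 2"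
  shows "(m choose (2 * i)) *
      (\<integral>y. (x \<bullet> y) ^ (m mod 2 + m - 2 * i) / (1 - (x \<bullet> y)\<^sup>2) * (h \<bullet> y) ^ (2 * i) * (b \<bullet> y)\<^sup>2 \<partial>sphere_haar)
    = (Suc (m div 2) choose Suc i) / ((real m + 1) * (real m + 2))" (is "_ * ?I = _")
proof -
  let ?J = "\<integral>y. (x \<bullet> y) ^ (m mod 2 + m - 2 * i) * (h \<bullet> y) ^ (2 * i) \<partial>sphere_haar"
  have I: "?I = ?J / (2 * (real i + 1))" unfolding weighted_moment[OF f] by (simp add: distrib_left)
  have J: "(m choose (2 * i)) * ?J = (m div 2 choose i) / (real (m mod 2) + real m + 1)"
  proof (cases "even m")
    case True
    then obtain K where K: "m = 2 * K" by (elim evenE)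
    then show ?thesis using sphere_moment_mixed[OF f, of i K] i by simp
  next
    case False
    then obtain K where K: "m = 2 * K + 1" by (elim oddE)
    let ?P = "real (2 * K + 2 choose (2 * i))" and ?Q = "real (Suc K choose i)"
    have 1: "?P * ?J = ?Q / (2 * real K + 3)"
      using sphere_moment_mixed[OF f, of i "Suc K"] i K by simp
    have r: "real (2 * K + 2 - 2 * i) = 2 * (real K + 1 - real i)" "real (Suc K - i) = real K + 1 - real i"
      "real (2 * K + 2) = 2 * (real K + 1)"
      using i K by (simp_all add: of_nat_diff)
    have "(2 * K + 2 - 2 * i) * (2 * K + 2 choose (2 * i)) = (2 * K + 2) * (2 * K + 1 choose (2 * i))"
      using binomial_absorb_comp[of "2 * K + 2" "2 * i"] by simp
    from arg_cong[OF this, of real]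
    have "2 * ((real K + 1 - real i) * ?P) = 2 * ((real K + 1) * real (m choose (2 * i)))"
      by (simp only: of_nat_mult r K mult.assoc)
    then have 2: "(real K + 1 - real i) * ?P = (real K + 1) * real (m choose (2 * i))" by simp
    have "(Suc K - i) * (Suc K choose i) = Suc K * (K choose i)"
      using binomial_absorb_comp[of "Suc K" i] by simp
    from arg_cong[OF this, of real]
    have 3: "(real K + 1 - real i) * ?Q = (real K + 1) * real (K choose i)"
      unfolding of_nat_mult r by (simp add: add.commute)
    have "(real K + 1) * (real (m choose (2 * i)) * ?J) = (real K + 1 - real i) * (?P * ?J)"
      unfolding mult.assoc[symmetric] 2 ..
    also have "\<dots> = (real K + 1) * (real (K choose i) / (2 * real K + 3))"
      unfolding 1 by (simp add: 3)
    finally have "real (m choose (2 * i)) * ?J = real (K choose i) / (2 * real K + 3)"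
      by (subst (asm) mult_cancel_left) linarith
    then show ?thesis using K by simp
  qed
  have "Suc i * (Suc (m div 2) choose Suc i) = Suc (m div 2) * (m div 2 choose i)"
    by (rule Suc_times_binomial)
  from arg_cong[OF this, of real]
  have S: "(real i + 1) * real (Suc (m div 2) choose Suc i) = (real (m div 2) + 1) * real (m div 2 choose i)"
    by (simp add: algebra_simps)
  have den: "(real (m div 2) + 1) * (2 * (real (m mod 2) + real m + 1)) = (real m + 1) * (real m + 2)"
    by (cases "even m") (auto elim!: evenE oddE simp: mod2_eq_if algebra_simps)
  have cancel: "p * s / q / (2 * p * r) = s / (q * (2 * r))" if "p \<noteq> 0" for p q r s :: real
    using that by (cases "q = 0"; cases "r = 0") (simp_all add: field_simps)
  have "real (m choose (2 * i)) * ?I = real (m div 2 choose i) / (2 * (real i + 1) * (real (m mod 2) + real m + 1))"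
  proof -
    have "real (m choose (2 * i)) * ?I = (real (m choose (2 * i)) * ?J) / (2 * (real i + 1))" unfolding I by simp
    then show ?thesis unfolding J by (simp add: mult.commute)
  qed
  also have "real (m div 2 choose i) = (real i + 1) * real (Suc (m div 2) choose Suc i) / (real (m div 2) + 1)"
    unfolding S by simp
  also have "\<dots> / (2 * (real i + 1) * (real (m mod 2) + real m + 1))
      = real (Suc (m div 2) choose Suc i) / ((real (m div 2) + 1) * (2 * (real (m mod 2) + real m + 1)))"
    by (rule cancel) linarith
  finally show ?thesis unfolding den .
qed

text \<open>Expand the power by the binomial theorem. Terms with an odd power of \<open>h \<bullet> y\<close> vanish by reflection, and
the coefficients of the others combine to a geometric sum in \<open>\<alpha>\<^sup>2 + \<beta>\<^sup>2\<close> and \<open>\<alpha>\<^sup>2\<close>.\<close>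

lemma kernel_moment:
  assumes f: "frame x h b"
  shows "(\<integral>y. (x \<bullet> y) ^ (m mod 2) / (1 - (x \<bullet> y)\<^sup>2) * (\<alpha> * (x \<bullet> y) + \<beta> * (h \<bullet> y)) ^ m * (b \<bullet> y)\<^sup>2 \<partial>sphere_haar)
    = \<alpha> ^ (m mod 2) * (\<Sum>j\<le>m div 2. (\<alpha>\<^sup>2 + \<beta>\<^sup>2) ^ j * \<alpha> ^ (2 * (m div 2 - j))) / ((real m + 1) * (real m + 2))"
proof -
  define g where "g j y = (x \<bullet> y) ^ (m mod 2 + m - j) / (1 - (x \<bullet> y)\<^sup>2) * (h \<bullet> y) ^ j * (b \<bullet> y)\<^sup>2" for j y
  have g_int: "integrable sphere_haar (g j)" for j
    unfolding g_def by (rule integrable_weighted[OF f]) simp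
  have odd: "(\<integral>y. g j y \<partial>sphere_haar) = 0" if "odd j" for j
  proof (rule integral_sphere_haar_odd[OF orthogonal_transformation_reflection borel_measurable_integrable[OF g_int]])
    show "g j (reflection h y) = - g j y" for y
      using that frameD(1-6)[OF f]
      by (simp add: g_def inner_reflection_self inner_reflection_orthogonal inner_commute[of b h])
  qed
  have "(x \<bullet> y) ^ (m mod 2) / (1 - (x \<bullet> y)\<^sup>2) * (\<alpha> * (x \<bullet> y) + \<beta> * (h \<bullet> y)) ^ m * (b \<bullet> y)\<^sup>2
      = (\<Sum>j\<le>m. ((m choose j) * \<alpha> ^ (m - j) * \<beta> ^ j) * g j y)" for y
  proof -
    have e: "(x \<bullet> y) ^ (m mod 2 + m - j) = (x \<bullet> y) ^ (m mod 2) * (x \<bullet> y) ^ (m - j)" if "j \<le> m" for j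
      using that by (simp add: power_add[symmetric])
    have "(\<alpha> * (x \<bullet> y) + \<beta> * (h \<bullet> y)) ^ m = (\<Sum>j\<le>m. (m choose j) * (\<beta> * (h \<bullet> y)) ^ j * (\<alpha> * (x \<bullet> y)) ^ (m - j))"
      unfolding add.commute[of "\<alpha> * _"] binomial_ring ..
    then show ?thesis
      by (simp only: sum_distrib_left sum_distrib_right g_def)
        (intro sum.cong refl, simp add: e power_mult_distrib)
  qed
  then have "(\<integral>y. (x \<bullet> y) ^ (m mod 2) / (1 - (x \<bullet> y)\<^sup>2) * (\<alpha> * (x \<bullet> y) + \<beta> * (h \<bullet> y)) ^ m * (b \<bullet> y)\<^sup>2 \<partial>sphere_haar)
      = (\<Sum>j\<le>m. ((m choose j) * \<alpha> ^ (m - j) * \<beta> ^ j) * (\<integral>y. g j y \<partial>sphere_haar))"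
    by (simp add: g_int)
  also have "\<dots> = (\<Sum>j\<in>(*) 2 ` {..m div 2}. ((m choose j) * \<alpha> ^ (m - j) * \<beta> ^ j) * (\<integral>y. g j y \<partial>sphere_haar))"
    by (rule sum.mono_neutral_right) (auto elim!: evenE simp: image_iff intro: odd)
  also have "\<dots> = (\<Sum>i\<le>m div 2. \<alpha> ^ (m - 2 * i) * \<beta> ^ (2 * i) * ((m choose (2 * i)) * (\<integral>y. g (2 * i) y \<partial>sphere_haar)))"
    by (subst sum.reindex) (auto simp: inj_on_def ac_simps)
  also have "\<dots> = (\<Sum>i\<le>m div 2. \<alpha> ^ (m - 2 * i) * \<beta> ^ (2 * i) * ((Suc (m div 2) choose Suc i) / ((real m + 1) * (real m + 2))))"
    unfolding g_def by (intro sum.cong refl, subst weighted_coefficient[OF f]) auto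
  also have "\<dots> = (\<Sum>i\<le>m div 2. \<alpha> ^ (m mod 2) * ((Suc (m div 2) choose Suc i) * (\<alpha>\<^sup>2) ^ (m div 2 - i) * (\<beta>\<^sup>2) ^ i) / ((real m + 1) * (real m + 2)))"
  proof (intro sum.cong refl)
    fix i assume "i \<in> {..m div 2}"
    then have "m - 2 * i = m mod 2 + 2 * (m div 2 - i)" unfolding atMost_iff by presburger
    then show "\<alpha> ^ (m - 2 * i) * \<beta> ^ (2 * i) * ((Suc (m div 2) choose Suc i) / ((real m + 1) * (real m + 2)))
        = \<alpha> ^ (m mod 2) * ((Suc (m div 2) choose Suc i) * (\<alpha>\<^sup>2) ^ (m div 2 - i) * (\<beta>\<^sup>2) ^ i) / ((real m + 1) * (real m + 2))"
      by (simp add: power_add power_mult)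
  qed
  also have "\<dots> = \<alpha> ^ (m mod 2) * (\<Sum>i\<le>m div 2. (Suc (m div 2) choose Suc i) * (\<alpha>\<^sup>2) ^ (m div 2 - i) * (\<beta>\<^sup>2) ^ i) / ((real m + 1) * (real m + 2))"
    by (simp only: sum_distrib_left sum_divide_distrib)
  finally show ?thesis unfolding geometric_binomial_sum by (simp add: power_mult)
qed

end

lemma inner_common_lines_kernel:
  assumes "norm x = 1" "norm y = 1" "v \<bullet> y = 0" "c \<bullet> x = 0"
  shows "common_lines_kernel x y v \<bullet> c = v \<bullet> c + (v \<bullet> x) * (x \<bullet> y) * (c \<bullet> y) / (1 - (x \<bullet> y)\<^sup>2)"
proof -
  have v: "v \<in> tangent_plane y" using assms(3) by (simp add: tangent_plane_def)
  have c: "x \<bullet> c = 0" "y \<bullet> c = c \<bullet> y" using assms(4) by (simp_all add: inner_commute)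
  show ?thesis
    unfolding common_lines_kernel_eq(2)[OF assms(1,2) v] by (simp add: inner_diff_left c)
qed

lemma l2_section_continuous:
  fixes s :: "'a::euclidean_space \<Rightarrow> 'a"
  assumes "section_of_bundle s" "continuous_on UNIV s"
  shows "l2_section s"
  unfolding l2_section_def
proof (intro conjI)
  show "integrable sphere_haar (\<lambda>x. (norm (s x))\<^sup>2)"
    by (intro integrable_sphere_haar_continuous continuous_intros assms(2))
qed (intro assms measurable_sphere_haar_continuous)+

lemma inner_common_lines_integral:
  assumes s: "l2_section s" and x: "norm x = 1" and c: "c \<bullet> x = 0"
  shows "common_lines_integral s x \<bullet> c
    = (\<integral>y. s y \<bullet> c + (s y \<bullet> x) * (x \<bullet> y) * (c \<bullet> y) / (1 - (x \<bullet> y)\<^sup>2) \<partial>sphere_haar)"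
proof -
  have "common_lines_integral s x \<bullet> c = (\<integral>y. common_lines_kernel x y (s y) \<bullet> c \<partial>sphere_haar)"
    unfolding common_lines_integral_def
    by (rule integral_inner_left[symmetric]) (rule common_lines_integrable[OF s x])
  also have "\<dots> = (\<integral>y. s y \<bullet> c + (s y \<bullet> x) * (x \<bullet> y) * (c \<bullet> y) / (1 - (x \<bullet> y)\<^sup>2) \<partial>sphere_haar)"
    using section_of_bundleD[OF l2_sectionD(1)[OF s]] x c
    by (intro Bochner_Integration.integral_cong refl) (simp add: inner_common_lines_kernel)
  finally show ?thesis .
qed

context cross_product begin

text \<open>Up to the factor \<open>m + 1\<close>, the spherical gradient of \<open>(a \<bullet> y)\<^bsup>m + 1\<^esup>\<close>, turned by a right angle for odd
\<open>m\<close>. The turn makes the field invariant under \<open>y \<mapsto> - y\<close> in both cases; the fields of the other kind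
lie in the kernel of the operator.\<close>

definition zonal :: "nat \<Rightarrow> 'a \<Rightarrow> 'a \<Rightarrow> 'a" where
  "zonal m a y = (a \<bullet> y) ^ m *\<^sub>R (if even m then a - (a \<bullet> y) *\<^sub>R y else cross y a)"

lemma continuous_on_cross [continuous_intros]:
  "continuous_on S f \<Longrightarrow> continuous_on S g \<Longrightarrow> continuous_on S (\<lambda>y. cross (f y) (g y))"
  by (rule cross.continuous_on)

lemma continuous_on_zonal: "continuous_on UNIV (zonal m a)"
proof (cases "even m")
  case True
  then show ?thesis unfolding zonal_def[abs_def] if_P[OF True] by (intro continuous_intros)
next
  case False
  then show ?thesis unfolding zonal_def[abs_def] if_not_P[OF False] by (intro continuous_intros)
qed

lemma section_of_bundle_zonal: "section_of_bundle (zonal m a)"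
  by (rule section_of_bundleI) (simp add: zonal_def inner_diff_left dot_square_norm)

lemma l2_section_zonal: "l2_section (zonal m a)"
  by (intro l2_section_continuous section_of_bundle_zonal continuous_on_zonal)

lemma cross_frame:
  assumes f: "frame x h b"
  shows "cross y (\<alpha> *\<^sub>R x + \<beta> *\<^sub>R h)
    = (- (b \<bullet> y) * \<beta>) *\<^sub>R x + ((b \<bullet> y) * \<alpha>) *\<^sub>R h + ((x \<bullet> y) * \<beta> - (h \<bullet> y) * \<alpha>) *\<^sub>R b"
proof -
  have c: "cross x h = b" "cross h x = - b" "cross b x = h" "cross b h = - x"
    using frameD(7-9)[OF f] cross_skew[of h x] cross_skew[of b h] by auto
  have "cross y (\<alpha> *\<^sub>R x + \<beta> *\<^sub>R h)
      = cross ((x \<bullet> y) *\<^sub>R x + (h \<bullet> y) *\<^sub>R h + (b \<bullet> y) *\<^sub>R b) (\<alpha> *\<^sub>R x + \<beta> *\<^sub>R h)"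
    using frameD(10)[OF f, of y] by (rule arg_cong)
  then show ?thesis
    by (simp add: cross.add_left cross.add_right cross.scaleR_left cross.scaleR_right c algebra_simps)
qed

text \<open>Take \<open>a = \<alpha> x + \<beta> h\<close>. One of the two tangential components of the integral vanishes by the reflection
\<open>b \<mapsto> - b\<close>. In the other one, the kernel reduces the integrand to
\<open>\<beta> (a \<bullet> y)\<^sup>m (b \<bullet> y)\<^sup>2 / (1 - (x \<bullet> y)\<^sup>2)\<close> for even \<open>m\<close>; for odd \<open>m\<close> the sign changes and a factor
\<open>x \<bullet> y\<close> appears, besides a term that integrates to zero. So \<open>kernel_moment\<close> applies in both cases.\<close>

lemma common_lines_integral_zonal:
  assumes x: "norm x = 1"
  shows "common_lines_integral (zonal m a) x
    = ((-1) ^ m / ((real m + 1) * (real m + 2))) *\<^sub>R (\<Sum>j\<le>m div 2. norm a ^ (2 * j) *\<^sub>R zonal (m - 2 * j) a x)"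
proof -
  obtain h b where f: "frame x h b" and ba: "b \<bullet> a = 0" and a: "a = (x \<bullet> a) *\<^sub>R x + (h \<bullet> a) *\<^sub>R h"
    by (rule frame_exists[OF x])
  define \<alpha> \<beta> where "\<alpha> = x \<bullet> a" and "\<beta> = h \<bullet> a"
  note a = a[folded \<alpha>_def \<beta>_def]
  note fD = frameD(1-6)[OF f]
  have fD': "x \<bullet> h = 0" "x \<bullet> b = 0" "h \<bullet> b = 0" "h \<bullet> x = 0" "b \<bullet> x = 0" "b \<bullet> h = 0"
    using fD by (simp_all add: inner_commute)
  have unit: "x \<bullet> x = 1" "h \<bullet> h = 1" "b \<bullet> b = 1" using fD by (simp_all add: dot_square_norm)
  have D: "a \<bullet> y = \<alpha> * (x \<bullet> y) + \<beta> * (h \<bullet> y)" for y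
    by (subst a) (simp add: inner_add_left)
  have ip: "a \<bullet> x = \<alpha>" "a \<bullet> h = \<beta>" "a \<bullet> b = 0"
    using ba by (simp_all add: \<alpha>_def \<beta>_def inner_commute)
  have na: "norm a ^ (2 * j) = (\<alpha>\<^sup>2 + \<beta>\<^sup>2) ^ j" for j
    using frame_norm[OF f, of a] ba by (simp add: power_mult \<alpha>_def \<beta>_def)
  define K where "K = (\<Sum>j\<le>m div 2. (\<alpha>\<^sup>2 + \<beta>\<^sup>2) ^ j * \<alpha> ^ (2 * (m div 2 - j))) / ((real m + 1) * (real m + 2))"
  have km: "(\<integral>y. (x \<bullet> y) ^ (m mod 2) / (1 - (x \<bullet> y)\<^sup>2) * (\<alpha> * (x \<bullet> y) + \<beta> * (h \<bullet> y)) ^ m * (b \<bullet> y)\<^sup>2 \<partial>sphere_haar)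
      = \<alpha> ^ (m mod 2) * K"
    unfolding kernel_moment[OF f] K_def by simp
  let ?C = "common_lines_integral (zonal m a) x"
  have Cx: "x \<bullet> ?C = 0"
    using section_of_bundleD[OF l2_sectionD(1)[OF l2_section_common_lines_integral[OF l2_section_zonal]] x]
    by (simp add: inner_commute)
  have C: "?C = (h \<bullet> ?C) *\<^sub>R h + (b \<bullet> ?C) *\<^sub>R b"
    by (subst frameD(10)[OF f, of ?C], subst Cx) simp
  have Ch: "h \<bullet> ?C = (\<integral>y. zonal m a y \<bullet> h + (zonal m a y \<bullet> x) * (x \<bullet> y) * (h \<bullet> y) / (1 - (x \<bullet> y)\<^sup>2) \<partial>sphere_haar)"
    using inner_common_lines_integral[OF l2_section_zonal x, of h] fD by (simp add: inner_commute)
  have Cb: "b \<bullet> ?C = (\<integral>y. zonal m a y \<bullet> b + (zonal m a y \<bullet> x) * (x \<bullet> y) * (b \<bullet> y) / (1 - (x \<bullet> y)\<^sup>2) \<partial>sphere_haar)"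
    using inner_common_lines_integral[OF l2_section_zonal x, of b] fD by (simp add: inner_commute)
  have refl_b: "v \<bullet> reflection b y = v \<bullet> y" if "v \<bullet> b = 0" for v y
    by (rule inner_reflection_orthogonal[OF that])
  show ?thesis
  proof (cases "even m")
    case True
    have z: "zonal m a y \<bullet> x = (a \<bullet> y) ^ m * (\<alpha> - (a \<bullet> y) * (x \<bullet> y))"
        "zonal m a y \<bullet> h = (a \<bullet> y) ^ m * (\<beta> - (a \<bullet> y) * (h \<bullet> y))"
        "zonal m a y \<bullet> b = - ((a \<bullet> y) ^ m * (a \<bullet> y) * (b \<bullet> y))" for y
      using True by (simp_all add: zonal_def inner_diff_left ip inner_commute[of y])
    have "b \<bullet> ?C = 0"
      unfolding Cb z
    proof (rule integral_sphere_haar_odd[OF orthogonal_transformation_reflection[of b]])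
      show "(\<lambda>y. - ((a \<bullet> y) ^ m * (a \<bullet> y) * (b \<bullet> y)) + (a \<bullet> y) ^ m * (\<alpha> - (a \<bullet> y) * (x \<bullet> y)) * (x \<bullet> y) * (b \<bullet> y) / (1 - (x \<bullet> y)\<^sup>2))
          \<in> borel_measurable sphere_haar" by measurable
    qed (simp add: refl_b inner_reflection_self fD' ip)
    moreover have "h \<bullet> ?C = (\<integral>y. \<beta> * ((x \<bullet> y) ^ (m mod 2) / (1 - (x \<bullet> y)\<^sup>2) * (\<alpha> * (x \<bullet> y) + \<beta> * (h \<bullet> y)) ^ m * (b \<bullet> y)\<^sup>2) \<partial>sphere_haar)"
      unfolding Ch z
    proof (rule integral_cong_AE)
      show "AE y in sphere_haar. (a \<bullet> y) ^ m * (\<beta> - (a \<bullet> y) * (h \<bullet> y)) + (a \<bullet> y) ^ m * (\<alpha> - (a \<bullet> y) * (x \<bullet> y)) * (x \<bullet> y) * (h \<bullet> y) / (1 - (x \<bullet> y)\<^sup>2)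
        = \<beta> * ((x \<bullet> y) ^ (m mod 2) / (1 - (x \<bullet> y)\<^sup>2) * (\<alpha> * (x \<bullet> y) + \<beta> * (h \<bullet> y)) ^ m * (b \<bullet> y)\<^sup>2)"
        using AE_not_polar[OF x] AE_space
      proof eventually_elim
        fix y assume y: "(x \<bullet> y)\<^sup>2 \<noteq> 1" "y \<in> space sphere_haar"
        have e: "(b \<bullet> y)\<^sup>2 = 1 - (x \<bullet> y)\<^sup>2 - (h \<bullet> y)\<^sup>2" using frame_norm[OF f, of y] y by simp
        have "(\<beta> - (a \<bullet> y) * (h \<bullet> y)) * (1 - (x \<bullet> y)\<^sup>2) + (\<alpha> - (a \<bullet> y) * (x \<bullet> y)) * (x \<bullet> y) * (h \<bullet> y) = \<beta> * (b \<bullet> y)\<^sup>2"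
          unfolding e D by (simp add: algebra_simps power2_eq_square)
        then have "(\<beta> - (a \<bullet> y) * (h \<bullet> y)) + (\<alpha> - (a \<bullet> y) * (x \<bullet> y)) * (x \<bullet> y) * (h \<bullet> y) / (1 - (x \<bullet> y)\<^sup>2) = \<beta> * (b \<bullet> y)\<^sup>2 / (1 - (x \<bullet> y)\<^sup>2)"
          using y(1) by (simp add: field_simps)
        then have "(a \<bullet> y) ^ m * ((\<beta> - (a \<bullet> y) * (h \<bullet> y)) + (\<alpha> - (a \<bullet> y) * (x \<bullet> y)) * (x \<bullet> y) * (h \<bullet> y) / (1 - (x \<bullet> y)\<^sup>2)) = (a \<bullet> y) ^ m * (\<beta> * (b \<bullet> y)\<^sup>2 / (1 - (x \<bullet> y)\<^sup>2))"
          by simp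
        then show "(a \<bullet> y) ^ m * (\<beta> - (a \<bullet> y) * (h \<bullet> y)) + (a \<bullet> y) ^ m * (\<alpha> - (a \<bullet> y) * (x \<bullet> y)) * (x \<bullet> y) * (h \<bullet> y) / (1 - (x \<bullet> y)\<^sup>2)
          = \<beta> * ((x \<bullet> y) ^ (m mod 2) / (1 - (x \<bullet> y)\<^sup>2) * (\<alpha> * (x \<bullet> y) + \<beta> * (h \<bullet> y)) ^ m * (b \<bullet> y)\<^sup>2)"
          using True unfolding D[symmetric] by (simp add: distrib_left mult.assoc mult.left_commute[of \<beta>])
      qed
    qed measurable
    then have "h \<bullet> ?C = \<beta> * (\<alpha> ^ (m mod 2) * K)"
      by (simp only: integral_mult_right_zero km)
    then have "h \<bullet> ?C = \<beta> * K" using True by simp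
    ultimately have "?C = (\<beta> * K) *\<^sub>R h" by (subst C) simp
    also have "\<dots> = (1 / ((real m + 1) * (real m + 2))) *\<^sub>R (\<Sum>j\<le>m div 2. ((\<alpha>\<^sup>2 + \<beta>\<^sup>2) ^ j * \<alpha> ^ (2 * (m div 2 - j)) * \<beta>) *\<^sub>R h)"
      by (simp add: K_def scaleR_sum_left[symmetric] sum_distrib_left sum_divide_distrib ac_simps)
    also have "(\<Sum>j\<le>m div 2. ((\<alpha>\<^sup>2 + \<beta>\<^sup>2) ^ j * \<alpha> ^ (2 * (m div 2 - j)) * \<beta>) *\<^sub>R h)
        = (\<Sum>j\<le>m div 2. norm a ^ (2 * j) *\<^sub>R zonal (m - 2 * j) a x)"
    proof (rule sum.cong[OF refl])
      fix j assume "j \<in> {..m div 2}"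
      have e: "2 * (m div 2 - j) = m - 2 * j" using True by (auto elim!: evenE)
      have ax: "a \<bullet> x = \<alpha>" by (simp add: \<alpha>_def inner_commute)
      have "a - \<alpha> *\<^sub>R x = \<beta> *\<^sub>R h" by (subst a) simp
      then show "((\<alpha>\<^sup>2 + \<beta>\<^sup>2) ^ j * \<alpha> ^ (2 * (m div 2 - j)) * \<beta>) *\<^sub>R h = norm a ^ (2 * j) *\<^sub>R zonal (m - 2 * j) a x"
        unfolding na e using True by (simp add: zonal_def ax)
    qed
    finally show ?thesis using True by simp
  next
    case False
    have cy: "cross y a = (- (b \<bullet> y) * \<beta>) *\<^sub>R x + ((b \<bullet> y) * \<alpha>) *\<^sub>R h + ((x \<bullet> y) * \<beta> - (h \<bullet> y) * \<alpha>) *\<^sub>R b" for y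
      by (subst a) (rule cross_frame[OF f])
    have z: "zonal m a y \<bullet> x = - ((a \<bullet> y) ^ m * (b \<bullet> y) * \<beta>)"
        "zonal m a y \<bullet> h = (a \<bullet> y) ^ m * (b \<bullet> y) * \<alpha>"
        "zonal m a y \<bullet> b = (a \<bullet> y) ^ m * ((x \<bullet> y) * \<beta> - (h \<bullet> y) * \<alpha>)" for y
      using False fD' unit by (simp_all add: zonal_def cy inner_add_left inner_diff_left algebra_simps)
    have "h \<bullet> ?C = 0"
      unfolding Ch z
    proof (rule integral_sphere_haar_odd[OF orthogonal_transformation_reflection[of b]])
      show "(\<lambda>y. (a \<bullet> y) ^ m * (b \<bullet> y) * \<alpha> + - ((a \<bullet> y) ^ m * (b \<bullet> y) * \<beta>) * (x \<bullet> y) * (h \<bullet> y) / (1 - (x \<bullet> y)\<^sup>2))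
          \<in> borel_measurable sphere_haar" by measurable
    qed (simp add: refl_b inner_reflection_self fD' ip)
    moreover have "b \<bullet> ?C = - (\<beta> * (\<alpha> * K))"
    proof -
      \<comment> \<open>The vector \<open>u\<close> is orthogonal to \<open>a\<close>, so the reflection along \<open>u\<close> kills the first term.\<close>
      define u where "u = \<beta> *\<^sub>R x - \<alpha> *\<^sub>R h"
      have u: "(x \<bullet> y) * \<beta> - (h \<bullet> y) * \<alpha> = u \<bullet> y" for y by (simp add: u_def inner_diff_left mult.commute)
      have ua: "a \<bullet> u = 0" unfolding u_def D using fD' unit by (simp add: inner_diff_right)
      have i1: "integrable sphere_haar (\<lambda>y. (a \<bullet> y) ^ m * (u \<bullet> y))"
        by (intro integrable_sphere_haar_continuous continuous_intros)
      let ?g = "\<lambda>y. (x \<bullet> y) ^ (m mod 2) / (1 - (x \<bullet> y)\<^sup>2) * (\<alpha> * (x \<bullet> y) + \<beta> * (h \<bullet> y)) ^ m * (b \<bullet> y)\<^sup>2"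
      have i2: "integrable sphere_haar ?g"
      proof (rule Bochner_Integration.integrable_bound)
        show "integrable sphere_haar (\<lambda>y. norm a ^ m * ((x \<bullet> y) ^ 0 / (1 - (x \<bullet> y)\<^sup>2) * (h \<bullet> y) ^ 0 * (b \<bullet> y) ^ 2))"
          by (intro integrable_mult_right integrable_weighted[OF f]) simp
        show "AE y in sphere_haar. norm (?g y) \<le> norm (norm a ^ m * ((x \<bullet> y) ^ 0 / (1 - (x \<bullet> y)\<^sup>2) * (h \<bullet> y) ^ 0 * (b \<bullet> y) ^ 2))"
        proof (rule AE_I2)
          fix y :: 'a assume "y \<in> space sphere_haar"
          then have y: "norm y = 1" by simp
          have "\<bar>x \<bullet> y\<bar> \<le> 1" using Cauchy_Schwarz_ineq2[of x y] x y by simp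
          then have "\<bar>x \<bullet> y\<bar> ^ (m mod 2) \<le> 1" by (simp add: power_le_one)
          moreover have "\<bar>a \<bullet> y\<bar> ^ m \<le> norm a ^ m" using Cauchy_Schwarz_ineq2[of a y] y by (intro power_mono) auto
          ultimately have "\<bar>x \<bullet> y\<bar> ^ (m mod 2) * \<bar>a \<bullet> y\<bar> ^ m \<le> 1 * norm a ^ m" by (intro mult_mono) auto
          then have "(\<bar>x \<bullet> y\<bar> ^ (m mod 2) * \<bar>a \<bullet> y\<bar> ^ m) * ((b \<bullet> y)\<^sup>2 / \<bar>1 - (x \<bullet> y)\<^sup>2\<bar>) \<le> (1 * norm a ^ m) * ((b \<bullet> y)\<^sup>2 / \<bar>1 - (x \<bullet> y)\<^sup>2\<bar>)"
            by (intro mult_right_mono) auto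
          then show "norm (?g y) \<le> norm (norm a ^ m * ((x \<bullet> y) ^ 0 / (1 - (x \<bullet> y)\<^sup>2) * (h \<bullet> y) ^ 0 * (b \<bullet> y) ^ 2))"
            unfolding D[symmetric] by (simp add: abs_mult power_abs mult.assoc)
        qed
      qed measurable
      have "b \<bullet> ?C = (\<integral>y. (a \<bullet> y) ^ m * (u \<bullet> y) - \<beta> * ?g y \<partial>sphere_haar)"
        unfolding Cb z u using False
        by (intro Bochner_Integration.integral_cong refl)
          (simp add: D[symmetric] mod2_eq_if power2_eq_square algebra_simps)
      also have "\<dots> = (\<integral>y. (a \<bullet> y) ^ m * (u \<bullet> y) \<partial>sphere_haar) - \<beta> * (\<integral>y. ?g y \<partial>sphere_haar)"
        by (subst Bochner_Integration.integral_diff[OF i1 integrable_mult_right[OF i2]])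
          (simp only: integral_mult_right_zero)
      also have "(\<integral>y. (a \<bullet> y) ^ m * (u \<bullet> y) \<partial>sphere_haar) = 0"
        by (rule integral_sphere_haar_odd[OF orthogonal_transformation_reflection[of u] borel_measurable_integrable[OF i1]])
          (simp add: inner_reflection_self inner_reflection_orthogonal[OF ua])
      finally show ?thesis unfolding km using False by (simp add: mod2_eq_if)
    qed
    ultimately have "?C = - ((\<beta> * (\<alpha> * K)) *\<^sub>R b)" by (subst C) simp
    also have "\<dots> = (- 1 / ((real m + 1) * (real m + 2))) *\<^sub>R (\<Sum>j\<le>m div 2. ((\<alpha>\<^sup>2 + \<beta>\<^sup>2) ^ j * \<alpha> ^ (2 * (m div 2 - j)) * (\<alpha> * \<beta>)) *\<^sub>R b)"
      by (simp add: K_def scaleR_sum_left[symmetric] sum_distrib_left sum_divide_distrib sum_negf ac_simps)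
    also have "(\<Sum>j\<le>m div 2. ((\<alpha>\<^sup>2 + \<beta>\<^sup>2) ^ j * \<alpha> ^ (2 * (m div 2 - j)) * (\<alpha> * \<beta>)) *\<^sub>R b)
        = (\<Sum>j\<le>m div 2. norm a ^ (2 * j) *\<^sub>R zonal (m - 2 * j) a x)"
    proof (rule sum.cong[OF refl])
      fix j assume j: "j \<in> {..m div 2}"
      have e: "m - 2 * j = Suc (2 * (m div 2 - j))" using False j by (auto elim!: oddE)
      have ax: "a \<bullet> x = \<alpha>" by (simp add: \<alpha>_def inner_commute)
      have "cross x a = \<beta> *\<^sub>R b" unfolding cy using fD' unit by simp
      then show "((\<alpha>\<^sup>2 + \<beta>\<^sup>2) ^ j * \<alpha> ^ (2 * (m div 2 - j)) * (\<alpha> * \<beta>)) *\<^sub>R b = norm a ^ (2 * j) *\<^sub>R zonal (m - 2 * j) a x"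
        unfolding na e by (simp add: zonal_def ax)
    qed
    finally show ?thesis using False by simp
  qed
qed

end

section \<open>Symmetry and parity of the operator of common lines\<close>

lemma common_lines_kernel_symmetric:
  assumes "norm x = 1" "norm y = 1" "v \<bullet> y = 0" "w \<bullet> x = 0"
  shows "common_lines_kernel x y v \<bullet> w = v \<bullet> common_lines_kernel y x w"
proof -
  have "common_lines_kernel y x w \<bullet> v = w \<bullet> v + (w \<bullet> y) * (y \<bullet> x) * (v \<bullet> x) / (1 - (y \<bullet> x)\<^sup>2)"
    by (rule inner_common_lines_kernel) (use assms in auto)
  moreover have "common_lines_kernel x y v \<bullet> w = v \<bullet> w + (v \<bullet> x) * (x \<bullet> y) * (w \<bullet> y) / (1 - (x \<bullet> y)\<^sup>2)"
    by (rule inner_common_lines_kernel) (use assms in auto)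
  ultimately show ?thesis
    by (simp only: inner_commute[of y x] inner_commute[of w v] inner_commute[of v "common_lines_kernel y x w"] ac_simps)
qed

lemma common_lines_operator_abs:
  assumes "l2_section s"
  shows "common_lines_operator (abs_section_space s) = abs_section_space (common_lines_integral s)"
  using assms by (intro common_lines_operator.abs_eq) (simp add: l2_section_eq_def)

lemma inner_abs_section_space:
  assumes "l2_section s" "l2_section t"
  shows "abs_section_space s \<bullet> abs_section_space t = (\<integral>x. s x \<bullet> t x \<partial>sphere_haar)"
  using assms by (intro inner_section_space.abs_eq) (auto simp: l2_section_eq_def)

text \<open>Fubini's theorem for the symmetric kernel. The double integral converges because \<open>C(x, y)\<close> does not
increase norms.\<close>

lemma common_lines_operator_symmetric:
  "common_lines_operator S \<bullet> T = S \<bullet> common_lines_operator (T :: 'a::euclidean_space section_space)"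
proof -
  interpret P: prob_space "sphere_haar :: 'a measure" by (rule prob_space_sphere_haar)
  interpret pair_sigma_finite "sphere_haar :: 'a measure" "sphere_haar :: 'a measure" ..
  obtain s where s: "l2_section s" "S = abs_section_space s" by (rule section_space_cases)
  obtain t where t: "l2_section t" "T = abs_section_space t" by (rule section_space_cases)
  note tan = section_of_bundleD[OF l2_sectionD(1)]
  define f where "f = (\<lambda>(x, y). common_lines_kernel x y (s y) \<bullet> t x)"
  have [measurable]: "t \<in> borel_measurable sphere_haar" by (rule l2_sectionD(2)[OF t(1)])
  have K [measurable]: "(\<lambda>z. common_lines_kernel (fst z) (snd z) (s (snd z)))
      \<in> borel_measurable (sphere_haar \<Otimes>\<^sub>M (sphere_haar :: 'a measure))"
    using common_lines_measurable[OF s(1)] by (simp add: case_prod_beta')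
  have meas [measurable]: "f \<in> borel_measurable (sphere_haar \<Otimes>\<^sub>M sphere_haar)"
    unfolding f_def case_prod_beta' by measurable
  have int_y: "integrable sphere_haar (\<lambda>y. f (x, y))" if "norm x = 1" for x
    unfolding f_def prod.case by (intro integrable_inner_left common_lines_integrable s that)
  have bound: "(\<integral>y. norm (f (x, y)) \<partial>sphere_haar) \<le> (\<integral>y. norm (s y) \<partial>sphere_haar) * norm (t x)" if x: "norm x = 1" for x
  proof -
    have "(\<integral>y. norm (f (x, y)) \<partial>sphere_haar) \<le> (\<integral>y. norm (s y) * norm (t x) \<partial>sphere_haar)"
    proof (rule integral_mono)
      show "integrable sphere_haar (\<lambda>y. norm (f (x, y)))" by (intro integrable_norm int_y x)
      show "integrable sphere_haar (\<lambda>y. norm (s y) * norm (t x))"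
        by (intro integrable_mult_left l2_section_integrable_norm s)
      fix y :: 'a assume "y \<in> space sphere_haar"
      then have y: "norm y = 1" by simp
      have "norm (f (x, y)) \<le> norm (common_lines_kernel x y (s y)) * norm (t x)"
        unfolding f_def prod.case real_norm_def by (rule Cauchy_Schwarz_ineq2)
      also have "\<dots> \<le> norm (s y) * norm (t x)"
        using tan[OF s(1) y] x y by (intro mult_right_mono common_lines_kernel_props) (auto simp: tangent_plane_def)
      finally show "norm (f (x, y)) \<le> norm (s y) * norm (t x)" .
    qed
    then show ?thesis by simp
  qed
  have int: "integrable (sphere_haar \<Otimes>\<^sub>M sphere_haar) f"
  proof (rule Fubini_integrable[OF meas])
    show "integrable sphere_haar (\<lambda>x. \<integral>y. norm (f (x, y)) \<partial>sphere_haar)"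
    proof (rule Bochner_Integration.integrable_bound)
      show "integrable sphere_haar (\<lambda>x. (\<integral>y. norm (s y) \<partial>sphere_haar) * norm (t x))"
        by (intro integrable_mult_right l2_section_integrable_norm t)
      show "AE x in sphere_haar. norm (\<integral>y. norm (f (x, y)) \<partial>sphere_haar) \<le> norm ((\<integral>y. norm (s y) \<partial>sphere_haar) * norm (t x))"
        using bound by (intro AE_I2) (auto simp: abs_of_nonneg)
    qed measurable
    show "AE x in sphere_haar. integrable sphere_haar (\<lambda>y. f (x, y))"
      by (intro AE_I2 int_y) simp
  qed
  have "common_lines_operator S \<bullet> T = (\<integral>x. common_lines_integral s x \<bullet> t x \<partial>sphere_haar)"
    unfolding s(2) t(2) common_lines_operator_abs[OF s(1)]
    by (rule inner_abs_section_space[OF l2_section_common_lines_integral[OF s(1)] t(1)])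
  also have "\<dots> = (\<integral>x. (\<integral>y. f (x, y) \<partial>sphere_haar) \<partial>sphere_haar)"
    unfolding f_def prod.case common_lines_integral_def
    by (intro Bochner_Integration.integral_cong refl integral_inner_left[symmetric] common_lines_integrable s) simp
  also have "\<dots> = (\<integral>y. (\<integral>x. f (x, y) \<partial>sphere_haar) \<partial>sphere_haar)"
    using Fubini_integral[of "\<lambda>x y. f (x, y)"] int by simp
  also have "\<dots> = (\<integral>y. s y \<bullet> common_lines_integral t y \<partial>sphere_haar)"
  proof (rule Bochner_Integration.integral_cong[OF refl])
    fix y :: 'a assume "y \<in> space sphere_haar"
    then have y: "norm y = 1" by simp
    have "(\<integral>x. f (x, y) \<partial>sphere_haar) = (\<integral>x. s y \<bullet> common_lines_kernel y x (t x) \<partial>sphere_haar)"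
      unfolding f_def prod.case using tan[OF s(1) y] tan[OF t(1)] y
      by (intro Bochner_Integration.integral_cong refl common_lines_kernel_symmetric) auto
    also have "\<dots> = s y \<bullet> common_lines_integral t y"
      unfolding common_lines_integral_def
      by (intro integral_inner_right common_lines_integrable t y)
    finally show "(\<integral>x. f (x, y) \<partial>sphere_haar) = s y \<bullet> common_lines_integral t y" .
  qed
  also have "\<dots> = S \<bullet> common_lines_operator T"
    unfolding s(2) t(2) common_lines_operator_abs[OF t(1)]
    by (rule inner_abs_section_space[OF s(1) l2_section_common_lines_integral[OF t(1)], symmetric])
  finally show ?thesis .
qed

text \<open>The lines \<open>x\<^sup>\<bottom> \<inter> y\<^sup>\<bottom>\<close> and \<open>x\<^sup>\<bottom> \<inter> (- y)\<^sup>\<bottom>\<close> coincide, so the contributions of \<open>y\<close> and \<open>- y\<close>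
cancel.\<close>

lemma common_lines_integral_odd:
  fixes s :: "'a::euclidean_space \<Rightarrow> 'a"
  assumes s: "l2_section s" and odd: "\<And>y. norm y = 1 \<Longrightarrow> s (- y) = - s y" and x: "norm x = 1"
  shows "common_lines_integral s x = 0"
proof -
  let ?f = "\<lambda>y. common_lines_kernel x y (s y)"
  have "common_lines_integral s x = (\<integral>y. ?f (- y) \<partial>sphere_haar)"
    unfolding common_lines_integral_def
    by (rule integral_sphere_haar_orthogonal[symmetric, OF _ borel_measurable_integrable[OF common_lines_integrable[OF s x]]])
      (auto simp: orthogonal_transformation_def intro!: linearI)
  also have "\<dots> = (\<integral>y. - ?f y \<partial>sphere_haar)"
  proof (rule Bochner_Integration.integral_cong[OF refl])
    fix y :: 'a assume "y \<in> space sphere_haar"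
    then have y: "norm y = 1" by simp
    have v: "s y \<in> tangent_plane y" "- s y \<in> tangent_plane (- y)"
      using section_of_bundleD[OF l2_sectionD(1)[OF s] y] by (auto simp: tangent_plane_def)
    have my: "norm (- y) = 1" using y by simp
    show "?f (- y) = - ?f y"
      unfolding odd[OF y] common_lines_kernel_eq(2)[OF x y v(1)] common_lines_kernel_eq(2)[OF x my v(2)]
      by simp
  qed
  also have "\<dots> = - common_lines_integral s x" by (simp add: common_lines_integral_def)
  finally show ?thesis by (simp add: eq_neg_iff_add_eq_0 flip: scaleR_2)
qed

section \<open>Sections given by continuous vector fields\<close>

definition tangential_section :: "('a::euclidean_space \<Rightarrow> 'a) \<Rightarrow> 'a section_space" where
  "tangential_section f = abs_section_space (tangential_part f)"

lemma l2_section_tangential_continuous: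
  fixes f :: "'a::euclidean_space \<Rightarrow> 'a"
  assumes "continuous_on UNIV f"
  shows "l2_section (tangential_part f)"
  by (intro l2_section_tangential_part measurable_sphere_haar_continuous integrable_sphere_haar_continuous continuous_intros assms)

lemma tangential_section_cong:
  fixes f g :: "'a::euclidean_space \<Rightarrow> 'a"
  assumes "continuous_on UNIV f" "continuous_on UNIV g"
    and "\<And>y. norm y = 1 \<Longrightarrow> tangential_part f y = tangential_part g y"
  shows "tangential_section f = tangential_section g"
  unfolding tangential_section_def
  by (intro abs_section_space_eqI l2_section_tangential_continuous assms)

lemma tangential_section_add:
  fixes f g :: "'a::euclidean_space \<Rightarrow> 'a"
  assumes "continuous_on UNIV f" "continuous_on UNIV g"
  shows "tangential_section (\<lambda>y. f y + g y) = tangential_section f + tangential_section g"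
  unfolding tangential_section_def
  by (subst plus_abs_section_space) (intro l2_section_tangential_continuous assms | simp add: tangential_part_add[abs_def, symmetric] fun_eq_iff)+

lemma tangential_section_scaleR:
  fixes f :: "'a::euclidean_space \<Rightarrow> 'a"
  assumes "continuous_on UNIV f"
  shows "tangential_section (\<lambda>y. c *\<^sub>R f y) = c *\<^sub>R tangential_section f"
proof -
  have "tangential_part (\<lambda>y. c *\<^sub>R f y) = (\<lambda>y. c *\<^sub>R tangential_part f y)"
    by (simp add: fun_eq_iff tangential_part_scaleR)
  then show ?thesis
    by (simp add: tangential_section_def scaleR_abs_section_space l2_section_tangential_continuous assms)
qed

lemma tangential_section_zero: "tangential_section (\<lambda>y. 0 :: 'a::euclidean_space) = 0"
  by (simp add: tangential_section_def zero_section_space_def)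

lemma tangential_section_sum:
  fixes f :: "'i \<Rightarrow> 'a::euclidean_space \<Rightarrow> 'a"
  assumes "\<And>i. i \<in> A \<Longrightarrow> continuous_on UNIV (f i)"
  shows "tangential_section (\<lambda>y. \<Sum>i\<in>A. f i y) = (\<Sum>i\<in>A. tangential_section (f i))"
  using assms
proof (induction A rule: infinite_finite_induct)
  case (insert i A)
  have "continuous_on UNIV (\<lambda>y. \<Sum>i\<in>A. f i y)" by (intro continuous_on_sum insert.prems) auto
  with insert show ?case by (simp add: tangential_section_add)
qed (simp_all add: tangential_section_zero)

text \<open>Nonempty open sets have positive measure on the sphere, since the cones over them are open in the ball.\<close>

lemma AE_sphere_haar_continuous_zero:
  fixes g :: "'a::euclidean_space \<Rightarrow> real"
  assumes g: "continuous_on UNIV g" and ae: "AE y in sphere_haar. g y = 0" and x: "norm x = 1"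
  shows "g x = 0"
proof (rule ccontr)
  assume nz: "g x \<noteq> 0"
  have [measurable]: "g \<in> borel_measurable borel" by (rule borel_measurable_continuous_onI[OF g])
  let ?A = "{y. norm y = 1 \<and> g y \<noteq> 0}"
  have A [measurable]: "?A \<in> sets borel" by measurable
  have sub: "?A \<subseteq> sphere 0 1" by auto
  have "emeasure sphere_haar ?A = 0"
  proof -
    have A': "?A \<in> sets sphere_haar" using A by (auto simp: sets_restrict_space)
    have sp: "{y \<in> space sphere_haar. \<not> g y = 0} = ?A" by auto
    show ?thesis by (rule iffD1[OF AE_iff_measurable[OF A' sp] ae])
  qed
  then have zero: "emeasure lborel {z \<in> ball 0 1. sgn z \<in> ?A} = 0"
    using emeasure_sphere_haar[OF A sub] emeasure_unit_ball_bounds[where 'a='a] by (auto simp: ennreal_divide_eq_0_iff)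
  have eq: "{z \<in> ball 0 1. sgn z \<in> ?A} = {z \<in> ball 0 1 - {0}. g (sgn z) \<in> - {0}}"
    by (auto simp: norm_sgn)
  have "continuous_on (ball 0 1 - {0}) (\<lambda>z::'a. g (sgn z))"
    by (intro continuous_on_compose2[OF g] continuous_on_sgn continuous_on_id) auto
  then have op: "open {z \<in> ball 0 1 - {0}. g (sgn z) \<in> - {0}}"
    using continuous_open_preimage[OF _ open_Diff[OF open_ball closed_singleton] open_Compl[OF closed_singleton]]
    unfolding Int_def vimage_def mem_Collect_eq by blast
  have "{z \<in> ball 0 1 - {0}. g (sgn z) \<in> - {0}} \<in> null_sets lborel"
    using zero[unfolded eq] borel_open[OF op] by (intro null_setsI) simp_all
  then have "{z \<in> ball 0 1 - {0}. g (sgn z) \<in> - {0}} \<in> null_sets lebesgue"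
    by (rule null_sets_completionI)
  then have "negligible {z \<in> ball 0 1 - {0}. g (sgn z) \<in> - {0}}" by (simp add: negligible_iff_null_sets)
  \<comment> \<open>The point \<open>x / 2\<close> witnesses that this open cone is nonempty.\<close>
  moreover have "(1/2) *\<^sub>R x \<in> {z \<in> ball 0 1 - {0}. g (sgn z) \<in> - {0}}"
    using x nz by (auto simp: sgn_scaleR sgn_div_norm)
  ultimately show False using open_not_negligible[OF op] by blast
qed

lemma tangential_section_eq_zeroD:
  fixes f :: "'a::euclidean_space \<Rightarrow> 'a"
  assumes f: "continuous_on UNIV f" and zero: "tangential_section f = 0" and x: "norm x = 1"
  shows "tangential_part f x = 0"
proof -
  have l2: "l2_section (tangential_part f)" by (rule l2_section_tangential_continuous[OF f])
  have "(\<integral>y. (norm (tangential_part f y))\<^sup>2 \<partial>sphere_haar) = 0"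
    using norm_abs_section_space[OF l2] zero by (simp add: tangential_section_def)
  then have "AE y in sphere_haar. (norm (tangential_part f y))\<^sup>2 = 0"
    by (subst (asm) integral_nonneg_eq_0_iff_AE[OF l2_sectionD(3)[OF l2]]) auto
  moreover have "continuous_on UNIV (\<lambda>y. (norm (tangential_part f y))\<^sup>2)"
    unfolding tangential_part_def by (intro continuous_intros f)
  ultimately have "(norm (tangential_part f x))\<^sup>2 = 0" using AE_sphere_haar_continuous_zero x by blast
  then show ?thesis by simp
qed

section \<open>Polynomial functions, powers of linear forms, and gradients\<close>

abbreviation polynomial_linear :: "(('a::euclidean_space \<Rightarrow> real) \<Rightarrow> 'v::real_vector) \<Rightarrow> bool" where
  "polynomial_linear \<Phi> \<equiv>
    (\<forall>f g. real_polynomial_function f \<longrightarrow> real_polynomial_function g \<longrightarrow> \<Phi> (\<lambda>y. f y + g y) = \<Phi> f + \<Phi> g) \<and>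
    (\<forall>c f. real_polynomial_function f \<longrightarrow> \<Phi> (\<lambda>y. c * f y) = c *\<^sub>R \<Phi> f)"

lemma real_polynomial_function_inner [simp, intro]: "real_polynomial_function (\<lambda>y. a \<bullet> y)"
  by (rule real_polynomial_function.intros(1)) (rule bounded_linear_inner_right)

lemmas polynomial_intros = real_polynomial_function.intros(2-4) real_polynomial_function_power
  real_polynomial_function_inner real_polynomial_function_sum

lemma polynomial_linear_sum:
  assumes lin: "polynomial_linear \<Phi>" and "\<And>i. i \<in> A \<Longrightarrow> real_polynomial_function (f i)" "finite A"
  shows "\<Phi> (\<lambda>y. \<Sum>i\<in>A. c i * f i y) = (\<Sum>i\<in>A. c i *\<^sub>R \<Phi> (f i))"
  using assms(3,2)
proof (induction A)
  case empty
  have "\<Phi> (\<lambda>y. 0 * 0) = 0 *\<^sub>R \<Phi> (\<lambda>y. 0)" using lin by (blast intro: real_polynomial_function.intros(2))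
  then show ?case by simp
next
  case (insert i A)
  have 1: "real_polynomial_function (\<lambda>y. \<Sum>i\<in>A. c i * f i y)"
    using insert.hyps(1) insert.prems by (intro polynomial_intros) auto
  have 2: "real_polynomial_function (\<lambda>y. c i * f i y)"
    using insert.prems by (intro polynomial_intros) auto
  have "\<Phi> (\<lambda>y. \<Sum>i\<in>insert i A. c i * f i y) = \<Phi> (\<lambda>y. c i * f i y + (\<Sum>i\<in>A. c i * f i y))"
    using insert.hyps by simp
  also have "\<dots> = \<Phi> (\<lambda>y. c i * f i y) + \<Phi> (\<lambda>y. \<Sum>i\<in>A. c i * f i y)" using lin 1 2 by blast
  also have "\<Phi> (\<lambda>y. c i * f i y) = c i *\<^sub>R \<Phi> (f i)" using lin insert.prems by blast
  finally show ?case using insert by simp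
qed

text \<open>Apply \<open>coefficients_in_subspace\<close> to the expansion in powers of \<open>s\<close>. The functional \<open>\<Phi>\<close> is allowed to be
defined on all functions but only has to be linear on polynomials.\<close>

lemma polarization:
  fixes a b :: "'a::euclidean_space"
  assumes lin: "polynomial_linear \<Phi>" and S: "subspace S" and p: "real_polynomial_function p"
    and powers: "\<And>s. \<Phi> (\<lambda>y. ((a + s *\<^sub>R b) \<bullet> y) ^ m * p y) \<in> S" and k: "k \<le> m"
  shows "\<Phi> (\<lambda>y. (a \<bullet> y) ^ (m - k) * (b \<bullet> y) ^ k * p y) \<in> S"
proof -
  define f where "f k y = (a \<bullet> y) ^ (m - k) * (b \<bullet> y) ^ k * p y" for k y
  have f: "real_polynomial_function (f k)" for k
    unfolding f_def by (intro real_polynomial_function.intros(4) real_polynomial_function_power real_polynomial_function_inner p)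
  have "(\<Sum>k\<le>m. s ^ k *\<^sub>R ((m choose k) *\<^sub>R \<Phi> (f k))) \<in> S" for s
  proof -
    have "((a + s *\<^sub>R b) \<bullet> y) ^ m * p y = (\<Sum>k\<le>m. (s ^ k * (m choose k)) * f k y)" for y
    proof -
      have "((a + s *\<^sub>R b) \<bullet> y) ^ m = (\<Sum>k\<le>m. (m choose k) * (s * (b \<bullet> y)) ^ k * (a \<bullet> y) ^ (m - k))"
        using binomial_ring[of "s * (b \<bullet> y)" "a \<bullet> y" m] by (simp add: inner_add_left add.commute)
      then show ?thesis by (simp add: sum_distrib_right sum_distrib_left f_def power_mult_distrib ac_simps)
    qed
    then have "\<Phi> (\<lambda>y. \<Sum>k\<le>m. (s ^ k * (m choose k)) * f k y) \<in> S" using powers[of s] by simp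
    then show ?thesis by (simp add: polynomial_linear_sum[OF lin f])
  qed
  then have "(m choose k) *\<^sub>R \<Phi> (f k) \<in> S" by (rule coefficients_in_subspace[OF S _ k])
  then have "inverse (real (m choose k)) *\<^sub>R ((m choose k) *\<^sub>R \<Phi> (f k)) \<in> S" by (rule subspace_scale[OF S])
  then show ?thesis using k by (simp add: f_def[abs_def])
qed

text \<open>Over the reals every polynomial is a combination of powers of linear forms. The additional power of
\<open>a \<bullet> y\<close> and the arbitrary \<open>\<Phi>\<close> make the induction pass through products.\<close>

lemma polynomial_from_powers_aux:
  fixes p :: "'a::euclidean_space \<Rightarrow> real"
  assumes S: "subspace S" and p: "real_polynomial_function p"
    and "polynomial_linear \<Phi>" and "\<And>a m. \<Phi> (\<lambda>y. (a \<bullet> y) ^ m) \<in> S"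
  shows "\<Phi> (\<lambda>y. (a \<bullet> y) ^ m * p y) \<in> S"
  using p assms(3,4)
proof (induction arbitrary: \<Phi> a m)
  case (linear f)
  define b where "b = (\<Sum>i\<in>Basis. f i *\<^sub>R i)"
  have b: "f y = b \<bullet> y" for y
  proof -
    have "f y = f (\<Sum>i\<in>Basis. (y \<bullet> i) *\<^sub>R i)" by (simp add: euclidean_representation)
    also have "\<dots> = (\<Sum>i\<in>Basis. (y \<bullet> i) * f i)"
      using bounded_linear.linear[OF linear.hyps] by (simp add: linear_sum linear_scale)
    finally show ?thesis by (simp add: b_def inner_sum_left inner_commute[of y] mult.commute)
  qed
  have "\<Phi> (\<lambda>y. (a \<bullet> y) ^ (Suc m - 1) * (b \<bullet> y) ^ 1 * 1) \<in> S"
    by (rule polarization[OF linear.prems(1) S real_polynomial_function.intros(2)]) (simp_all add: linear.prems(2) del: power_Suc)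
  then show ?case by (simp add: b)
next
  case (const c)
  have "real_polynomial_function (\<lambda>y. (a \<bullet> y) ^ m)" by (intro real_polynomial_function_power real_polynomial_function_inner)
  then have "\<Phi> (\<lambda>y. c * (a \<bullet> y) ^ m) = c *\<^sub>R \<Phi> (\<lambda>y. (a \<bullet> y) ^ m)" using const.prems(1) by blast
  then show ?case using subspace_scale[OF S const.prems(2)] by (simp add: mult.commute)
next
  case (add f g)
  have "real_polynomial_function (\<lambda>y. (a \<bullet> y) ^ m * f y)" "real_polynomial_function (\<lambda>y. (a \<bullet> y) ^ m * g y)"
    by (intro polynomial_intros add.hyps)+
  then have "\<Phi> (\<lambda>y. (a \<bullet> y) ^ m * f y + (a \<bullet> y) ^ m * g y) = \<Phi> (\<lambda>y. (a \<bullet> y) ^ m * f y) + \<Phi> (\<lambda>y. (a \<bullet> y) ^ m * g y)"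
    using add.prems(1) by blast
  then show ?case
    using subspace_add[OF S add.IH(1)[OF add.prems] add.IH(2)[OF add.prems]] by (simp add: distrib_left)
next
  case (mult f g)
  \<comment> \<open>Multiplication by g turns the functional for the product into one for f alone.\<close>
  define \<Psi> where "\<Psi> q = \<Phi> (\<lambda>y. q y * g y)" for q
  have "polynomial_linear \<Psi>"
  proof (intro conjI allI impI)
    fix f1 f2 :: "'a \<Rightarrow> real" assume f: "real_polynomial_function f1" "real_polynomial_function f2"
    have "real_polynomial_function (\<lambda>y. f1 y * g y)" "real_polynomial_function (\<lambda>y. f2 y * g y)"
      by (intro polynomial_intros f mult.hyps(2))+
    then have "\<Phi> (\<lambda>y. f1 y * g y + f2 y * g y) = \<Phi> (\<lambda>y. f1 y * g y) + \<Phi> (\<lambda>y. f2 y * g y)"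
      using mult.prems(1) by blast
    then show "\<Psi> (\<lambda>y. f1 y + f2 y) = \<Psi> f1 + \<Psi> f2" by (simp add: \<Psi>_def distrib_right)
  next
    fix c and f1 :: "'a \<Rightarrow> real" assume f: "real_polynomial_function f1"
    have "real_polynomial_function (\<lambda>y. f1 y * g y)" by (intro polynomial_intros f mult.hyps(2))
    then have "\<Phi> (\<lambda>y. c * (f1 y * g y)) = c *\<^sub>R \<Phi> (\<lambda>y. f1 y * g y)" using mult.prems(1) by blast
    then show "\<Psi> (\<lambda>y. c * f1 y) = c *\<^sub>R \<Psi> f1" by (simp add: \<Psi>_def mult.assoc)
  qed
  moreover have "\<Psi> (\<lambda>y. (a \<bullet> y) ^ m) \<in> S" for a m
    unfolding \<Psi>_def by (rule mult.IH(2)[OF mult.prems])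
  ultimately have "\<Psi> (\<lambda>y. (a \<bullet> y) ^ m * f y) \<in> S" by (rule mult.IH(1))
  then show ?case by (simp add: \<Psi>_def mult.assoc)
qed

lemma polynomial_from_powers:
  fixes p :: "'a::euclidean_space \<Rightarrow> real"
  assumes "subspace S" "real_polynomial_function p"
    "polynomial_linear \<Phi>" "\<And>a m. \<Phi> (\<lambda>y. (a \<bullet> y) ^ m) \<in> S"
  shows "\<Phi> p \<in> S"
  using polynomial_from_powers_aux[OF assms, of 0 0] by simp

lemma real_polynomial_function_along_line:
  fixes f :: "'a::euclidean_space \<Rightarrow> real"
  assumes "real_polynomial_function f"
  shows "\<exists>q. \<forall>\<tau>. f (u + \<tau> *\<^sub>R v) = poly q \<tau>"
  using assms
proof induction
  case (linear f)
  have "f (u + \<tau> *\<^sub>R v) = poly [:f u, f v:] \<tau>" for \<tau>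
    using bounded_linear.linear[OF linear] by (simp add: linear_add linear_scale)
  then show ?case by blast
next
  case (const c)
  then show ?case by (intro exI[of _ "[:c:]"]) simp
next
  case (add f g)
  then show ?case by (metis poly_add)
next
  case (mult f g)
  then show ?case by (metis poly_mult)
qed

definition gradient :: "('a::euclidean_space \<Rightarrow> real) \<Rightarrow> 'a \<Rightarrow> 'a" where
  "gradient f y = (\<Sum>b\<in>Basis. frechet_derivative f (at y) b *\<^sub>R b)"

lemma gradient_eqI:
  assumes "GDERIV f y :> X" shows "gradient f y = X"
proof -
  have "frechet_derivative f (at y) = (\<lambda>h. h \<bullet> X)"
    using frechet_derivative_at[OF assms[unfolded gderiv_def]] by simp
  then show ?thesis by (simp add: gradient_def inner_commute[of _ X] euclidean_representation)
qed

lemma gradient_polynomial: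
  assumes "real_polynomial_function f"
  shows "GDERIV f y :> gradient f y" "continuous_on UNIV (gradient f)"
proof -
  obtain p where p: "\<And>x. (f has_derivative p x) (at x)" "\<And>v. real_polynomial_function (\<lambda>x. p x v)"
    using real_polynomial_function_has_derivative[OF assms] by blast
  have fr: "frechet_derivative f (at x) = p x" for x
    using frechet_derivative_at[OF p(1)] by simp
  have lin: "linear (p x)" for x using has_derivative_linear[OF p(1)] .
  have "p y h = h \<bullet> gradient f y" for h
  proof -
    have "p y h = p y (\<Sum>b\<in>Basis. (h \<bullet> b) *\<^sub>R b)" by (simp add: euclidean_representation)
    also have "\<dots> = h \<bullet> gradient f y"
      by (simp add: linear_sum[OF lin] linear_scale[OF lin] gradient_def fr inner_sum_right mult.commute)
    finally show ?thesis .
  qed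
  then have "p y = (\<lambda>h. h \<bullet> gradient f y)" by auto
  then show "GDERIV f y :> gradient f y" using p(1)[of y] by (simp add: gderiv_def)
  show "continuous_on UNIV (gradient f)"
    unfolding gradient_def[abs_def] fr
    by (intro continuous_intros continuous_on_polymonial_function p(2)[unfolded real_polynomial_function_eq])
qed

lemma GDERIV_inner: "GDERIV (\<lambda>y. a \<bullet> y) y :> a"
  unfolding gderiv_def by (subst inner_commute) (auto intro!: derivative_eq_intros)

lemma GDERIV_power_inner: "GDERIV (\<lambda>y. (a \<bullet> y) ^ n) y :> (real n * (a \<bullet> y) ^ (n - 1)) *\<^sub>R a"
proof -
  have "DERIV (\<lambda>t. t ^ n) (a \<bullet> y) :> real n * (a \<bullet> y) ^ (n - 1)"
    by (auto intro!: derivative_eq_intros)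
  from GDERIV_DERIV_compose[OF GDERIV_inner this] show ?thesis .
qed

section \<open>Gradient fields and their quarter turns\<close>

text \<open>If the gradient is normal to the sphere, the derivative along the circle vanishes.\<close>

lemma constant_on_great_circle:
  fixes f :: "'a::euclidean_space \<Rightarrow> real"
  assumes f: "\<And>y. GDERIV f y :> gradient f y"
    and radial: "\<And>y. norm y = 1 \<Longrightarrow> gradient f y = (gradient f y \<bullet> y) *\<^sub>R y"
    and u: "norm u = 1" "norm h = 1" "u \<bullet> h = 0"
  shows "f (cos \<tau> *\<^sub>R u + sin \<tau> *\<^sub>R h) = f u"
proof -
  define \<gamma> where "\<gamma> \<tau> = cos \<tau> *\<^sub>R u + sin \<tau> *\<^sub>R h" for \<tau>
  define \<gamma>' where "\<gamma>' \<tau> = - sin \<tau> *\<^sub>R u + cos \<tau> *\<^sub>R h" for \<tau>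
  have uu: "u \<bullet> u = 1" "h \<bullet> h = 1" "h \<bullet> u = 0" using u by (simp_all add: dot_square_norm inner_commute)
  have n: "norm (\<gamma> \<tau>) = 1" for \<tau>
    using sin_cos_squared_add[of \<tau>] uu u(3)
    by (simp add: \<gamma>_def norm_eq_sqrt_inner inner_add_left inner_add_right power2_eq_square add.commute)
  have orth: "\<gamma>' \<tau> \<bullet> \<gamma> \<tau> = 0" for \<tau>
    using uu u(3) by (simp add: \<gamma>_def \<gamma>'_def inner_add_left inner_add_right inner_diff_left)
  have \<gamma>: "(\<gamma> has_derivative (\<lambda>r. r *\<^sub>R \<gamma>' \<tau>)) (at \<tau>)" for \<tau>
    unfolding \<gamma>_def \<gamma>'_def
    by (auto intro!: derivative_eq_intros simp: fun_eq_iff algebra_simps)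
  have "DERIV (\<lambda>\<tau>. f (\<gamma> \<tau>)) \<tau> :> 0" for \<tau>
  proof -
    have "((\<lambda>\<tau>. f (\<gamma> \<tau>)) has_derivative (\<lambda>r. (r *\<^sub>R \<gamma>' \<tau>) \<bullet> gradient f (\<gamma> \<tau>))) (at \<tau>)"
      using has_derivative_compose[OF \<gamma> f[unfolded gderiv_def]] .
    moreover have "(\<lambda>r. (r *\<^sub>R \<gamma>' \<tau>) \<bullet> gradient f (\<gamma> \<tau>)) = (*) 0"
      by (rule ext, subst radial[OF n]) (simp add: orth)
    ultimately show ?thesis unfolding has_field_derivative_def by (simp only:)
  qed
  then have "f (\<gamma> \<tau>) = f (\<gamma> 0)" using DERIV_isconst_all by blast
  then show ?thesis by (simp add: \<gamma>_def)
qed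

context cross_product begin

text \<open>For even \<open>n\<close>, and for \<open>v\<close> tangential at \<open>y\<close>, the rotation of \<open>v\<close> by a right angle in the tangent plane;
the normal component of \<open>v\<close> is lost.\<close>

definition twist :: "nat \<Rightarrow> 'a \<Rightarrow> 'a \<Rightarrow> 'a" where
  "twist n y v = (if odd n then v else cross y v)"

text \<open>The two summands of the Hodge decomposition of tangential fields, gradients for odd \<open>n\<close> and turned
gradients for even \<open>n\<close>. Only the parity of \<open>n\<close> enters; it is to be that of the degree of \<open>f\<close>.\<close>

definition hodge_field :: "nat \<Rightarrow> ('a \<Rightarrow> real) \<Rightarrow> 'a section_space" where
  "hodge_field n f = tangential_section (\<lambda>y. twist n y (gradient f y))"

lemma twist_add: "twist n y (v + w) = twist n y v + twist n y w"
  and twist_scaleR: "twist n y (c *\<^sub>R v) = c *\<^sub>R twist n y v"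
  by (simp_all add: twist_def cross.add_right cross.scaleR_right)

lemma continuous_on_twist:
  assumes "continuous_on UNIV X" shows "continuous_on UNIV (\<lambda>y. twist n y (X y))"
proof (cases "odd n")
  case True
  then show ?thesis using assms by (simp add: twist_def)
next
  case False
  have "continuous_on UNIV (\<lambda>y. cross y (X y))" by (intro continuous_intros assms)
  then show ?thesis using False by (simp add: twist_def)
qed

lemma continuous_on_twist_gradient:
  assumes "real_polynomial_function f" shows "continuous_on UNIV (\<lambda>y. twist n y (gradient f y))"
  by (intro continuous_on_twist gradient_polynomial assms)

lemma hodge_field_linear: "polynomial_linear (hodge_field n)"
proof (intro conjI allI impI)
  fix f g :: "'a \<Rightarrow> real" assume P: "real_polynomial_function f" "real_polynomial_function g"
  have "gradient (\<lambda>y. f y + g y) y = gradient f y + gradient g y" for y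
    by (rule gradient_eqI) (intro GDERIV_add gradient_polynomial P)
  then show "hodge_field n (\<lambda>y. f y + g y) = hodge_field n f + hodge_field n g"
    unfolding hodge_field_def
    by (simp add: twist_add tangential_section_add continuous_on_twist_gradient P)
next
  fix c and f :: "'a \<Rightarrow> real" assume P: "real_polynomial_function f"
  have "gradient (\<lambda>y. c * f y) y = c *\<^sub>R gradient f y" for y
    by (rule gradient_eqI) (use GDERIV_mult[OF GDERIV_const gradient_polynomial(1)[OF P], of c y] in simp)
  then show "hodge_field n (\<lambda>y. c * f y) = c *\<^sub>R hodge_field n f"
    unfolding hodge_field_def
    by (simp add: twist_scaleR tangential_section_scaleR continuous_on_twist_gradient P)
qed

lemmas hodge_field_add = hodge_field_linear[THEN conjunct1, rule_format]
lemmas hodge_field_scale = hodge_field_linear[THEN conjunct2, rule_format]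

lemma hodge_field_diff:
  assumes "real_polynomial_function f" "real_polynomial_function g"
  shows "hodge_field n (\<lambda>y. f y - g y) = hodge_field n f - hodge_field n g"
proof -
  have P: "real_polynomial_function (\<lambda>y. (-1) * g y)" by (intro polynomial_intros assms)
  show ?thesis
    using hodge_field_add[OF assms(1) P, of n] hodge_field_scale[OF assms(2), of n "-1"] by simp
qed

lemma hodge_field_parity: "even m = even n \<Longrightarrow> hodge_field m f = hodge_field n f"
  by (simp add: hodge_field_def twist_def)

lemma hodge_field_const: "hodge_field n (\<lambda>y. c) = 0"
proof -
  have "gradient (\<lambda>y. c) y = (0 :: 'a)" for y by (rule gradient_eqI) (rule GDERIV_const)
  then show ?thesis using twist_scaleR[of n _ 0] by (simp add: hodge_field_def tangential_section_zero)
qed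

lemma real_polynomial_function_norm2 [simp, intro]: "real_polynomial_function (\<lambda>y::'a. y \<bullet> y)"
proof -
  have "(\<lambda>y::'a. y \<bullet> y) = (\<lambda>y. \<Sum>b\<in>Basis. (b \<bullet> y) * (b \<bullet> y))"
    by (simp add: fun_eq_iff euclidean_inner[of y y for y] inner_commute)
  then show ?thesis by (simp only:) (intro polynomial_intros; simp)
qed

text \<open>The field only depends on the restriction of the polynomial to the sphere, where \<open>y \<bullet> y = 1\<close>.\<close>

lemma hodge_field_radial:
  assumes f: "real_polynomial_function f"
  shows "hodge_field n (\<lambda>y. (y \<bullet> y) * f y) = hodge_field n f"
proof -
  have "GDERIV (\<lambda>y::'a. y \<bullet> y) y :> 2 *\<^sub>R y" for y
    unfolding gderiv_def by (auto intro!: derivative_eq_intros simp: inner_commute)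
  then have grad: "gradient (\<lambda>y. (y \<bullet> y) * f y) y = (y \<bullet> y) *\<^sub>R gradient f y + f y *\<^sub>R (2 *\<^sub>R y)" for y
    by (intro gradient_eqI GDERIV_mult gradient_polynomial f)
  show ?thesis
    unfolding hodge_field_def
  proof (rule tangential_section_cong)
    show "continuous_on UNIV (\<lambda>y. twist n y (gradient (\<lambda>y. (y \<bullet> y) * f y) y))"
      by (intro continuous_on_twist_gradient polynomial_intros real_polynomial_function_norm2 f)
    show "continuous_on UNIV (\<lambda>y. twist n y (gradient f y))" by (rule continuous_on_twist_gradient[OF f])
    fix y :: 'a assume "norm y = 1"
    then have yy: "y \<bullet> y = 1" by (simp add: dot_square_norm)
    show "tangential_part (\<lambda>y. twist n y (gradient (\<lambda>y. (y \<bullet> y) * f y) y)) y = tangential_part (\<lambda>y. twist n y (gradient f y)) y"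
      unfolding tangential_part_def grad yy
      by (simp add: twist_def cross.add_right cross.scaleR_right inner_add_left yy algebra_simps)
  qed
qed

text \<open>The gradient is normal to the sphere, and any two points lie on a common great circle.\<close>

lemma hodge_field_eq_zeroD:
  assumes f: "real_polynomial_function f" and zero: "hodge_field n f = 0" and u: "norm u = 1" "norm v = 1"
  shows "f v = f u"
proof -
  have radial: "gradient f y = (gradient f y \<bullet> y) *\<^sub>R y" if y: "norm y = 1" for y
  proof -
    have yy: "y \<bullet> y = 1" using y by (simp add: dot_square_norm)
    have t: "tangential_part (\<lambda>y. twist n y (gradient f y)) y = 0"
      by (rule tangential_section_eq_zeroD[OF continuous_on_twist_gradient[OF f] zero[unfolded hodge_field_def] y])
    show ?thesis
    proof (cases "odd n")
      case True
      then show ?thesis using t by (simp add: tangential_part_def twist_def)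
    next
      case False
      then have "cross y (gradient f y) = 0" using t by (simp add: tangential_part_def twist_def)
      then have "cross y (cross y (gradient f y)) = 0" by (simp only: cross.zero_right)
      then have "gradient f y = (y \<bullet> gradient f y) *\<^sub>R y" unfolding cross_cross yy by simp
      then show ?thesis by (simp add: inner_commute)
    qed
  qed
  obtain h b where fr: "frame u h b" and v: "v = (u \<bullet> v) *\<^sub>R u + (h \<bullet> v) *\<^sub>R h" and bv: "b \<bullet> v = 0"
    by (rule frame_exists[OF u(1)])
  have "(u \<bullet> v)\<^sup>2 + (h \<bullet> v)\<^sup>2 = 1" using frame_norm[OF fr, of v] bv u(2) by simp
  then obtain \<tau> where "u \<bullet> v = cos \<tau>" "h \<bullet> v = sin \<tau>" using sincos_total_2pi by metis
  then have "v = cos \<tau> *\<^sub>R u + sin \<tau> *\<^sub>R h" using v by metis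
  then show ?thesis
    using constant_on_great_circle[OF gradient_polynomial(1)[OF f] radial u(1) frameD(2,4)[OF fr]] by simp
qed

definition zonal_section :: "nat \<Rightarrow> 'a \<Rightarrow> 'a section_space" where
  "zonal_section m a = tangential_section (zonal m a)"

lemma tangential_part_zonal: "norm y = 1 \<Longrightarrow> tangential_part (zonal m a) y = zonal m a y"
  by (rule tangential_part_section[OF section_of_bundle_zonal])

lemma hodge_field_power: "hodge_field (Suc m) (\<lambda>y. (a \<bullet> y) ^ Suc m) = real (Suc m) *\<^sub>R zonal_section m a"
proof -
  have g: "gradient (\<lambda>y. (a \<bullet> y) ^ Suc m) y = (real (Suc m) * (a \<bullet> y) ^ m) *\<^sub>R a" for y
    using gradient_eqI[OF GDERIV_power_inner[of a "Suc m" y]] by simp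
  have "hodge_field (Suc m) (\<lambda>y. (a \<bullet> y) ^ Suc m) = tangential_section (\<lambda>y. real (Suc m) *\<^sub>R zonal m a y)"
    unfolding hodge_field_def
  proof (rule tangential_section_cong)
    show "continuous_on UNIV (\<lambda>y. twist (Suc m) y (gradient (\<lambda>y. (a \<bullet> y) ^ Suc m) y))"
      by (intro continuous_on_twist_gradient polynomial_intros)
    show "continuous_on UNIV (\<lambda>y. real (Suc m) *\<^sub>R zonal m a y)"
      by (intro continuous_intros continuous_on_zonal)
    fix y :: 'a assume y: "norm y = 1"
    then have yy: "y \<bullet> y = 1" by (simp add: dot_square_norm)
    show "tangential_part (\<lambda>y. twist (Suc m) y (gradient (\<lambda>y. (a \<bullet> y) ^ Suc m) y)) y = tangential_part (\<lambda>y. real (Suc m) *\<^sub>R zonal m a y) y"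
      unfolding tangential_part_scaleR tangential_part_zonal[OF y]
      unfolding tangential_part_def g
      by (cases "even m") (simp_all add: twist_def zonal_def cross.scaleR_right algebra_simps del: of_nat_Suc)
  qed
  then show ?thesis
    unfolding zonal_section_def by (simp add: tangential_section_scaleR continuous_on_zonal del: of_nat_Suc)
qed

lemma common_lines_operator_zonal_section:
  "common_lines_operator (zonal_section m a)
    = ((-1) ^ m / ((real m + 1) * (real m + 2))) *\<^sub>R (\<Sum>j\<le>m div 2. norm a ^ (2 * j) *\<^sub>R zonal_section (m - 2 * j) a)"
proof -
  let ?c = "(-1) ^ m / ((real m + 1) * (real m + 2))"
  have Z: "zonal_section m a = abs_section_space (zonal m a)" for m
    unfolding zonal_section_def tangential_section_def
    by (intro abs_section_space_eqI l2_section_tangential_continuous continuous_on_zonal l2_section_zonal tangential_part_zonal)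
  have cont: "continuous_on UNIV (\<lambda>x. norm a ^ (2 * j) *\<^sub>R zonal (m - 2 * j) a x)" for j
    by (intro continuous_intros continuous_on_zonal)
  have sum: "continuous_on UNIV (\<lambda>x. \<Sum>j\<le>m div 2. norm a ^ (2 * j) *\<^sub>R zonal (m - 2 * j) a x)"
    by (intro continuous_on_sum cont)
  have tan: "tangential_part (\<lambda>x. ?c *\<^sub>R (\<Sum>j\<le>m div 2. norm a ^ (2 * j) *\<^sub>R zonal (m - 2 * j) a x)) x
      = ?c *\<^sub>R (\<Sum>j\<le>m div 2. norm a ^ (2 * j) *\<^sub>R zonal (m - 2 * j) a x)" if "norm x = 1" for x
    using section_of_bundleD[OF section_of_bundle_zonal that] by (simp add: tangential_part_def inner_sum_left)
  have "common_lines_operator (zonal_section m a) = abs_section_space (common_lines_integral (zonal m a))"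
    unfolding Z by (rule common_lines_operator_abs[OF l2_section_zonal])
  also have "\<dots> = tangential_section (\<lambda>x. ?c *\<^sub>R (\<Sum>j\<le>m div 2. norm a ^ (2 * j) *\<^sub>R zonal (m - 2 * j) a x))"
    unfolding tangential_section_def
  proof (rule abs_section_space_eqI)
    show "l2_section (common_lines_integral (zonal m a))"
      by (intro l2_section_common_lines_integral l2_section_zonal)
    show "l2_section (tangential_part (\<lambda>x. ?c *\<^sub>R (\<Sum>j\<le>m div 2. norm a ^ (2 * j) *\<^sub>R zonal (m - 2 * j) a x)))"
      by (intro l2_section_tangential_continuous continuous_intros sum)
  qed (simp only: tan common_lines_integral_zonal)
  also have "\<dots> = ?c *\<^sub>R (\<Sum>j\<le>m div 2. norm a ^ (2 * j) *\<^sub>R zonal_section (m - 2 * j) a)"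
    by (simp add: tangential_section_scaleR[OF sum] tangential_section_sum[OF cont] tangential_section_scaleR continuous_on_zonal
        zonal_section_def)
  finally show ?thesis .
qed

end

section \<open>Triangularity and density\<close>

context cross_product begin

abbreviation zonal_sections :: "nat \<Rightarrow> 'a section_space set" where
  "zonal_sections n \<equiv> range (zonal_section (n - 1))"

text \<open>Only degrees of the same parity are included. On the sphere these are the fields of homogeneous
polynomials of degree \<open>n - 2\<close>, and a mixture of gradients and turned gradients never arises.\<close>

definition lower_span :: "nat \<Rightarrow> 'a section_space set" where
  "lower_span n = span (\<Union>k\<in>{k. 1 \<le> k \<and> k < n \<and> (even k \<longleftrightarrow> even n)}. zonal_sections k)"

lemma subspace_lower_span: "subspace (lower_span n)"
  unfolding lower_span_def by (rule subspace_span)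

lemma zonal_sections_lower: "1 \<le> k \<Longrightarrow> k < n \<Longrightarrow> even k = even n \<Longrightarrow> span (zonal_sections k) \<subseteq> lower_span n"
  unfolding lower_span_def by (intro span_mono) auto

lemma common_lines_operator_triangular:
  assumes n: "n \<ge> 1" and x: "x \<in> zonal_sections n"
  shows "common_lines_operator x - ((-1) ^ (n - 1) / (real n * (real n + 1))) *\<^sub>R x \<in> lower_span n"
proof -
  obtain m where m: "n = Suc m" using n by (cases n) auto
  obtain a where a: "x = zonal_section m a" using x m by auto
  let ?c = "(-1) ^ m / ((real m + 1) * (real m + 2)) :: real"
  let ?z = "\<lambda>j. norm a ^ (2 * j) *\<^sub>R zonal_section (m - 2 * j) a"
  have c: "(-1) ^ (n - 1) / (real n * (real n + 1)) = ?c" using m by (simp add: add.commute)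
  have "(\<Sum>j\<le>m div 2. ?z j) = ?z 0 + (\<Sum>j\<in>{1..m div 2}. ?z j)"
    by (subst sum.atMost_shift) (simp add: sum.atLeast1_atMost_eq)
  then have "common_lines_operator x - ?c *\<^sub>R x = ?c *\<^sub>R (\<Sum>j\<in>{1..m div 2}. ?z j)"
    unfolding a common_lines_operator_zonal_section by (simp add: scaleR_add_right)
  also have "\<dots> \<in> lower_span n"
  proof (intro subspace_scale[OF subspace_lower_span] subspace_sum[OF subspace_lower_span])
    fix j assume j: "j \<in> {1..m div 2}"
    have "zonal_section (m - 2 * j) a \<in> span (zonal_sections (n - 2 * j))"
      using j m by (intro span_base) (auto simp: Suc_diff_le)
    moreover have "1 \<le> n - 2 * j" "n - 2 * j < n" "even (n - 2 * j) = even n" using j m by auto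
    ultimately show "zonal_section (m - 2 * j) a \<in> lower_span n" using zonal_sections_lower by blast
  qed
  finally show ?thesis unfolding c .
qed

lemma hodge_field_homogeneous:
  assumes n: "n \<ge> 1" "i + j + k = n"
  shows "hodge_field n (\<lambda>y. (a \<bullet> y) ^ i * (b \<bullet> y) ^ j * (c \<bullet> y) ^ k) \<in> span (zonal_sections n)"
proof -
  obtain m where m: "n = Suc m" using n(1) by (cases n) auto
  have pow: "hodge_field n (\<lambda>y. (u \<bullet> y) ^ n * 1) \<in> span (zonal_sections n)" for u
  proof -
    have "real (Suc m) *\<^sub>R zonal_section m u \<in> span (zonal_sections n)"
      using m by (intro span_scale span_base) auto
    then show ?thesis unfolding m mult_1_right hodge_field_power .
  qed
  have "hodge_field n (\<lambda>y. (u \<bullet> y) ^ (n - k) * (c \<bullet> y) ^ k * 1) \<in> span (zonal_sections n)" for u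
    by (rule polarization[OF hodge_field_linear subspace_span]) (use pow n(2) in \<open>auto intro: real_polynomial_function.intros(2)\<close>)
  then have "hodge_field n (\<lambda>y. (u \<bullet> y) ^ (i + j) * (c \<bullet> y) ^ k) \<in> span (zonal_sections n)" for u
    using n(2) by (auto simp: mult.commute)
  then have "hodge_field n (\<lambda>y. (a \<bullet> y) ^ ((i + j) - j) * (b \<bullet> y) ^ j * (c \<bullet> y) ^ k) \<in> span (zonal_sections n)"
    by (intro polarization[OF hodge_field_linear subspace_span] polynomial_intros) auto
  then show ?thesis by simp
qed

text \<open>Let \<open>X = (a \<bullet> y)\<^sup>m v\<close>. Euler's identity gives \<open>(m + 1) X = \<nabla>(y \<bullet> X) - y \<times> curl X\<close>, and the same
identity for \<open>Y = curl X\<close>, which has degree \<open>m - 1\<close>, gives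
\<open>m (y \<times> Y) = y \<times> \<nabla>(y \<bullet> Y) - y \<times> (y \<times> curl Y)\<close>. On the sphere \<open>- y \<times> (y \<times> curl Y)\<close> is the tangential
part of \<open>curl Y\<close>, a field of the same form as \<open>X\<close> and of degree \<open>m - 2\<close>. With \<open>c = a \<times> v\<close> this reads, up to
tangential parts,

\<open>(m + 1) X = \<nabla>((a \<bullet> y)\<^sup>m (v \<bullet> y)) - y \<times> \<nabla>((a \<bullet> y)\<^bsup>m - 1\<^esup> (c \<bullet> y)) - (m - 1) (a \<bullet> y)\<^bsup>m - 2\<^esup> (a \<times> c)\<close>.\<close>

lemma tangential_section_power_even:
  fixes a v :: 'a
  assumes "even m"
  shows "tangential_section (\<lambda>y. (a \<bullet> y) ^ m *\<^sub>R v) \<in> span (\<Union>n\<in>{1..}. zonal_sections n)"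
  using assms
proof (induction m arbitrary: a v rule: less_induct)
  case (less m)
  let ?S = "span (\<Union>n\<in>{1..}. zonal_sections n)"
  have sub: "span (zonal_sections n) \<subseteq> ?S" if "n \<ge> 1" for n
    using that by (intro span_mono) auto
  show ?case
  proof (cases "m = 0")
    case True
    have "tangential_section (\<lambda>y. (a \<bullet> y) ^ m *\<^sub>R v) = zonal_section 0 v"
      unfolding zonal_section_def
    proof (rule tangential_section_cong)
      show "continuous_on UNIV (\<lambda>y. (a \<bullet> y) ^ m *\<^sub>R v)" by (intro continuous_intros)
      fix y :: 'a assume "norm y = 1"
      then show "tangential_part (\<lambda>y. (a \<bullet> y) ^ m *\<^sub>R v) y = tangential_part (zonal 0 v) y"
        using True by (simp add: tangential_part_zonal) (simp add: zonal_def tangential_part_def)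
    qed (rule continuous_on_zonal)
    moreover have "zonal_section 0 v \<in> span (zonal_sections 1)" by (intro span_base) auto
    ultimately show ?thesis using sub[of 1] by auto
  next
    case False
    define l where "l = m - 2"
    have "m \<ge> 2" using less.prems False by (auto elim!: evenE)
    then have l1: "m = Suc (Suc l)" by (simp add: l_def)
    then have l: "m = Suc (Suc l)" "even l" using less.prems by simp_all
    define c where "c = cross a v"
    define f where "f y = (a \<bullet> y) ^ m * (v \<bullet> y) ^ 1 * (v \<bullet> y) ^ 0" for y
    define g where "g y = (a \<bullet> y) ^ Suc l * (c \<bullet> y) ^ 1 * (c \<bullet> y) ^ 0" for y
    have P: "real_polynomial_function f" "real_polynomial_function g"
      unfolding f_def g_def by (intro polynomial_intros)+
    have "hodge_field (Suc m) f \<in> span (zonal_sections (Suc m))" "hodge_field m g \<in> span (zonal_sections m)"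
      unfolding f_def[abs_def] g_def[abs_def] by (rule hodge_field_homogeneous; use l1 in simp)+
    then have fS: "hodge_field (Suc m) f \<in> ?S" "hodge_field m g \<in> ?S"
      using sub[of "Suc m"] sub[of m] l1 by auto
    let ?h = "\<lambda>y. (a \<bullet> y) ^ l *\<^sub>R cross a c"
    have hS: "tangential_section ?h \<in> ?S" using less.IH[of l] l by simp
    have gf: "gradient f y = (real m * (a \<bullet> y) ^ (m - 1) * (v \<bullet> y)) *\<^sub>R a + (a \<bullet> y) ^ m *\<^sub>R v" for y
      unfolding f_def
      by (rule gradient_eqI) (use GDERIV_mult[OF GDERIV_power_inner[of a m y] GDERIV_inner[of v y]] in \<open>simp add: algebra_simps\<close>)
    have gg: "gradient g y = (real (Suc l) * (a \<bullet> y) ^ l * (c \<bullet> y)) *\<^sub>R a + (a \<bullet> y) ^ Suc l *\<^sub>R c" for y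
      unfolding g_def
      by (rule gradient_eqI) (use GDERIV_mult[OF GDERIV_power_inner[of a "Suc l" y] GDERIV_inner[of c y]] in \<open>simp add: algebra_simps\<close>)
    have cont: "continuous_on UNIV (\<lambda>y. (a \<bullet> y) ^ m *\<^sub>R v)" "continuous_on UNIV ?h"
      by (intro continuous_intros)+
    have "real (Suc m) *\<^sub>R tangential_section (\<lambda>y. (a \<bullet> y) ^ m *\<^sub>R v)
        = hodge_field (Suc m) f + (-1) *\<^sub>R hodge_field m g + (- real (Suc l)) *\<^sub>R tangential_section ?h"
    proof -
      have ct: "continuous_on UNIV (\<lambda>y. twist (Suc m) y (gradient f y))" "continuous_on UNIV (\<lambda>y. twist m y (gradient g y))"
        by (intro continuous_on_twist_gradient P)+
      have "hodge_field (Suc m) f + (-1) *\<^sub>R hodge_field m g + (- real (Suc l)) *\<^sub>R tangential_section ?h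
        = tangential_section (\<lambda>y. twist (Suc m) y (gradient f y) + (-1) *\<^sub>R twist m y (gradient g y) + (- real (Suc l)) *\<^sub>R ?h y)"
        unfolding hodge_field_def tangential_section_scaleR[OF ct(2), symmetric] tangential_section_scaleR[OF cont(2), symmetric]
        by (subst tangential_section_add[symmetric], (intro continuous_intros ct cont)+)+ simp
      also have "\<dots> = tangential_section (\<lambda>y. real (Suc m) *\<^sub>R ((a \<bullet> y) ^ m *\<^sub>R v))"
      proof (rule tangential_section_cong)
        show "continuous_on UNIV (\<lambda>y. twist (Suc m) y (gradient f y) + (-1) *\<^sub>R twist m y (gradient g y) + (- real (Suc l)) *\<^sub>R ?h y)"
          by (intro continuous_intros ct cont)
        show "continuous_on UNIV (\<lambda>y. real (Suc m) *\<^sub>R ((a \<bullet> y) ^ m *\<^sub>R v))" by (intro continuous_intros)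
        fix y :: 'a assume "norm y = 1"
        then have yy: "y \<bullet> y = 1" by (simp add: dot_square_norm)
        define \<alpha> where "\<alpha> = a \<bullet> y"
        have W: "cross y c = (v \<bullet> y) *\<^sub>R a - \<alpha> *\<^sub>R v"
          unfolding c_def cross_cross by (simp add: inner_commute \<alpha>_def)
        \<comment> \<open>\<open>- y \<times> (y \<times> Z)\<close> is the tangential part of \<open>Z = a \<times> c\<close>.\<close>
        have ac: "cross a c = (y \<bullet> cross a c) *\<^sub>R y - (c \<bullet> y) *\<^sub>R cross y a + \<alpha> *\<^sub>R cross y c"
        proof -
          have "cross y (cross y (cross a c)) = (y \<bullet> cross a c) *\<^sub>R y - cross a c"
            by (subst cross_cross) (simp add: yy)
          moreover have "cross y (cross a c) = (c \<bullet> y) *\<^sub>R a - \<alpha> *\<^sub>R c"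
            by (subst cross_cross) (simp add: inner_commute \<alpha>_def)
          ultimately have "(y \<bullet> cross a c) *\<^sub>R y - cross a c = (c \<bullet> y) *\<^sub>R cross y a - \<alpha> *\<^sub>R cross y c"
            by (simp add: cross.diff_right cross.scaleR_right)
          then show ?thesis by (simp add: algebra_simps)
        qed
        have "twist (Suc m) y (gradient f y) + (-1) *\<^sub>R twist m y (gradient g y) + (- real (Suc l)) *\<^sub>R ?h y
          = real (Suc m) *\<^sub>R (\<alpha> ^ m *\<^sub>R v) - (real (Suc l) * \<alpha> ^ l * (y \<bullet> cross a c)) *\<^sub>R y"
        proof -
          define q W where "q = \<alpha> ^ l" and "W = (v \<bullet> y) *\<^sub>R a - \<alpha> *\<^sub>R v"
          have pw: "\<alpha> ^ m = \<alpha> * (\<alpha> * q)" "\<alpha> ^ (m - 1) = \<alpha> * q" "\<alpha> ^ Suc l = \<alpha> * q" "\<alpha> ^ l = q"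
            using l1 by (simp_all add: q_def)
          have t1: "twist (Suc m) y (gradient f y) = ((real l + 2) * (\<alpha> * q) * (v \<bullet> y)) *\<^sub>R a + (\<alpha> * (\<alpha> * q)) *\<^sub>R v"
            unfolding gf \<alpha>_def[symmetric] pw using l by (simp add: twist_def)
          have t2: "twist m y (gradient g y) = ((real l + 1) * q * (c \<bullet> y)) *\<^sub>R cross y a + (\<alpha> * q) *\<^sub>R W"
            unfolding gg \<alpha>_def[symmetric] pw W_def W[symmetric]
            using l by (simp add: twist_def cross.add_right cross.scaleR_right add.commute)
          have t3: "?h y = q *\<^sub>R ((y \<bullet> cross a c) *\<^sub>R y - (c \<bullet> y) *\<^sub>R cross y a + \<alpha> *\<^sub>R W)"
            unfolding \<alpha>_def[symmetric] pw W_def W[symmetric] by (subst ac) (rule refl)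
          have sm: "real (Suc m) = real l + 3" "real (Suc l) = real l + 1" using l1 by simp_all
          show ?thesis
            unfolding t1 t2 t3 pw sm
            by (subst vector_eq_rdot[symmetric])
              (simp add: inner_add_left inner_diff_left W_def algebra_simps)
        qed
        then show "tangential_part (\<lambda>y. twist (Suc m) y (gradient f y) + (-1) *\<^sub>R twist m y (gradient g y) + (- real (Suc l)) *\<^sub>R ?h y) y
          = tangential_part (\<lambda>y. real (Suc m) *\<^sub>R ((a \<bullet> y) ^ m *\<^sub>R v)) y"
          unfolding tangential_part_def \<alpha>_def
          by (simp only:) (simp add: inner_diff_left yy algebra_simps)
      qed
      finally show ?thesis by (simp only: tangential_section_scaleR[OF cont(1)])
    qed
    also have "\<dots> \<in> ?S" by (intro span_add span_scale fS hS)
    finally have "inverse (real (Suc m)) *\<^sub>R (real (Suc m) *\<^sub>R tangential_section (\<lambda>y. (a \<bullet> y) ^ m *\<^sub>R v)) \<in> ?S"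
      by (rule span_scale)
    then show ?thesis by (simp del: of_nat_Suc)
  qed
qed

lemma tangential_section_power_odd:
  fixes a v :: 'a
  assumes "odd m"
  shows "tangential_section (\<lambda>y. (a \<bullet> y) ^ m *\<^sub>R v) \<in> eigenspace common_lines_operator 0"
proof -
  let ?s = "tangential_part (\<lambda>y. (a \<bullet> y) ^ m *\<^sub>R v)"
  have l2: "l2_section ?s" by (intro l2_section_tangential_continuous continuous_intros)
  have "abs_section_space (common_lines_integral ?s) = abs_section_space (\<lambda>y. 0)"
  proof (rule abs_section_space_eqI[OF l2_section_common_lines_integral[OF l2] l2_section_zero])
    fix x :: 'a assume x: "norm x = 1"
    show "common_lines_integral ?s x = 0"
      by (rule common_lines_integral_odd[OF l2 _ x]) (simp add: tangential_part_def assms)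
  qed
  then show ?thesis
    by (simp add: eigenspace_def tangential_section_def common_lines_operator_abs[OF l2] zero_section_space_def)
qed

text \<open>Smooth sections are dense and are uniformly approximated by polynomial fields, and taking tangential parts
does not increase the distance. Polynomial fields decompose into fields \<open>(a \<bullet> y)\<^sup>m v\<close>.\<close>

lemma zonal_sections_dense:
  "closure (span (eigenspace common_lines_operator 0 \<union> (\<Union>n\<in>{1..}. zonal_sections n))) = UNIV"
proof -
  let ?X = "span (eigenspace common_lines_operator 0 \<union> (\<Union>n\<in>{1..}. zonal_sections n))"
  have pow: "tangential_section (\<lambda>y. (a \<bullet> y) ^ m *\<^sub>R v) \<in> ?X" for a v m
  proof (cases "even m")
    case True
    have "span (\<Union>n\<in>{1..}. zonal_sections n) \<subseteq> ?X" by (intro span_mono) auto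
    then show ?thesis using tangential_section_power_even[OF True] by blast
  next
    case False
    then show ?thesis using tangential_section_power_odd[OF False] by (intro span_base) auto
  qed
  have scalar: "tangential_section (\<lambda>y. q y *\<^sub>R v) \<in> ?X" if q: "real_polynomial_function q" for q v
  proof (rule polynomial_from_powers[OF subspace_span q, where \<Phi> = "\<lambda>q. tangential_section (\<lambda>y. q y *\<^sub>R v)"])
    have cont: "continuous_on UNIV (\<lambda>y. f y *\<^sub>R v)" if "real_polynomial_function f" for f :: "'a \<Rightarrow> real"
      using that by (intro continuous_intros continuous_on_polymonial_function) (simp add: real_polynomial_function_eq)
    show "polynomial_linear (\<lambda>q. tangential_section (\<lambda>y. q y *\<^sub>R v))"
      by (auto simp: scaleR_add_left tangential_section_add cont)
        (simp add: cont flip: scaleR_scaleR tangential_section_scaleR)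
  qed (rule pow)
  have poly: "tangential_section p \<in> ?X" if p: "polynomial_function p" for p :: "'a \<Rightarrow> 'a"
  proof -
    have P: "real_polynomial_function (\<lambda>y. p y \<bullet> b)" if "b \<in> Basis" for b
      using p that by (simp add: polynomial_function_iff_Basis_inner)
    have "tangential_section (\<lambda>y. \<Sum>b\<in>Basis. (p y \<bullet> b) *\<^sub>R b) = (\<Sum>b\<in>Basis. tangential_section (\<lambda>y. (p y \<bullet> b) *\<^sub>R b))"
      by (intro tangential_section_sum continuous_intros continuous_on_polymonial_function p)
    then have "tangential_section p = (\<Sum>b\<in>Basis. tangential_section (\<lambda>y. (p y \<bullet> b) *\<^sub>R b))"
      by (simp add: euclidean_representation)
    then show ?thesis using scalar[OF P] by (auto intro: span_sum)
  qed
  have "abs_section_space s \<in> closure ?X" if s: "smooth_section s" for s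
    unfolding closure_approachable
  proof (intro allI impI)
    fix e :: real assume e: "e > 0"
    obtain U F where U: "open U" "sphere 0 1 \<subseteq> U" "smooth_on U F" "\<forall>x\<in>sphere 0 1. s x = F x"
      using s by (auto simp: smooth_section_def)
    have "F differentiable_on U" using U(3) by (cases rule: smooth_on.cases) auto
    then have "continuous_on (sphere 0 1) F"
      using U(2) continuous_on_subset differentiable_imp_continuous_on by blast
    then obtain p where p: "polynomial_function p" "\<And>x. x \<in> sphere 0 1 \<Longrightarrow> norm (F x - p x) < e / 2"
      using Stone_Weierstrass_polynomial_function[of "sphere 0 1" F "e / 2"] e by auto
    have l2s: "l2_section s" by (rule smooth_section_imp_l2_section[OF s])
    have l2p: "l2_section (tangential_part p)"
      by (intro l2_section_tangential_continuous continuous_on_polymonial_function p(1))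
    have "(dist (tangential_section p) (abs_section_space s))\<^sup>2 = (\<integral>x. (norm (tangential_part p x - s x))\<^sup>2 \<partial>sphere_haar)"
      unfolding dist_norm tangential_section_def minus_abs_section_space[OF l2p l2s]
      by (rule norm_abs_section_space[OF l2_section_minus[OF l2p l2s]])
    also have "\<dots> \<le> (\<integral>x. (e / 2)\<^sup>2 \<partial>(sphere_haar :: 'a measure))"
    proof (rule integral_mono)
      show "integrable sphere_haar (\<lambda>x. (norm (tangential_part p x - s x))\<^sup>2)"
        by (rule l2_sectionD(3)[OF l2_section_minus[OF l2p l2s]])
      show "integrable sphere_haar (\<lambda>x::'a. (e / 2)\<^sup>2)" by (intro integrable_sphere_haar_continuous continuous_intros)
      fix x :: 'a assume "x \<in> space sphere_haar"
      then have x: "norm x = 1" by simp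
      have "tangential_part p x - s x = tangential_part (\<lambda>x. p x - s x) x"
        using tangential_part_section[OF l2_sectionD(1)[OF l2s] x] by (simp add: tangential_part_diff)
      then have "norm (tangential_part p x - s x) \<le> norm (p x - s x)"
        using norm_tangential_part_le[OF x, of "\<lambda>x. p x - s x"] by simp
      also have "\<dots> \<le> e / 2" using p(2)[of x] U(4) x by (simp add: norm_minus_commute less_imp_le)
      finally show "(norm (tangential_part p x - s x))\<^sup>2 \<le> (e / 2)\<^sup>2" by (intro power_mono) auto
    qed
    also have "\<dots> = (e / 2)\<^sup>2" by simp
    finally have "dist (tangential_section p) (abs_section_space s) \<le> e / 2"
      by (rule power2_le_imp_le) (use e in simp)
    then show "\<exists>y\<in>?X. dist y (abs_section_space s) < e" using poly[OF p(1)] e by force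
  qed
  then have "abs_section_space ` {s. smooth_section s} \<subseteq> closure ?X" by auto
  then have "closure (abs_section_space ` {s. smooth_section s}) \<subseteq> closure ?X" by (rule closure_minimal) simp
  then show ?thesis unfolding smooth_sections_dense by blast
qed

end

section \<open>Polynomials on the sphere modulo lower degree\<close>

context cross_product begin

text \<open>The pair \<open>(k, i)\<close> consists of the exponents of the third and of the first coordinate; the degree \<open>n\<close>
determines the second one.\<close>

definition monomial :: "'a \<Rightarrow> 'a \<Rightarrow> 'a \<Rightarrow> nat \<Rightarrow> nat \<times> nat \<Rightarrow> 'a \<Rightarrow> real" where
  "monomial e1 e2 e3 n = (\<lambda>(k, i) y. (e1 \<bullet> y) ^ i * (e2 \<bullet> y) ^ (n - k - i) * (e3 \<bullet> y) ^ k)"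

definition reduced_exponents :: "nat \<Rightarrow> (nat \<times> nat) set" where
  "reduced_exponents n = (SIGMA k:{0, 1}. {..n - k})"

lemma finite_reduced_exponents [simp]: "finite (reduced_exponents n)"
  by (simp add: reduced_exponents_def)

lemma card_reduced_exponents: "n \<ge> 1 \<Longrightarrow> card (reduced_exponents n) = 2 * n + 1"
  by (simp add: reduced_exponents_def card_SigmaI)

lemma real_polynomial_function_monomial [simp]: "real_polynomial_function (monomial e1 e2 e3 n p)"
  unfolding monomial_def by (cases p) (simp, intro polynomial_intros)

text \<open>On the sphere, \<open>(e3 \<bullet> y)\<^sup>2\<close> is \<open>1 - (e1 \<bullet> y)\<^sup>2 - (e2 \<bullet> y)\<^sup>2\<close>. The constant \<open>1\<close> leads to degree
\<open>n - 2\<close>, the squares lower the exponent of the third coordinate by two.\<close>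

lemma hodge_field_monomial_in_span:
  assumes n: "n \<ge> 1" and ijk: "i + j + k = n"
  and f: "frame e1 e2 e3"
  shows "hodge_field n (\<lambda>y. (e1 \<bullet> y) ^ i * (e2 \<bullet> y) ^ j * (e3 \<bullet> y) ^ k)
    \<in> span ((\<lambda>p. hodge_field n (monomial e1 e2 e3 n p)) ` reduced_exponents n \<union> lower_span n)"
    (is "_ \<in> ?S")
  using ijk
proof (induction k arbitrary: i j rule: less_induct)
  case (less k)
  show ?case
  proof (cases "k \<le> 1")
    case True
    then have "(k, i) \<in> reduced_exponents n" using less.prems by (auto simp: reduced_exponents_def)
    moreover have "(\<lambda>y. (e1 \<bullet> y) ^ i * (e2 \<bullet> y) ^ j * (e3 \<bullet> y) ^ k) = monomial e1 e2 e3 n (k, i)"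
      using less.prems by (auto simp: monomial_def)
    ultimately show ?thesis by (intro span_base) auto
  next
    case False
    then obtain l where l: "k = Suc (Suc l)" by (metis One_nat_def Suc_le_mono le0 not0_implies_Suc)
    define f where "f i j y = (e1 \<bullet> y) ^ i * (e2 \<bullet> y) ^ j * (e3 \<bullet> y) ^ l" for i j y
    have P: "real_polynomial_function (f i j)" for i j
      unfolding f_def by (intro polynomial_intros)
    have eq: "(e1 \<bullet> y) ^ i * (e2 \<bullet> y) ^ j * (e3 \<bullet> y) ^ k = (y \<bullet> y) * f i j y - f (i + 2) j y - f i (j + 2) y" for y
    proof -
      have e3: "(e3 \<bullet> y)\<^sup>2 = y \<bullet> y - (e1 \<bullet> y)\<^sup>2 - (e2 \<bullet> y)\<^sup>2"
        using frame_norm[OF f, of y] by (simp add: power2_norm_eq_inner)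
      have "(e1 \<bullet> y) ^ i * (e2 \<bullet> y) ^ j * (e3 \<bullet> y) ^ k = f i j y * (e3 \<bullet> y)\<^sup>2"
        by (simp add: f_def l power2_eq_square)
      also have "\<dots> = f i j y * (y \<bullet> y - (e1 \<bullet> y)\<^sup>2 - (e2 \<bullet> y)\<^sup>2)" unfolding e3 ..
      also have "\<dots> = (y \<bullet> y) * f i j y - f (i + 2) j y - f i (j + 2) y"
        by (simp add: f_def algebra_simps power2_eq_square)
      finally show ?thesis .
    qed
    have P': "real_polynomial_function (\<lambda>y. (y \<bullet> y) * f i j y)"
      by (intro polynomial_intros real_polynomial_function_norm2 P)
    have P'': "real_polynomial_function (\<lambda>y. (y \<bullet> y) * f i j y - f (i + 2) j y)"
      by (intro real_polynomial_function_diff P P')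
    have "hodge_field n (f i j) \<in> ?S"
    proof (cases "i + j + l = 0")
      case True
      then show ?thesis using hodge_field_const[of n 1] span_zero by (simp add: f_def[abs_def])
    next
      case False
      have "hodge_field (n - 2) (f i j) \<in> span (zonal_sections (n - 2))"
        unfolding f_def by (rule hodge_field_homogeneous) (use False less.prems l in auto)
      moreover have "span (zonal_sections (n - 2)) \<subseteq> lower_span n"
        by (rule zonal_sections_lower) (use False less.prems l in auto)
      moreover have "hodge_field (n - 2) (f i j) = hodge_field n (f i j)"
        by (rule hodge_field_parity) (use False less.prems l in auto)
      ultimately show ?thesis by (auto intro: span_base)
    qed
    moreover have "hodge_field n (f (i + 2) j) \<in> ?S" "hodge_field n (f i (j + 2)) \<in> ?S"
      unfolding f_def by (rule less.IH; use l less.prems in simp)+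
    ultimately have "hodge_field n (f i j) - hodge_field n (f (i + 2) j) - hodge_field n (f i (j + 2)) \<in> ?S"
      by (intro span_diff)
    then show ?thesis
      unfolding eq hodge_field_diff[OF P'' P] hodge_field_diff[OF P' P] hodge_field_radial[OF P] .
  qed
qed

lemma zonal_sections_generated:
  assumes n: "n \<ge> 1" and f: "frame e1 e2 e3"
  shows "zonal_sections n \<subseteq> span ((\<lambda>p. hodge_field n (monomial e1 e2 e3 n p)) ` reduced_exponents n \<union> lower_span n)"
    (is "_ \<subseteq> ?S")
proof -
  obtain m where m: "n = Suc m" using n by (cases n) auto
  have "hodge_field n (\<lambda>y. (a \<bullet> y) ^ r * ((e1 \<bullet> y) ^ i * (e2 \<bullet> y) ^ j * (e3 \<bullet> y) ^ k)) \<in> ?S"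
    if "i + j + k + r = n" for a i j k r
    using that
  proof (induction r arbitrary: i j k)
    case 0
    then show ?case using hodge_field_monomial_in_span[OF n _ f, of i j k] by simp
  next
    case (Suc r)
    define g where "g i j k y = (a \<bullet> y) ^ r * ((e1 \<bullet> y) ^ i * (e2 \<bullet> y) ^ j * (e3 \<bullet> y) ^ k)" for i j k y
    have P: "real_polynomial_function (g i j k)" for i j k
      unfolding g_def by (intro polynomial_intros)
    have P1: "real_polynomial_function (\<lambda>y. c * g i j k y)" for c i j k
      by (intro polynomial_intros P)
    have a: "a \<bullet> y = (e1 \<bullet> a) * (e1 \<bullet> y) + (e2 \<bullet> a) * (e2 \<bullet> y) + (e3 \<bullet> a) * (e3 \<bullet> y)" for y
      by (subst frameD(10)[OF f, of a]) (simp add: inner_add_left)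
    have "(a \<bullet> y) ^ Suc r * ((e1 \<bullet> y) ^ i * (e2 \<bullet> y) ^ j * (e3 \<bullet> y) ^ k)
        = (e1 \<bullet> a) * g (Suc i) j k y + (e2 \<bullet> a) * g i (Suc j) k y + (e3 \<bullet> a) * g i j (Suc k) y" for y
    proof -
      have "(a \<bullet> y) ^ Suc r * ((e1 \<bullet> y) ^ i * (e2 \<bullet> y) ^ j * (e3 \<bullet> y) ^ k) = (a \<bullet> y) * g i j k y"
        by (simp add: g_def)
      also have "\<dots> = ((e1 \<bullet> a) * (e1 \<bullet> y) + (e2 \<bullet> a) * (e2 \<bullet> y) + (e3 \<bullet> a) * (e3 \<bullet> y)) * g i j k y"
        by (simp only: a[symmetric])
      also have "\<dots> = (e1 \<bullet> a) * g (Suc i) j k y + (e2 \<bullet> a) * g i (Suc j) k y + (e3 \<bullet> a) * g i j (Suc k) y"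
        by (simp add: g_def algebra_simps)
      finally show ?thesis .
    qed
    then have "hodge_field n (\<lambda>y. (a \<bullet> y) ^ Suc r * ((e1 \<bullet> y) ^ i * (e2 \<bullet> y) ^ j * (e3 \<bullet> y) ^ k))
      = (e1 \<bullet> a) *\<^sub>R hodge_field n (g (Suc i) j k) + (e2 \<bullet> a) *\<^sub>R hodge_field n (g i (Suc j) k) + (e3 \<bullet> a) *\<^sub>R hodge_field n (g i j (Suc k))"
      by (simp only: hodge_field_add[OF polynomial_intros(2)[OF P1 P1] P1] hodge_field_add[OF P1 P1] hodge_field_scale[OF P])
    also have "\<dots> \<in> ?S"
      unfolding g_def by (intro span_add span_scale Suc.IH) (use Suc.prems in auto)
    finally show ?case .
  qed
  from this[of 0 0 0 n] have "hodge_field n (\<lambda>y. (a \<bullet> y) ^ n) \<in> ?S" for a by simp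
  then have "real (Suc m) *\<^sub>R zonal_section m a \<in> ?S" for a
    using hodge_field_power[of m a] m by metis
  then have "inverse (real (Suc m)) *\<^sub>R (real (Suc m) *\<^sub>R zonal_section m a) \<in> ?S" for a by (rule span_scale)
  then show ?thesis using m by (auto simp del: of_nat_Suc)
qed

text \<open>A power \<open>(a \<bullet> y)\<^sup>k\<close> is made homogeneous of degree \<open>n\<close> by a power of \<open>y \<bullet> y\<close>, with positive exponent
because \<open>k < n\<close> has the parity of \<open>n\<close>.\<close>

lemma lower_span_representation:
  assumes "s \<in> lower_span n"
  shows "\<exists>Q. real_polynomial_function Q \<and> s = hodge_field n (\<lambda>y. (y \<bullet> y) * Q y) \<and>
    (\<forall>t y. ((t *\<^sub>R y) \<bullet> (t *\<^sub>R y)) * Q (t *\<^sub>R y) = t ^ n * ((y \<bullet> y) * Q y))"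
  using assms unfolding lower_span_def
proof (induction rule: span_induct_alt)
  case base
  show ?case
    by (rule exI[of _ "\<lambda>y. 0"]) (auto simp: hodge_field_const intro: real_polynomial_function.intros(2))
next
  case (step c x s)
  then obtain Q where Q: "real_polynomial_function Q" "s = hodge_field n (\<lambda>y. (y \<bullet> y) * Q y)"
    "\<And>t y. ((t *\<^sub>R y) \<bullet> (t *\<^sub>R y)) * Q (t *\<^sub>R y) = t ^ n * ((y \<bullet> y) * Q y)" by blast
  obtain k a where k: "1 \<le> k" "k < n" "even k = even n" "x = zonal_section (k - 1) a"
    using step.hyps by auto
  \<comment> \<open>The truncated subtraction is exact: \<open>n - k\<close> is even and at least \<open>2\<close>.\<close>
  define d where "d = (n - k) div 2 - 1"
  have d: "n = k + 2 * Suc d" using k(2,3) unfolding d_def by (cases "n - k = 1") presburger+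
  have pow: "hodge_field n (\<lambda>y. (y \<bullet> y) ^ j * (a \<bullet> y) ^ k) = hodge_field n (\<lambda>y. (a \<bullet> y) ^ k)" for j
  proof (induction j)
    case (Suc j)
    have "real_polynomial_function (\<lambda>y. (y \<bullet> y) ^ j * (a \<bullet> y) ^ k)"
      by (intro polynomial_intros real_polynomial_function_norm2)
    from hodge_field_radial[OF this, of n] Suc show ?case by (simp add: mult.assoc)
  qed simp
  have x: "hodge_field n (\<lambda>y. (y \<bullet> y) ^ Suc d * (a \<bullet> y) ^ k) = real k *\<^sub>R x"
    using hodge_field_power[of "k - 1" a] k hodge_field_parity[OF k(3)] pow[of "Suc d"] by simp
  define R where "R y = Q y + (c / real k) * ((y \<bullet> y) ^ d * (a \<bullet> y) ^ k)" for y
  have P: "real_polynomial_function (\<lambda>y. (y \<bullet> y) * Q y)" "real_polynomial_function (\<lambda>y. (y \<bullet> y) ^ Suc d * (a \<bullet> y) ^ k)"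
    "real_polynomial_function R"
    unfolding R_def by (intro polynomial_intros real_polynomial_function_norm2 Q(1))+
  have eq: "(y \<bullet> y) * R y = (y \<bullet> y) * Q y + (c / real k) * ((y \<bullet> y) ^ Suc d * (a \<bullet> y) ^ k)" for y
    by (simp add: R_def distrib_left)
  have "hodge_field n (\<lambda>y. (y \<bullet> y) * R y) = s + (c / real k) *\<^sub>R (real k *\<^sub>R x)"
    unfolding eq by (subst hodge_field_add) (intro P polynomial_intros | simp only: hodge_field_scale[OF P(2)] Q(2) x)+
  then have "hodge_field n (\<lambda>y. (y \<bullet> y) * R y) = c *\<^sub>R x + s" using k(1) by (simp add: add.commute)
  moreover have "((t *\<^sub>R y) \<bullet> (t *\<^sub>R y)) * R (t *\<^sub>R y) = t ^ n * ((y \<bullet> y) * R y)" for t y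
  proof -
    have "((t *\<^sub>R y) \<bullet> (t *\<^sub>R y)) ^ Suc d * (a \<bullet> (t *\<^sub>R y)) ^ k = t ^ n * ((y \<bullet> y) ^ Suc d * (a \<bullet> y) ^ k)"
      unfolding d by (simp add: power_mult_distrib power_add power_mult power2_eq_square)
    then show ?thesis unfolding eq Q(3) by (simp add: algebra_simps)
  qed
  ultimately show ?case using P(3) by (intro exI[of _ R]) simp
qed

lemma monomial_scale: "p \<in> reduced_exponents n \<Longrightarrow> n \<ge> 1 \<Longrightarrow> monomial e1 e2 e3 n p (t *\<^sub>R y) = t ^ n * monomial e1 e2 e3 n p y"
proof -
  assume "p \<in> reduced_exponents n" "n \<ge> 1"
  then obtain k i where p: "p = (k, i)" and "k \<le> 1" "i \<le> n - k" "n \<ge> 1" by (auto simp: reduced_exponents_def)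
  then have "n = i + (n - k - i) + k" by simp
  then have t: "t ^ n = t ^ i * t ^ (n - k - i) * t ^ k" by (metis power_add)
  show ?thesis by (simp add: p monomial_def power_mult_distrib t)
qed

text \<open>The difference of the two polynomials is constant on the sphere, so by homogeneity it is a multiple of
\<open>\<bar>y\<bar>\<^sup>n\<close>. For odd \<open>n\<close> the multiple is zero by parity, for even \<open>n\<close> it is divisible by \<open>y \<bullet> y\<close>.\<close>

lemma polynomial_divisible_by_norm:
  assumes n: "n \<ge> 1" and P: "real_polynomial_function P" "real_polynomial_function Q"
    and hom: "\<And>t y. P (t *\<^sub>R y) = t ^ n * P y"
      "\<And>t y. ((t *\<^sub>R y) \<bullet> (t *\<^sub>R y)) * Q (t *\<^sub>R y) = t ^ n * ((y \<bullet> y) * Q y)"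
    and eq: "hodge_field n P = hodge_field n (\<lambda>y. (y \<bullet> y) * Q y)"
  shows "\<exists>R. real_polynomial_function R \<and> (\<forall>y. P y = (y \<bullet> y) * R y)"
proof -
  define D where "D y = P y - (y \<bullet> y) * Q y" for y
  have PQ: "real_polynomial_function (\<lambda>y. (y \<bullet> y) * Q y)"
    by (intro polynomial_intros real_polynomial_function_norm2 P)
  have D: "real_polynomial_function D" unfolding D_def by (intro real_polynomial_function_diff P PQ)
  have D0: "hodge_field n D = 0" unfolding D_def hodge_field_diff[OF P(1) PQ] eq by simp
  have Dhom: "D (t *\<^sub>R y) = t ^ n * D y" for t y
    unfolding D_def hom(1) hom(2) by (simp add: right_diff_distrib)
  obtain u :: 'a where u: "norm u = 1" using vector_choose_size[of 1] by auto
  have norm_D: "D y = norm y ^ n * D u" for y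
  proof (cases "y = 0")
    case True
    then show ?thesis using Dhom[of 0 0] n by (cases n) auto
  next
    case False
    have "D y = norm y ^ n * D (y /\<^sub>R norm y)" using Dhom[of "norm y" "y /\<^sub>R norm y"] False by simp
    also have "D (y /\<^sub>R norm y) = D u" by (rule hodge_field_eq_zeroD[OF D D0 u]) (use False in simp)
    finally show ?thesis .
  qed
  show ?thesis
  proof (cases "even n")
    case True
    then obtain l where l: "n = 2 * Suc l" using n by (metis One_nat_def dvdE mult_0_right not0_implies_Suc not_one_le_zero)
    have "P y = (y \<bullet> y) * (Q y + D u * (y \<bullet> y) ^ l)" for y
    proof -
      have "norm y ^ n = (y \<bullet> y) ^ Suc l" unfolding l power_mult power2_norm_eq_inner ..
      then show ?thesis using norm_D[of y] by (simp add: D_def algebra_simps)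
    qed
    moreover have "real_polynomial_function (\<lambda>y. Q y + D u * (y \<bullet> y) ^ l)"
      by (intro polynomial_intros real_polynomial_function_norm2 P)
    ultimately show ?thesis by blast
  next
    case False
    have "D (- u) = - D u" using Dhom[of "-1" u] False by simp
    moreover have "D (- u) = D u" using norm_D[of "- u"] u by simp
    ultimately have "D y = 0" for y using norm_D[of y] by simp
    then show ?thesis using P(2) by (auto simp: D_def)
  qed
qed

text \<open>A combination \<open>P\<close> of the monomials that is congruent to zero modulo lower degrees is divisible by
\<open>y \<bullet> y\<close>. As a polynomial in the third coordinate, \<open>P\<close> has degree at most \<open>1\<close> and \<open>y \<bullet> y\<close> has
degree \<open>2\<close>, so \<open>P\<close> vanishes.\<close>

lemma monomials_independent_mod_lower:
  assumes n: "n \<ge> 1" and f: "frame e1 e2 e3"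
    and L: "(\<Sum>p\<in>reduced_exponents n. c p *\<^sub>R hodge_field n (monomial e1 e2 e3 n p)) \<in> lower_span n"
    and p: "p \<in> reduced_exponents n"
  shows "c p = 0"
proof -
  define P where "P y = (\<Sum>p\<in>reduced_exponents n. c p * monomial e1 e2 e3 n p y)" for y
  have P: "real_polynomial_function P"
    unfolding P_def by (intro polynomial_intros real_polynomial_function_monomial finite_reduced_exponents)
  have "hodge_field n P = (\<Sum>p\<in>reduced_exponents n. c p *\<^sub>R hodge_field n (monomial e1 e2 e3 n p))"
    unfolding P_def by (rule polynomial_linear_sum[OF hodge_field_linear]) auto
  with L have "hodge_field n P \<in> lower_span n" by simp
  from lower_span_representation[OF this] obtain Q where Q: "real_polynomial_function Q" "hodge_field n P = hodge_field n (\<lambda>y. (y \<bullet> y) * Q y)"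
    "\<And>t y. ((t *\<^sub>R y) \<bullet> (t *\<^sub>R y)) * Q (t *\<^sub>R y) = t ^ n * ((y \<bullet> y) * Q y)"
    by blast
  have "P (t *\<^sub>R y) = t ^ n * P y" for t y
    unfolding P_def sum_distrib_left using n by (intro sum.cong) (auto simp: monomial_scale)
  then obtain R where R: "real_polynomial_function R" "\<And>y. P y = (y \<bullet> y) * R y"
    using polynomial_divisible_by_norm[OF n P Q(1) _ Q(3) Q(2)] by blast
  note fD = frameD(1-6)[OF f]
  have unit: "e1 \<bullet> e1 = 1" "e2 \<bullet> e2 = 1" "e3 \<bullet> e3 = 1" using fD by (simp_all add: dot_square_norm)
  have fD': "e2 \<bullet> e1 = 0" "e3 \<bullet> e1 = 0" "e3 \<bullet> e2 = 0" using fD by (simp_all add: inner_commute)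
  define A where "A k r = (\<Sum>i\<le>n - k. r ^ i * c (k, i))" for k :: nat and r :: real
  have A: "A 0 r = 0 \<and> A 1 r = 0" for r
  proof -
    \<comment> \<open>A line in the third direction. The second coordinate is \<open>1\<close>, the first one is the variable \<open>r\<close> in which coefficients are compared at the end.\<close>
    define u where "u = r *\<^sub>R e1 + e2"
    obtain q where q: "\<And>\<tau>. R (u + \<tau> *\<^sub>R e3) = poly q \<tau>"
      using real_polynomial_function_along_line[OF R(1)] by blast
    have "P (u + \<tau> *\<^sub>R e3) = A 0 r + \<tau> * A 1 r" for \<tau>
    proof -
      have co: "e1 \<bullet> (u + \<tau> *\<^sub>R e3) = r" "e2 \<bullet> (u + \<tau> *\<^sub>R e3) = 1" "e3 \<bullet> (u + \<tau> *\<^sub>R e3) = \<tau>"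
        using fD fD' unit by (simp_all add: u_def inner_add_right)
      have "P (u + \<tau> *\<^sub>R e3) = (\<Sum>(k, i)\<in>(SIGMA k:{0, 1}. {..n - k}). c (k, i) * (r ^ i * \<tau> ^ k))"
        unfolding P_def reduced_exponents_def by (intro sum.cong refl) (auto simp: monomial_def co)
      also have "\<dots> = (\<Sum>k\<in>{0, 1}. \<Sum>i\<le>n - k. c (k, i) * (r ^ i * \<tau> ^ k))"
        by (rule sum.Sigma[symmetric]) auto
      finally have "P (u + \<tau> *\<^sub>R e3) = (\<Sum>k\<in>{0, 1}. \<Sum>i\<le>n - k. c (k, i) * (r ^ i * \<tau> ^ k))" .
      then show ?thesis by (simp add: A_def sum_distrib_left ac_simps)
    qed
    moreover have "(u + \<tau> *\<^sub>R e3) \<bullet> (u + \<tau> *\<^sub>R e3) = r\<^sup>2 + 1 + \<tau>\<^sup>2" for \<tau>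
      using fD fD' unit by (simp add: u_def inner_add_left inner_add_right power2_eq_square)
    ultimately have "poly [:A 0 r, A 1 r:] \<tau> = poly ([:r\<^sup>2 + 1, 0, 1:] * q) \<tau>" for \<tau>
      using R(2)[of "u + \<tau> *\<^sub>R e3"] by (simp add: q power2_eq_square algebra_simps)
    then have eq: "[:A 0 r, A 1 r:] = [:r\<^sup>2 + 1, 0, 1:] * q" by (simp add: poly_eq_poly_eq_iff[symmetric] fun_eq_iff)
    have "q = 0"
    proof (rule ccontr)
      assume "q \<noteq> 0"
      then have "degree ([:r\<^sup>2 + 1, 0, 1:] * q) = 2 + degree q" by (subst degree_mult_eq) auto
      moreover have "degree [:A 0 r, A 1 r:] \<le> 1" by simp
      ultimately show False unfolding eq by simp
    qed
    then show ?thesis using eq by simp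
  qed
  obtain k i where ki: "p = (k, i)" "k = 0 \<or> k = 1" "i \<le> n - k" using p by (auto simp: reduced_exponents_def)
  have "(\<Sum>i\<le>n - k. s ^ i *\<^sub>R c (k, i)) \<in> {0}" for s
    using A[of s] ki(2) by (auto simp: A_def)
  from coefficients_in_subspace[OF subspace_single_0 this ki(3)] show ?thesis using ki(1) by simp
qed

end

section \<open>The spectrum\<close>

definition common_lines_eigenvalue :: "nat \<Rightarrow> real" where
  "common_lines_eigenvalue n = (-1) ^ (n - 1) / (real n * (real n + 1))"

lemma abs_common_lines_eigenvalue: "\<bar>common_lines_eigenvalue n\<bar> = 1 / (real n * (real n + 1))"
  by (simp add: common_lines_eigenvalue_def abs_mult power_abs)

lemma common_lines_eigenvalue_nonzero: "n \<ge> 1 \<Longrightarrow> common_lines_eigenvalue n \<noteq> 0"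
  by (simp add: common_lines_eigenvalue_def)

lemma inj_common_lines_eigenvalue: "inj_on common_lines_eigenvalue {1..}"
proof (rule inj_onI)
  fix m n :: nat
  assume mn: "m \<in> {1..}" "n \<in> {1..}" and "common_lines_eigenvalue m = common_lines_eigenvalue n"
  then have "1 / (real m * (real m + 1)) = 1 / (real n * (real n + 1))"
    by (metis abs_common_lines_eigenvalue)
  then have eq: "real m * (real m + 1) = real n * (real n + 1)" using mn by (simp add: field_simps)
  have "real k * (real k + 1) < real l * (real l + 1)" if "k < l" for k l
    using that by (intro mult_strict_mono) auto
  then show "m = n" using eq by (metis less_irrefl nat_neq_iff)
qed

lemma common_lines_eigenvalue_tendsto: "common_lines_eigenvalue \<longlonglongrightarrow> 0"
proof (rule tendsto_rabs_zero_cancel)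
  have "(\<lambda>n. 1 / (real n * (real n + 1))) \<longlonglongrightarrow> 0" by real_asymp
  then show "(\<lambda>n. \<bar>common_lines_eigenvalue n\<bar>) \<longlonglongrightarrow> 0" by (simp add: abs_common_lines_eigenvalue)
qed

text \<open>Half of \<open>\<bar>\<mu>\<bar>\<close> works for \<open>0\<close> and for all but finitely many \<open>lam n\<close>.\<close>

lemma eigenvalues_gap:
  assumes lim: "lam \<longlonglongrightarrow> (0::real)" and mu: "\<mu> \<notin> lam ` {1..} \<union> {0}"
  obtains \<delta> where "\<delta> > 0" "\<And>\<nu>. \<nu> \<in> lam ` {1..} \<union> {0} \<Longrightarrow> \<delta> \<le> \<bar>\<nu> - \<mu>\<bar>"
proof -
  have "\<mu> \<noteq> 0" using mu by auto
  then obtain N where N: "\<And>n. n \<ge> N \<Longrightarrow> \<bar>lam n\<bar> < \<bar>\<mu>\<bar> / 2"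
    using LIMSEQ_D[OF lim, of "\<bar>\<mu>\<bar> / 2"] by auto
  define A where "A = insert (\<bar>\<mu>\<bar> / 2) ((\<lambda>n. \<bar>lam n - \<mu>\<bar>) ` {1..<N})"
  have A: "finite A" "A \<noteq> {}" by (auto simp: A_def)
  have pos: "Min A > 0" using A mu \<open>\<mu> \<noteq> 0\<close> by (subst Min_gr_iff) (auto simp: A_def)
  have half: "Min A \<le> \<bar>\<mu>\<bar> / 2" using A by (intro Min_le) (auto simp: A_def)
  have "Min A \<le> \<bar>\<nu> - \<mu>\<bar>" if nu: "\<nu> \<in> lam ` {1..} \<union> {0}" for \<nu>
  proof (cases "\<bar>\<nu>\<bar> \<le> \<bar>\<mu>\<bar> / 2")
    case True
    then show ?thesis using half by linarith
  next
    case False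
    then obtain n where n: "n \<ge> 1" "\<nu> = lam n" using nu by auto
    then have "n < N" using N[of n] False by (cases "n < N") auto
    then show ?thesis using n A(1) by (intro Min_le) (auto simp: A_def)
  qed
  then show thesis using that pos by blast
qed

context cross_product begin

lemma common_lines_spectrum:
  fixes C :: "'a section_space \<Rightarrow> 'a section_space"
  defines "C \<equiv> common_lines_operator" and "lam \<equiv> common_lines_eigenvalue"
  shows "closure (span (\<Union>\<nu>\<in>lam ` {1..} \<union> {0}. eigenspace C \<nu>)) = UNIV"
    and "n \<ge> 1 \<Longrightarrow> dim (eigenspace C (lam n)) = 2 * n + 1"
    and "eigenspace C 0 \<noteq> {0}"
proof -
  obtain e1 :: 'a where e1: "norm e1 = 1" using vector_choose_size[of 1] by auto
  obtain e2 e3 where f: "frame e1 e2 e3" by (rule frame_exists[OF e1])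
  interpret triangular_operator C lam zonal_sections reduced_exponents
    "\<lambda>n p. hodge_field n (monomial e1 e2 e3 n p)" lower_span
  proof (rule triangular_operator.intro)
    show "linear C" unfolding C_def
      by (rule bounded_linear.linear[OF bounded_linear_common_lines_operator])
    show "C s \<bullet> t = s \<bullet> C t" for s t unfolding C_def by (rule common_lines_operator_symmetric)
    show "inj_on lam {1..}" unfolding lam_def by (rule inj_common_lines_eigenvalue)
    show "lam n \<noteq> 0" if "n \<ge> 1" for n unfolding lam_def by (rule common_lines_eigenvalue_nonzero[OF that])
    show "C x - lam n *\<^sub>R x \<in> lower_span n" if "n \<ge> 1" "x \<in> zonal_sections n" for n x
      unfolding C_def lam_def common_lines_eigenvalue_def by (rule common_lines_operator_triangular[OF that])
    show "(\<lambda>p. hodge_field n (monomial e1 e2 e3 n p)) ` reduced_exponents n \<subseteq> span (zonal_sections n)"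
      if n: "n \<ge> 1" for n
    proof (rule image_subsetI)
      fix p assume "p \<in> reduced_exponents n"
      then obtain k i where p: "p = (k, i)" "i + (n - k - i) + k = n"
        using n by (auto simp: reduced_exponents_def)
      show "hodge_field n (monomial e1 e2 e3 n p) \<in> span (zonal_sections n)"
        using hodge_field_homogeneous[OF n p(2)] by (simp add: p(1) monomial_def)
    qed
    show "zonal_sections n \<subseteq> span ((\<lambda>p. hodge_field n (monomial e1 e2 e3 n p)) ` reduced_exponents n \<union> lower_span n)"
      if "n \<ge> 1" for n
      by (rule zonal_sections_generated[OF that f])
    show "c i = 0" if "n \<ge> 1" "(\<Sum>i\<in>reduced_exponents n. c i *\<^sub>R hodge_field n (monomial e1 e2 e3 n i)) \<in> lower_span n"
      "i \<in> reduced_exponents n" for n c i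
      by (rule monomials_independent_mod_lower[OF that(1) f that(2,3)])
    show "closure (span (eigenspace C 0 \<union> (\<Union>n\<in>{1..}. zonal_sections n))) = UNIV"
      unfolding C_def by (rule zonal_sections_dense)
  qed (simp_all add: lower_span_def)
  show "closure (span (\<Union>\<nu>\<in>lam ` {1..} \<union> {0}. eigenspace C \<nu>)) = UNIV" by (rule eigenspaces_dense)
  show "dim (eigenspace C (lam n)) = 2 * n + 1" if "n \<ge> 1"
    using dim_eigenspace[OF that] card_reduced_exponents[OF that] by simp
  show "eigenspace C 0 \<noteq> {0}"
  proof
    \<comment> \<open>An odd field that does not vanish at the point \<open>e1\<close>.\<close>
    assume eq: "eigenspace C 0 = {0}"
    have fD: "e1 \<bullet> e2 = 0" "norm e2 = 1" "norm e1 = 1" using frameD(1,2,4)[OF f] by auto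
    have "tangential_section (\<lambda>y. (e1 \<bullet> y) ^ 1 *\<^sub>R e2) \<in> eigenspace C 0"
      unfolding C_def by (rule tangential_section_power_odd) simp
    then have "tangential_section (\<lambda>y. (e1 \<bullet> y) ^ 1 *\<^sub>R e2) = 0" using eq by simp
    then have "tangential_part (\<lambda>y. (e1 \<bullet> y) ^ 1 *\<^sub>R e2) e1 = 0"
      by (intro tangential_section_eq_zeroD fD(3)) (intro continuous_intros)
    then show False using fD by (auto simp: tangential_part_def dot_square_norm inner_commute[of e2])
  qed
qed

end

theorem theorem3:
  fixes C :: "'a::euclidean_space section_space \<Rightarrow> 'a section_space"
    and lam :: "nat \<Rightarrow> real"
  assumes "DIM('a) = 3"
    and "C = common_lines_operator"
    and "\<And>n. n \<ge> 1 \<Longrightarrow> lam n = (-1) ^ (n - 1) / (real n * (real n + 1))"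
  shows "has_discrete_spectrum C \<and> spectrum C = lam ` {1..} \<union> {0} \<and>
    (\<forall>n\<ge>1. dim (eigenspace C (lam n)) = 2 * n + 1)"
proof -
  obtain cross :: "'a \<Rightarrow> 'a \<Rightarrow> 'a" where "cross_product cross"
    using cross_product_exists[OF assms(1)] by blast
  then interpret cross_product cross .
  have lam: "lam n = common_lines_eigenvalue n" if "n \<ge> 1" for n
    using assms(3)[OF that] by (simp add: common_lines_eigenvalue_def)
  have range_lam: "lam ` {1..} = common_lines_eigenvalue ` {1..}" using lam by (intro image_cong) auto
  note spec = common_lines_spectrum[folded assms(2)]
  have lin: "bounded_linear C" unfolding assms(2) by (rule bounded_linear_common_lines_operator)
  have sym: "C s \<bullet> t = s \<bullet> C t" for s t unfolding assms(2) by (rule common_lines_operator_symmetric)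
  have dims: "dim (eigenspace C (lam n)) = 2 * n + 1" if "n \<ge> 1" for n
    using spec(2)[OF that] lam[OF that] by simp
  have nontrivial: "eigenspace C \<nu> \<noteq> {0}" if nu: "\<nu> \<in> lam ` {1..} \<union> {0}" for \<nu>
  proof (cases "\<nu> = 0")
    case True
    then show ?thesis using spec(3) by simp
  next
    case False
    then obtain n where n: "n \<ge> 1" "\<nu> = lam n" using nu by auto
    show ?thesis
    proof
      assume "eigenspace C \<nu> = {0}"
      then have "dim (eigenspace C \<nu>) = 0" using dim_eq_card[of "{}" "eigenspace C \<nu>"] by (simp add: independent_empty)
      then show False using dims[OF n(1)] n(2) by simp
    qed
  qed
  have spectrum: "spectrum C = lam ` {1..} \<union> {0}"
  proof (rule set_eqI, rule iffI)
    fix \<mu> assume "\<mu> \<in> lam ` {1..} \<union> {0}"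
    then show "\<mu> \<in> spectrum C"
      by (intro spectrum_if_eigenvalue nontrivial bounded_linear.linear[OF lin])
  next
    fix \<mu> assume mu: "\<mu> \<in> spectrum C"
    show "\<mu> \<in> lam ` {1..} \<union> {0}"
    proof (rule ccontr)
      assume "\<mu> \<notin> lam ` {1..} \<union> {0}"
      then obtain \<delta> where \<delta>: "\<delta> > 0" "\<And>\<nu>. \<nu> \<in> common_lines_eigenvalue ` {1..} \<union> {0} \<Longrightarrow> \<delta> \<le> \<bar>\<nu> - \<mu>\<bar>"
        unfolding range_lam using eigenvalues_gap[OF common_lines_eigenvalue_tendsto] by blast
      have "\<mu> \<notin> spectrum C" using resolvent_exists[OF lin sym spec(1) \<delta>(2) \<delta>(1)] by blast
      then show False using mu by blast
    qed
  qed
  have "has_discrete_spectrum C"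
    unfolding has_discrete_spectrum_def spectrum
  proof (intro conjI ballI)
    show "closure (span (\<Union>\<mu>\<in>lam ` {1..} \<union> {0}. eigenspace C \<mu>)) = UNIV"
      unfolding range_lam by (rule spec(1))
  qed (rule nontrivial)
  then show ?thesis using spectrum dims by blast
qed

end
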